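(* Let $q$ be a power of $2$ and let $a\in\mathbb{F}_q$ be such that $T^2+T+a$ is irreducible in $\mathbb{F}_q[T]$. Let $G_1\le O^-(2m+2,q)$ be the group of all matrices $N=\begin{pmatrix}A&0&0\\ B&I_2&0\\ C&D&E\end{pmatrix}\in U(2m+2,\mathbb{F}_q)$, with $A,E\in U(m,\mathbb{F}_q)$, such that $N^TJ_{2m+2}N=J_{2m+2}$ and $S=A^TJ_mC$ satisfies $s_{ii}=b_{1i}^2+b_{1i}b_{2i}+a\,b_{2i}^2$ for $i=1,\dots,m$. Let $h_1=\sum_{i=1}^{m}x_{2m+3-i}x_i+x_{m+1}^2+x_{m+1}x_{m+2}+ax_{m+2}^2$ and, for $k\ge2$, $h_k=\sum_{i=1}^{m+1}\left(x_{2m+3-i}^{q^{k-1}}x_i+x_{2m+3-i}x_i^{q^{k-1}}\right)$. Then the invariant field of $G_1$ is generated by the polynomials $N(x_i)$, $i=1,\dots,m+2$, and $h_k$, $k=1,\dots,m$; i.e. $$\mathbb{F}_q(V)^{G_1}=\mathbb{F}_q(x_1,N(x_2),\dots,N(x_{m+2}),h_1,\dots,h_m).$$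
   Context: $m\ge 1$, $V=\mathbb{F}_q^{2m+2}$ (column vectors) with $x_1,\dots,x_{2m+2}$ the dual basis of the standard basis; $\mathbb{F}_q[V]=\mathbb{F}_q[x_1,\dots,x_{2m+2}]$, $\mathbb{F}_q(V)$ is its fraction field, and $G_1$ acts by $(g\cdot f)(v)=f(g^{-1}v)$. $N(x_i)=\prod_{y\in G_1\cdot x_i}y$ is the product over the $G_1$-orbit of $x_i$ (so $N(x_1)=x_1$). $U(n,\mathbb{F})$ is the group of lower triangular $n\times n$ matrices over $\mathbb{F}$ with ones on the diagonal; $J_n$ is the $n\times n$ matrix with ones on the antidiagonal and zeros elsewhere; $b_{ij}$, $s_{ij}$ are the entries of the $2\times m$ matrix $B$ and of $S$. $O^-(2m+2,q)$ is the group of invertible matrices preserving the quadratic form $h_1$ on $V$. *)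

theory Defs
  imports
    "HOL-Library.Cardinality"
    "HOL-Library.Poly_Mapping"
    "HOL-Algebra.Generated_Fields"
    "HOL-Algebra.Algebraic_Closure_Type"
    "HOL-Computational_Algebra.Fraction_Field"
    "HOL-Computational_Algebra.Polynomial_Factorial"
    "Jordan_Normal_Form.Determinant"
begin

no_notation fps_nth (infixl \<open>$\<close> 75)
no_notation fls_nth (infixl \<open>$$\<close> 75)

section \<open>Polynomials and rational functions\<close>

text \<open>
  Polynomials over \<open>'a\<close> in variables \<open>x\<^sub>i\<close> indexed by all natural numbers \<open>i\<close>; this type is an
  integral domain, so its fraction field is available as \<open>'a mpoly fract\<close>.
  The rings and fields in \<open>x\<^sub>1, \<dots>, x\<^sub>n\<close> are the subsets \<open>polys n\<close> and \<open>ratfuns n\<close>.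
\<close>

type_synonym 'a mpoly = "(nat \<Rightarrow>\<^sub>0 nat) \<Rightarrow>\<^sub>0 'a"

definition Var :: "nat \<Rightarrow> 'a::zero_neq_one mpoly" where
  "Var i = Poly_Mapping.single (Poly_Mapping.single i 1) 1"

definition Const :: "'a::zero \<Rightarrow> 'a mpoly" where
  "Const c = Poly_Mapping.single 0 c"

definition mpoly_eval :: "('a::zero \<Rightarrow> 'b::comm_ring_1) \<Rightarrow> (nat \<Rightarrow> 'b) \<Rightarrow> 'a mpoly \<Rightarrow> 'b" where
  "mpoly_eval \<kappa> \<sigma> p =
    (\<Sum>\<mu>\<in>Poly_Mapping.keys p. \<kappa> (Poly_Mapping.lookup p \<mu>) * (\<Prod>i\<in>Poly_Mapping.keys \<mu>. \<sigma> i ^ Poly_Mapping.lookup \<mu> i))"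

definition polys :: "nat \<Rightarrow> 'a::zero mpoly set" where
  "polys n = {p. \<forall>\<mu>\<in>Poly_Mapping.keys p. Poly_Mapping.keys \<mu> \<subseteq> {1..n}}"

definition ratfuns :: "nat \<Rightarrow> 'a::idom mpoly fract set" where
  "ratfuns n = {Fract p h | p h. p \<in> polys n \<and> h \<in> polys n \<and> h \<noteq> 0}"

text \<open>The subfield generated by \<open>H\<close> over the constants.\<close>

definition field_gen :: "'a::idom mpoly fract set \<Rightarrow> 'a mpoly fract set" where
  "field_gen H = generate_field ring_of_type_algebra (range (\<lambda>c. to_fract (Const c)) \<union> H)"


section \<open>The action of matrices\<close>

text \<open>
  Matrices and vectors are indexed from 0, variables from 1: \<open>x\<^sub>i\<close> is the coordinate \<open>v $ (i - 1)\<close>.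
\<close>

definition point_eval :: "'a::comm_ring_1 vec \<Rightarrow> 'a mpoly \<Rightarrow> 'a" where
  "point_eval v = mpoly_eval (\<lambda>c. c) (\<lambda>i. v $ (i - 1))"

text \<open>
  \<open>(g \<cdot> f)(v) = f(g\<^sup>-\<^sup>1 v)\<close>, read as an identity of polynomials (over a finite field a polynomial
  is not determined by its values): \<open>g \<cdot> x\<^sub>i = \<Sum>\<^sub>j (g\<^sup>-\<^sup>1)\<^sub>i\<^sub>j x\<^sub>j\<close>, extended to polynomials by
  substitution. Lemma \<open>point_eval_mpoly_act\<close> recovers the pointwise formula.
\<close>

definition mpoly_act :: "nat \<Rightarrow> 'a::field mat \<Rightarrow> 'a mpoly \<Rightarrow> 'a mpoly" where
  "mpoly_act n g = mpoly_eval Const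
     (\<lambda>i. \<Sum>j=1..n. Const (the (mat_inverse g) $$ (i - 1, j - 1)) * Var j)"

text \<open>
  The induced action on \<open>ratfuns n\<close>, \<open>g \<cdot> (p/h) = (g \<cdot> p)/(g \<cdot> h)\<close>; lemma \<open>ratfun_act_Fract\<close> shows
  that it is well defined for invertible \<open>g\<close>.
\<close>

definition ratfun_act :: "nat \<Rightarrow> 'a::field mat \<Rightarrow> 'a mpoly fract \<Rightarrow> 'a mpoly fract" where
  "ratfun_act n g f = (THE r. \<exists>p\<in>polys n. \<exists>h\<in>polys n.
     h \<noteq> 0 \<and> f = Fract p h \<and> r = Fract (mpoly_act n g p) (mpoly_act n g h))"

definition invariant_field :: "nat \<Rightarrow> 'a::field mat set \<Rightarrow> 'a mpoly fract set" where
  "invariant_field n G = {f \<in> ratfuns n. \<forall>g\<in>G. ratfun_act n g f = f}"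

definition orbit_product :: "nat \<Rightarrow> 'a::field mat set \<Rightarrow> 'a mpoly \<Rightarrow> 'a mpoly" where
  "orbit_product n G f = (\<Prod>y\<in>(\<lambda>g. mpoly_act n g f) ` G. y)"


section \<open>The orthogonal group and the group \<open>G\<^sub>1\<close>\<close>

definition h_poly :: "nat \<Rightarrow> 'a::{finite,field} \<Rightarrow> nat \<Rightarrow> 'a mpoly" where
  "h_poly m a k =
    (if k = 1 then
       (\<Sum>i=1..m. Var (2*m+3-i) * Var i)
         + Var (m+1) ^ 2 + Var (m+1) * Var (m+2) + Const a * Var (m+2) ^ 2
     else
       (\<Sum>i=1..m+1. Var (2*m+3-i) ^ (CARD('a) ^ (k-1)) * Var i
                    + Var (2*m+3-i) * Var i ^ (CARD('a) ^ (k-1))))"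

definition O_minus :: "nat \<Rightarrow> 'a::{finite,field} \<Rightarrow> 'a mat set" where
  "O_minus m a = {N \<in> carrier_mat (2*m+2) (2*m+2). invertible_mat N \<and>
     (\<forall>v\<in>carrier_vec (2*m+2). point_eval (N *\<^sub>v v) (h_poly m a 1) = point_eval v (h_poly m a 1))}"

definition unitri :: "nat \<Rightarrow> 'a::zero_neq_one mat set" where
  "unitri n = {N \<in> carrier_mat n n.
     (\<forall>i<n. N $$ (i,i) = 1) \<and> (\<forall>i<n. \<forall>j<n. i < j \<longrightarrow> N $$ (i,j) = 0)}"

definition antidiag :: "nat \<Rightarrow> 'a::zero_neq_one mat" where
  "antidiag n = mat n n (\<lambda>(i,j). if i + j = n - 1 then 1 else 0)"

text \<open>The block matrix with rows \<open>(A, 0, 0)\<close>, \<open>(B, I\<^sub>2, 0)\<close>, \<open>(C, D, E)\<close>.\<close>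

definition block_mat :: "nat \<Rightarrow> 'a::zero_neq_one mat \<Rightarrow> 'a mat \<Rightarrow> 'a mat \<Rightarrow> 'a mat \<Rightarrow> 'a mat \<Rightarrow> 'a mat" where
  "block_mat m A B C D E =
     four_block_mat A (0\<^sub>m m (2+m)) (B @\<^sub>r C) (four_block_mat (1\<^sub>m 2) (0\<^sub>m 2 m) D E)"

text \<open>
  Membership in \<open>O_minus m a\<close> is not imposed, since the listed conditions imply it
  (lemma \<open>G1_subset_O_minus\<close>).
\<close>

definition G1 :: "nat \<Rightarrow> 'a::{finite,field} \<Rightarrow> 'a mat set" where
  "G1 m a = {N \<in> unitri (2*m+2). \<exists>A B C D E.
     A \<in> unitri m \<and> E \<in> unitri m \<and>
     B \<in> carrier_mat 2 m \<and> C \<in> carrier_mat m m \<and> D \<in> carrier_mat m 2 \<and>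
     N = block_mat m A B C D E \<and>
     transpose_mat N * antidiag (2*m+2) * N = antidiag (2*m+2) \<and>
     (let S = transpose_mat A * antidiag m * C in
       \<forall>i<m. S $$ (i,i) = (B $$ (0,i))^2 + B $$ (0,i) * B $$ (1,i) + a * (B $$ (1,i))^2)}"


section \<open>Consistency of the definitions\<close>

abbreviation (input) monom_eval :: "(nat \<Rightarrow> 'b::comm_ring_1) \<Rightarrow> (nat \<Rightarrow>\<^sub>0 nat) \<Rightarrow> 'b" where
  "monom_eval \<sigma> \<mu> \<equiv> (\<Prod>i\<in>Poly_Mapping.keys \<mu>. \<sigma> i ^ Poly_Mapping.lookup \<mu> i)"

lemma monom_eval_superset:
  assumes "finite S" "Poly_Mapping.keys \<mu> \<subseteq> S"
  shows "monom_eval \<sigma> \<mu> = (\<Prod>i\<in>S. \<sigma> i ^ Poly_Mapping.lookup \<mu> i)"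
  by (rule prod.mono_neutral_left) (use assms in \<open>auto simp: in_keys_iff\<close>)

lemma monom_eval_add: "monom_eval \<sigma> (\<mu> + \<nu>) = monom_eval \<sigma> \<mu> * monom_eval \<sigma> \<nu>"
proof -
  let ?S = "Poly_Mapping.keys \<mu> \<union> Poly_Mapping.keys \<nu>"
  have "monom_eval \<sigma> (\<mu> + \<nu>) = (\<Prod>i\<in>?S. \<sigma> i ^ Poly_Mapping.lookup (\<mu> + \<nu>) i)"
    by (rule monom_eval_superset) (auto dest: subsetD[OF Poly_Mapping.keys_add])
  also have "\<dots> = (\<Prod>i\<in>?S. \<sigma> i ^ Poly_Mapping.lookup \<mu> i) * (\<Prod>i\<in>?S. \<sigma> i ^ Poly_Mapping.lookup \<nu> i)"
    by (simp add: lookup_add power_add prod.distrib)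
  also have "\<dots> = monom_eval \<sigma> \<mu> * monom_eval \<sigma> \<nu>"
    by (simp add: monom_eval_superset[of ?S \<mu>] monom_eval_superset[of ?S \<nu>])
  finally show ?thesis .
qed

lemma mpoly_eval_superset:
  assumes "\<kappa> 0 = 0" "finite S" "Poly_Mapping.keys p \<subseteq> S"
  shows "mpoly_eval \<kappa> \<sigma> p = (\<Sum>\<mu>\<in>S. \<kappa> (Poly_Mapping.lookup p \<mu>) * monom_eval \<sigma> \<mu>)"
  unfolding mpoly_eval_def
  by (rule sum.mono_neutral_left) (use assms in \<open>auto simp: in_keys_iff\<close>)

lemma mpoly_eval_single:
  "\<kappa> 0 = 0 \<Longrightarrow> mpoly_eval \<kappa> \<sigma> (Poly_Mapping.single \<mu> c) = \<kappa> c * monom_eval \<sigma> \<mu>"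
  by (subst mpoly_eval_superset[of _ "{\<mu>}"]) auto

lemma mpoly_expand:
  "p = (\<Sum>\<mu>\<in>Poly_Mapping.keys p. Poly_Mapping.single \<mu> (Poly_Mapping.lookup p \<mu>))"
proof (rule poly_mapping_eqI)
  fix \<nu>
  have "(\<Sum>\<mu>\<in>Poly_Mapping.keys p. Poly_Mapping.lookup (Poly_Mapping.single \<mu> (Poly_Mapping.lookup p \<mu>)) \<nu>)
     = (\<Sum>\<mu>\<in>Poly_Mapping.keys p. if \<mu> = \<nu> then Poly_Mapping.lookup p \<mu> else 0)"
    by (rule sum.cong) (auto simp: lookup_single when_def)
  then show "Poly_Mapping.lookup p \<nu> =
      Poly_Mapping.lookup (\<Sum>\<mu>\<in>Poly_Mapping.keys p. Poly_Mapping.single \<mu> (Poly_Mapping.lookup p \<mu>)) \<nu>"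
    by (simp add: lookup_sum in_keys_iff)
qed

lemma mpoly_eval_hom:
  assumes "comm_ring_hom \<kappa>"
  shows "comm_ring_hom (mpoly_eval \<kappa> \<sigma>)"
proof -
  interpret \<kappa>: comm_ring_hom \<kappa> by fact
  have add: "mpoly_eval \<kappa> \<sigma> (p + q) = mpoly_eval \<kappa> \<sigma> p + mpoly_eval \<kappa> \<sigma> q" for p q
  proof -
    let ?S = "Poly_Mapping.keys p \<union> Poly_Mapping.keys q"
    have "mpoly_eval \<kappa> \<sigma> (p + q) = (\<Sum>\<mu>\<in>?S. \<kappa> (Poly_Mapping.lookup (p + q) \<mu>) * monom_eval \<sigma> \<mu>)"
      by (rule mpoly_eval_superset) (auto dest: subsetD[OF Poly_Mapping.keys_add])
    then show ?thesis
      by (simp add: mpoly_eval_superset[of \<kappa> ?S p] mpoly_eval_superset[of \<kappa> ?S q]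
          lookup_add \<kappa>.hom_add distrib_right sum.distrib)
  qed
  have zero: "mpoly_eval \<kappa> \<sigma> 0 = 0"
    by (simp add: mpoly_eval_def)
  have sum: "mpoly_eval \<kappa> \<sigma> (\<Sum>x\<in>I. f x) = (\<Sum>x\<in>I. mpoly_eval \<kappa> \<sigma> (f x))"
    for f :: "(nat \<Rightarrow>\<^sub>0 nat) \<Rightarrow> 'a mpoly" and I
    by (induction I rule: infinite_finite_induct) (auto simp: zero add)
  have mult: "mpoly_eval \<kappa> \<sigma> (p * q) = mpoly_eval \<kappa> \<sigma> p * mpoly_eval \<kappa> \<sigma> q" for p q
  proof -
    have "p * q = (\<Sum>\<mu>\<in>Poly_Mapping.keys p. \<Sum>\<nu>\<in>Poly_Mapping.keys q.
        Poly_Mapping.single (\<mu> + \<nu>) (Poly_Mapping.lookup p \<mu> * Poly_Mapping.lookup q \<nu>))"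
      using arg_cong2[where f = "(*)", OF mpoly_expand[of p] mpoly_expand[of q]]
      by (simp only: sum_product mult_single)
    then have "mpoly_eval \<kappa> \<sigma> (p * q) = (\<Sum>\<mu>\<in>Poly_Mapping.keys p. \<Sum>\<nu>\<in>Poly_Mapping.keys q.
        \<kappa> (Poly_Mapping.lookup p \<mu>) * \<kappa> (Poly_Mapping.lookup q \<nu>) * (monom_eval \<sigma> \<mu> * monom_eval \<sigma> \<nu>))"
      by (simp add: sum mpoly_eval_single monom_eval_add \<kappa>.hom_mult)
    then show ?thesis
      by (simp only: mpoly_eval_def sum_product mult.assoc mult.left_commute)
  qed
  have one: "mpoly_eval \<kappa> \<sigma> 1 = 1"
    unfolding single_one[symmetric] by (subst mpoly_eval_single) auto
  show ?thesis
    by unfold_locales (auto simp: add zero mult one)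
qed

lemma comm_ring_hom_Const: "comm_ring_hom (Const :: 'a::comm_ring_1 \<Rightarrow> 'a mpoly)"
  by unfold_locales (auto simp: Const_def single_add mult_single)

lemma comm_ring_hom_ident: "comm_ring_hom (\<lambda>c::'a::comm_ring_1. c)"
  by unfold_locales auto

lemma mpoly_eval_Var:
  assumes "comm_ring_hom \<kappa>"
  shows "mpoly_eval \<kappa> \<sigma> (Var i) = \<sigma> i"
proof -
  interpret comm_ring_hom \<kappa> by fact
  show ?thesis unfolding Var_def by (subst mpoly_eval_single) auto
qed

lemma mpoly_eval_Const:
  assumes "comm_ring_hom \<kappa>"
  shows "mpoly_eval \<kappa> \<sigma> (Const c) = \<kappa> c"
proof -
  interpret comm_ring_hom \<kappa> by fact
  show ?thesis unfolding Const_def by (subst mpoly_eval_single) auto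
qed

lemma mpoly_eval_compose:
  assumes "comm_ring_hom \<tau>"
  shows "\<tau> (mpoly_eval \<kappa> \<sigma> p) = mpoly_eval (\<lambda>c. \<tau> (\<kappa> c)) (\<lambda>i. \<tau> (\<sigma> i)) p"
proof -
  interpret comm_ring_hom \<tau> by fact
  show ?thesis
    by (simp add: mpoly_eval_def hom_sum hom_mult hom_prod hom_power)
qed

lemma mpoly_eval_cong:
  assumes "p \<in> polys n" "\<And>c. \<kappa> c = \<kappa>' c" "\<And>i. 1 \<le> i \<Longrightarrow> i \<le> n \<Longrightarrow> \<sigma> i = \<sigma>' i"
  shows "mpoly_eval \<kappa> \<sigma> p = mpoly_eval \<kappa>' \<sigma>' p"
  unfolding mpoly_eval_def
proof (intro sum.cong arg_cong2[where f="(*)"] prod.cong refl)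
  fix \<mu> i assume "\<mu> \<in> Poly_Mapping.keys p" "i \<in> Poly_Mapping.keys \<mu>"
  with assms(1) have "i \<in> {1..n}" unfolding polys_def by blast
  with assms(3) show "\<sigma> i ^ Poly_Mapping.lookup \<mu> i = \<sigma>' i ^ Poly_Mapping.lookup \<mu> i" by simp
qed (simp add: assms(2))

lemma mpoly_eval_Const_Var: "mpoly_eval Const Var p = (p :: 'a::comm_ring_1 mpoly)"
proof -
  have pow: "Var i ^ k = (Poly_Mapping.single (Poly_Mapping.single i k) 1 :: 'a mpoly)" for i k
    by (induction k) (auto simp: Var_def mult_single simp flip: single_add)
  have prod: "(\<Prod>i\<in>I. Poly_Mapping.single (f i) (1::'a)) = Poly_Mapping.single (\<Sum>i\<in>I. f i) 1"
    for f :: "nat \<Rightarrow> nat \<Rightarrow>\<^sub>0 nat" and I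
    by (induction I rule: infinite_finite_induct) (auto simp: mult_single)
  have exp: "(\<Sum>i\<in>Poly_Mapping.keys \<mu>. Poly_Mapping.single i (Poly_Mapping.lookup \<mu> i)) = \<mu>"
    for \<mu> :: "nat \<Rightarrow>\<^sub>0 nat"
  proof (rule poly_mapping_eqI)
    fix j
    have "(\<Sum>i\<in>Poly_Mapping.keys \<mu>. Poly_Mapping.lookup (Poly_Mapping.single i (Poly_Mapping.lookup \<mu> i)) j)
       = (\<Sum>i\<in>Poly_Mapping.keys \<mu>. if i = j then Poly_Mapping.lookup \<mu> i else 0)"
      by (rule sum.cong) (auto simp: lookup_single when_def)
    then show "Poly_Mapping.lookup (\<Sum>i\<in>Poly_Mapping.keys \<mu>. Poly_Mapping.single i (Poly_Mapping.lookup \<mu> i)) j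
       = Poly_Mapping.lookup \<mu> j"
      by (simp add: lookup_sum in_keys_iff)
  qed
  have "monom_eval Var \<mu> = (Poly_Mapping.single \<mu> 1 :: 'a mpoly)" for \<mu>
    by (simp add: pow prod exp)
  then have "mpoly_eval Const Var p =
      (\<Sum>\<mu>\<in>Poly_Mapping.keys p. Poly_Mapping.single \<mu> (Poly_Mapping.lookup p \<mu>))"
    by (simp add: mpoly_eval_def Const_def mult_single)
  then show ?thesis
    by (simp flip: mpoly_expand)
qed

lemma mat_inverse_invertible:
  fixes g :: "'a::field mat"
  assumes g: "g \<in> carrier_mat n n" and inv: "invertible_mat g"
  shows "the (mat_inverse g) \<in> carrier_mat n n"
    and "g * the (mat_inverse g) = 1\<^sub>m n" and "the (mat_inverse g) * g = 1\<^sub>m n"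
proof -
  from inv obtain B where B: "g * B = 1\<^sub>m (dim_row g)" "B * g = 1\<^sub>m (dim_row B)"
    by (auto simp: invertible_mat_def inverts_mat_def)
  have "dim_row B = n" "dim_col B = n"
    using B g by (metis carrier_matD index_mult_mat index_one_mat)+
  then have "g \<in> Units (ring_mat TYPE('a) n ())"
    using B g by (auto simp: Units_def ring_mat_def intro!: bexI[of _ B])
  with mat_inverse(1)[OF g] obtain G where "mat_inverse g = Some G" by fastforce
  with mat_inverse(2)[OF g this]
  show "the (mat_inverse g) \<in> carrier_mat n n"
    and "g * the (mat_inverse g) = 1\<^sub>m n" and "the (mat_inverse g) * g = 1\<^sub>m n" by auto
qed

lemma comm_ring_hom_mpoly_act: "comm_ring_hom (mpoly_act n g)"
  unfolding mpoly_act_def by (rule mpoly_eval_hom[OF comm_ring_hom_Const])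

lemma point_eval_mpoly_act:
  assumes g: "g \<in> carrier_mat n n" "invertible_mat g" and v: "v \<in> carrier_vec n" and p: "p \<in> polys n"
  shows "point_eval v (mpoly_act n g p) = point_eval (the (mat_inverse g) *\<^sub>v v) p"
proof -
  let ?G = "the (mat_inverse g)"
  have G: "?G \<in> carrier_mat n n" using mat_inverse_invertible[OF g] by simp
  interpret E: comm_ring_hom "mpoly_eval (\<lambda>c. c) (\<lambda>i. v $ (i - 1))"
    by (rule mpoly_eval_hom[OF comm_ring_hom_ident])
  show ?thesis
    unfolding point_eval_def mpoly_act_def mpoly_eval_compose[OF E.comm_ring_hom_axioms]
  proof (rule mpoly_eval_cong[OF p])
    fix i assume i: "1 \<le> i" "i \<le> n"
    have "(\<Sum>j=1..n. ?G $$ (i - 1, j - 1) * v $ (j - 1)) = (\<Sum>j<n. ?G $$ (i - 1, j) * v $ j)"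
      by (rule sum.reindex_bij_witness[of _ Suc "\<lambda>j. j - 1"]) auto
    also have "\<dots> = (?G *\<^sub>v v) $ (i - 1)"
      using i G v by (auto simp: scalar_prod_def atLeast0LessThan)
    finally show "mpoly_eval (\<lambda>c. c) (\<lambda>i. v $ (i - 1))
        (\<Sum>j = 1..n. Const (?G $$ (i - 1, j - 1)) * Var j) = (?G *\<^sub>v v) $ (i - 1)"
      by (simp add: E.hom_sum E.hom_mult mpoly_eval_Const mpoly_eval_Var comm_ring_hom_ident
          del: One_nat_def)
  qed (simp add: mpoly_eval_Const comm_ring_hom_ident)
qed

lemma mpoly_act_eq_0_iff:
  assumes g: "g \<in> carrier_mat n n" "invertible_mat g" and p: "p \<in> polys n"
  shows "mpoly_act n g p = 0 \<longleftrightarrow> p = 0"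
proof -
  let ?G = "the (mat_inverse g)"
  have G: "?G \<in> carrier_mat n n" and Gg: "?G * g = 1\<^sub>m n"
    using mat_inverse_invertible[OF g] by auto
  let ?T = "mpoly_eval Const (\<lambda>i. \<Sum>j=1..n. Const (g $$ (i - 1, j - 1)) * Var j)"
  interpret T: comm_ring_hom ?T
    by (rule mpoly_eval_hom[OF comm_ring_hom_Const])
  interpret K: comm_ring_hom Const by (rule comm_ring_hom_Const)
  interpret A: comm_ring_hom "mpoly_act n g" by (rule comm_ring_hom_mpoly_act)
  have "?T (mpoly_act n g p) = mpoly_eval Const Var p"
    unfolding mpoly_act_def mpoly_eval_compose[OF T.comm_ring_hom_axioms]
  proof (rule mpoly_eval_cong[OF p])
    fix i assume i: "1 \<le> i" "i \<le> n"
    have c: "(\<Sum>j=1..n. ?G $$ (i - 1, j - 1) * g $$ (j - 1, k - 1)) = (if k = i then 1 else 0)"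
      if k: "1 \<le> k" "k \<le> n" for k
    proof -
      have "(\<Sum>j=1..n. ?G $$ (i - 1, j - 1) * g $$ (j - 1, k - 1))
          = (\<Sum>j<n. ?G $$ (i - 1, j) * g $$ (j, k - 1))"
        by (rule sum.reindex_bij_witness[of _ Suc "\<lambda>j. j - 1"]) auto
      also have "\<dots> = (?G * g) $$ (i - 1, k - 1)"
        using i k G g(1) by (auto simp: scalar_prod_def atLeast0LessThan)
      also have "\<dots> = (if k = i then 1 else 0)"
        using i k by (auto simp: Gg)
      finally show ?thesis .
    qed
    have "?T (\<Sum>j = 1..n. Const (?G $$ (i - 1, j - 1)) * Var j)
        = (\<Sum>j=1..n. \<Sum>k=1..n. Const (?G $$ (i - 1, j - 1) * g $$ (j - 1, k - 1)) * Var k)"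
      by (simp add: T.hom_sum T.hom_mult mpoly_eval_Const mpoly_eval_Var comm_ring_hom_Const
          sum_distrib_left K.hom_mult mult.assoc del: One_nat_def)
    also have "\<dots> = (\<Sum>k=1..n. Const (\<Sum>j=1..n. ?G $$ (i - 1, j - 1) * g $$ (j - 1, k - 1)) * Var k)"
      by (subst sum.swap) (simp add: K.hom_sum sum_distrib_right)
    also have "\<dots> = (\<Sum>k=1..n. if k = i then Var k else 0)"
      by (rule sum.cong) (auto simp: c simp del: One_nat_def)
    also have "\<dots> = Var i" using i by simp
    finally show "?T (\<Sum>j = 1..n. Const (?G $$ (i - 1, j - 1)) * Var j) = Var i" .
  qed (simp add: mpoly_eval_Const comm_ring_hom_Const)
  then have T: "?T (mpoly_act n g p) = p" by (simp only: mpoly_eval_Const_Var)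
  show ?thesis
  proof
    assume "mpoly_act n g p = 0"
    with T have "p = ?T 0" by (simp only:)
    then show "p = 0" by (simp only: T.hom_zero)
  qed (simp only: A.hom_zero)
qed

lemma ratfun_act_Fract:
  assumes g: "g \<in> carrier_mat n n" "invertible_mat g"
    and p: "p \<in> polys n" and h: "h \<in> polys n" "h \<noteq> 0"
  shows "ratfun_act n g (Fract p h) = Fract (mpoly_act n g p) (mpoly_act n g h)"
  unfolding ratfun_act_def
proof (rule the_equality)
  interpret A: comm_ring_hom "mpoly_act n g" by (rule comm_ring_hom_mpoly_act)
  fix r assume "\<exists>p'\<in>polys n. \<exists>h'\<in>polys n.
     h' \<noteq> 0 \<and> Fract p h = Fract p' h' \<and> r = Fract (mpoly_act n g p') (mpoly_act n g h')"
  then obtain p' h' where *: "h' \<in> polys n" "h' \<noteq> 0" "Fract p h = Fract p' h'"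
    "r = Fract (mpoly_act n g p') (mpoly_act n g h')" by blast
  then have "p * h' = p' * h" using h by (simp add: eq_fract)
  then have "mpoly_act n g p * mpoly_act n g h' = mpoly_act n g p' * mpoly_act n g h"
    by (simp flip: A.hom_mult)
  moreover have "mpoly_act n g h \<noteq> 0" "mpoly_act n g h' \<noteq> 0"
    using g h * by (auto simp: mpoly_act_eq_0_iff)
  ultimately show "r = Fract (mpoly_act n g p) (mpoly_act n g h)"
    using * by (simp add: eq_fract)
qed (use p h in blast)

definition qform :: "nat \<Rightarrow> 'a::comm_ring_1 \<Rightarrow> 'a vec \<Rightarrow> 'a" where
  "qform m a v = (\<Sum>i<m. v $ (2*m+1-i) * v $ i) + (v $ m)^2 + v $ m * v $ (m+1) + a * (v $ (m+1))^2"

definition bform :: "nat \<Rightarrow> 'a::comm_ring_1 vec \<Rightarrow> 'a vec \<Rightarrow> 'a" where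
  "bform m u v = (\<Sum>i<2*m+2. u $ i * v $ (2*m+1-i))"

lemma point_eval_h1: "point_eval v (h_poly m a 1) = qform m a v"
proof -
  interpret E: comm_ring_hom "point_eval v"
    unfolding point_eval_def by (rule mpoly_eval_hom[OF comm_ring_hom_ident])
  have V: "point_eval v (Var i) = v $ (i - 1)" for i
    unfolding point_eval_def by (rule mpoly_eval_Var[OF comm_ring_hom_ident])
  have C: "point_eval v (Const c) = c" for c
    unfolding point_eval_def by (rule mpoly_eval_Const[OF comm_ring_hom_ident])
  have "(\<Sum>i=1..m. v $ (2*m+3-i-1) * v $ (i-1)) = (\<Sum>i<m. v $ (2*m+1-i) * v $ i)"
    by (rule sum.reindex_bij_witness[of _ Suc "\<lambda>i. i - 1"]) (auto simp: numeral_3_eq_3)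
  then show ?thesis
    by (simp add: h_poly_def E.hom_add E.hom_mult E.hom_sum E.hom_power V C del: One_nat_def)
       (simp add: qform_def numeral_2_eq_2)
qed

lemma bform_split:
  "bform m u v = (\<Sum>i<m. u $ i * v $ (2*m+1-i) + u $ (2*m+1-i) * v $ i)
     + u $ m * v $ (m+1) + u $ (m+1) * v $ m"
proof -
  define f where "f i = u $ i * v $ (2*m+1-i)" for i
  have "{..<2*m+2} = {..<m} \<union> {m..<2*m+2}" by auto
  moreover have "(\<Sum>i\<in>{..<m} \<union> {m..<2*m+2}. f i) = (\<Sum>i<m. f i) + (\<Sum>i=m..<2*m+2. f i)"
    by (rule sum.union_disjoint) auto
  moreover have "(\<Sum>i=m..<2*m+2. f i) = f m + (f (m+1) + (\<Sum>i=m+2..<2*m+2. f i))"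
    using sum.atLeast_Suc_lessThan[of m "2*m+2" f] sum.atLeast_Suc_lessThan[of "Suc m" "2*m+2" f]
    by (simp only: add_2_eq_Suc' Suc_eq_plus1[symmetric])
  moreover have "(\<Sum>i=m+2..<2*m+2. f i) = (\<Sum>i<m. u $ (2*m+1-i) * v $ i)"
    by (rule sum.reindex_bij_witness[of _ "\<lambda>i. 2*m+1-i" "\<lambda>i. 2*m+1-i"]) (auto simp: f_def)
  moreover have "f m = u $ m * v $ (m+1)" "f (m+1) = u $ (m+1) * v $ m"
    by (auto simp: f_def)
  moreover have "bform m u v = (\<Sum>i<2*m+2. f i)"
    by (simp only: bform_def f_def)
  moreover have "(\<Sum>i<m. u $ i * v $ (2*m+1-i) + u $ (2*m+1-i) * v $ i)
      = (\<Sum>i<m. f i) + (\<Sum>i<m. u $ (2*m+1-i) * v $ i)"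
    by (simp only: sum.distrib f_def)
  ultimately show ?thesis by (simp only: add.assoc add.commute add.left_commute)
qed

lemma qform_add:
  fixes a :: "'a::comm_ring_1"
  assumes "(2::'a) = 0" "u \<in> carrier_vec (2*m+2)" "v \<in> carrier_vec (2*m+2)"
  shows "qform m a (u + v) = qform m a u + qform m a v + bform m u v"
proof -
  have [simp]: "x * 2 = 0" "2 * x = 0" for x :: 'a using assms(1) by auto
  have s: "(\<Sum>i<m. (u+v) $ (2*m+1-i) * (u+v) $ i) = (\<Sum>i<m. u $ (2*m+1-i) * u $ i)
     + (\<Sum>i<m. v $ (2*m+1-i) * v $ i) + (\<Sum>i<m. u $ i * v $ (2*m+1-i) + u $ (2*m+1-i) * v $ i)"
    unfolding sum.distrib[symmetric]
    by (rule sum.cong) (use assms(2,3) in \<open>auto simp: algebra_simps\<close>)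
  have i: "(u+v) $ m = u $ m + v $ m" "(u+v) $ (m+1) = u $ (m+1) + v $ (m+1)"
    using assms(2,3) by auto
  show ?thesis
    unfolding qform_def s i bform_split by (simp add: power2_eq_square algebra_simps)
qed

lemma qform_smult:
  fixes a :: "'a::comm_ring_1"
  assumes "v \<in> carrier_vec (2*m+2)"
  shows "qform m a (c \<cdot>\<^sub>v v) = c^2 * qform m a v"
proof -
  have s: "(\<Sum>i<m. (c \<cdot>\<^sub>v v) $ (2*m+1-i) * (c \<cdot>\<^sub>v v) $ i) = c^2 * (\<Sum>i<m. v $ (2*m+1-i) * v $ i)"
    unfolding sum_distrib_left
    by (rule sum.cong) (use assms in \<open>auto simp: algebra_simps power2_eq_square\<close>)
  have i: "(c \<cdot>\<^sub>v v) $ m = c * v $ m" "(c \<cdot>\<^sub>v v) $ (m+1) = c * v $ (m+1)"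
    using assms by auto
  show ?thesis
    unfolding qform_def s i by (simp add: power2_eq_square algebra_simps)
qed

lemma bform_scalar_prod:
  fixes u v :: "'a::comm_ring_1 vec"
  assumes "u \<in> carrier_vec (2*m+2)" "v \<in> carrier_vec (2*m+2)"
  shows "bform m u v = u \<bullet> (antidiag (2*m+2) *\<^sub>v v)"
proof -
  have "(antidiag (2*m+2) *\<^sub>v v) $ i = v $ (2*m+1-i)" if "i < 2*m+2" for i
  proof -
    have "(antidiag (2*m+2) *\<^sub>v v) $ i = (\<Sum>j<2*m+2. (if i + j = 2*m+1 then 1 else 0) * v $ j)"
      using that assms by (simp add: antidiag_def scalar_prod_def atLeast0LessThan)
    also have "\<dots> = (\<Sum>j<2*m+2. if j = 2*m+1-i then v $ j else 0)"
      by (rule sum.cong) (use that in auto)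
    also have "\<dots> = v $ (2*m+1-i)" using that by (subst sum.delta) auto
    finally show ?thesis .
  qed
  then show ?thesis
    using assms by (auto simp: bform_def scalar_prod_def atLeast0LessThan antidiag_def
        simp del: index_mult_mat_vec mult_2 intro!: sum.cong)
qed

lemma block_mat_index:
  assumes "A \<in> carrier_mat m m" "B \<in> carrier_mat 2 m" "C \<in> carrier_mat m m" "D \<in> carrier_mat m 2" "E \<in> carrier_mat m m"
    and "i < 2*m+2" "j < 2*m+2"
  shows "block_mat m A B C D E $$ (i,j) =
    (if i < m then if j < m then A $$ (i,j) else 0
     else if i < m + 2 then if j < m then B $$ (i-m,j) else if i = j then 1 else 0
     else if j < m then C $$ (i-(m+2),j) else if j < m + 2 then D $$ (i-(m+2),j-m)
     else E $$ (i-(m+2),j-(m+2)))"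
proof -
  have *: "(i - m < 2) = (i < m + 2)" "(j - m < 2) = (j < m + 2)"
    "i - m - 2 = i - (m + 2)" "j - m - 2 = j - (m + 2)" by auto
  have d: "dim_row A = m" "dim_col A = m" "dim_row B = 2" "dim_col B = m" "dim_row C = m" "dim_col C = m"
     "dim_row D = m" "dim_col D = 2" "dim_row E = m" "dim_col E = m"
    using assms by auto
  note ij = assms(6,7)
  show ?thesis
    unfolding block_mat_def append_rows_def
    by (cases "i < m"; cases "i < m + 2"; cases "j < m"; cases "j < m + 2")
       (use ij in \<open>simp_all add: d * not_less eq_diff_iff\<close>)
qed

lemma antidiag_square: "antidiag n * antidiag n = (1\<^sub>m n :: 'a::comm_ring_1 mat)"
proof (rule eq_matI)
  fix i j assume ij: "i < dim_row (1\<^sub>m n :: 'a mat)" "j < dim_col (1\<^sub>m n :: 'a mat)"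
  then have "(antidiag n * antidiag n :: 'a mat) $$ (i,j)
     = (\<Sum>k<n. (if i + k = n - 1 then 1 else 0) * (if k + j = n - 1 then 1 else 0))"
    by (auto simp: antidiag_def scalar_prod_def atLeast0LessThan intro!: sum.cong)
  also have "\<dots> = (\<Sum>k<n. if k = n - 1 - i then (if i = j then 1 else 0) else 0)"
    by (rule sum.cong) (use ij in auto)
  also have "\<dots> = (1\<^sub>m n :: 'a mat) $$ (i,j)" using ij by auto
  finally show "(antidiag n * antidiag n :: 'a mat) $$ (i,j) = (1\<^sub>m n :: 'a mat) $$ (i,j)" .
qed (simp_all add: antidiag_def times_mat_def)

lemma qform_unit_vec: "j < 2*m+2 \<Longrightarrow> qform m a (unit_vec (2*m+2) j) =
   (if j = m then 1 else if j = m+1 then a else (0::'a::comm_ring_1))"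
proof -
  assume j: "j < 2*m+2"
  have "(\<Sum>i<m. unit_vec (2*m+2) j $ (2*m+1-i) * unit_vec (2*m+2) j $ i) = (0::'a)"
    by (rule sum.neutral) (use j in auto)
  then show ?thesis using j by (auto simp: qform_def)
qed

lemma two_eq_0:
  assumes "CARD('a::{finite,field}) = 2 ^ r"
  shows "(2::'a) = 0"
proof -
  have "(\<Sum>x\<in>(UNIV::'a set). x) = (\<Sum>x\<in>(UNIV::'a set). x + 1)"
    by (rule sum.reindex_bij_witness[of _ "\<lambda>x. x + 1" "\<lambda>x. x - 1"]) auto
  then have "of_nat CARD('a) = (0::'a)" by (simp add: sum.distrib)
  then show ?thesis by (simp add: assms)
qed

lemma G1_subset_O_minus:
  fixes a :: "'a::{finite,field}"
  assumes card: "CARD('a) = 2 ^ r"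
  shows "G1 m a \<subseteq> O_minus m a"
proof
  note two = two_eq_0[OF card]
  fix N assume N1: "N \<in> G1 m a"
  then obtain A B C D E where *: "A \<in> unitri m \<and> E \<in> unitri m \<and>
     B \<in> carrier_mat 2 m \<and> C \<in> carrier_mat m m \<and> D \<in> carrier_mat m 2 \<and>
     N = block_mat m A B C D E \<and>
     transpose_mat N * antidiag (2*m+2) * N = antidiag (2*m+2) \<and>
     (let S = transpose_mat A * antidiag m * C in
       \<forall>i<m. S $$ (i,i) = (B $$ (0,i))^2 + B $$ (0,i) * B $$ (1,i) + a * (B $$ (1,i))^2)"
    unfolding G1_def mem_Collect_eq by (elim conjE[of "N \<in> unitri (2*m+2)"] exE) (rule that)
  from N1 have N: "N \<in> carrier_mat (2*m+2) (2*m+2)"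
    unfolding G1_def unitri_def by (simp only: mem_Collect_eq)
  from * have car: "A \<in> carrier_mat m m" "B \<in> carrier_mat 2 m" "C \<in> carrier_mat m m"
      "D \<in> carrier_mat m 2" "E \<in> carrier_mat m m"
    and Neq: "N = block_mat m A B C D E"
    and NJN: "transpose_mat N * antidiag (2*m+2) * N = antidiag (2*m+2)"
    unfolding unitri_def mem_Collect_eq by blast+
  from * have S: "(transpose_mat A * antidiag m * C) $$ (i,i)
        = (B $$ (0,i))^2 + B $$ (0,i) * B $$ (1,i) + a * (B $$ (1,i))^2" if "i < m" for i
    using that unfolding Let_def by (simp only:)
  let ?n = "2*m+2" and ?J = "antidiag (2*m+2) :: 'a mat"
  have J: "?J \<in> carrier_mat ?n ?n" by (auto simp: antidiag_def)
  have inv: "invertible_mat N"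
  proof -
    have L: "?J * transpose_mat N * ?J * N = 1\<^sub>m ?n"
    proof -
      have Nt: "transpose_mat N \<in> carrier_mat ?n ?n" using N by simp
      have "?J * transpose_mat N * ?J * N = ?J * (transpose_mat N * ?J * N)"
        using J N Nt by (simp only: assoc_mult_mat[of _ ?n ?n _ ?n _ ?n] mult_carrier_mat[of _ ?n ?n _ ?n])
      then show ?thesis by (simp only: NJN antidiag_square)
    qed
    moreover have c: "?J * transpose_mat N * ?J \<in> carrier_mat ?n ?n"
      using J N by auto
    ultimately have "N * (?J * transpose_mat N * ?J) = 1\<^sub>m ?n"
      using N mat_mult_left_right_inverse by blast
    with L c N show ?thesis unfolding invertible_mat_def inverts_mat_def square_mat.simps by (metis carrier_matD)
  qed
  have bN: "bform m (N *\<^sub>v u) (N *\<^sub>v v) = bform m u v"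
    if uv: "u \<in> carrier_vec ?n" "v \<in> carrier_vec ?n" for u v
  proof -
    have "bform m (N *\<^sub>v u) (N *\<^sub>v v) = (N *\<^sub>v u) \<bullet> (?J *\<^sub>v (N *\<^sub>v v))"
      by (rule bform_scalar_prod) (use uv N in auto)
    also have "\<dots> = u \<bullet> (transpose_mat N *\<^sub>v (?J *\<^sub>v (N *\<^sub>v v)))"
      using transpose_vec_mult_scalar[of "transpose_mat N" ?n ?n "?J *\<^sub>v (N *\<^sub>v v)" u] N J uv by simp
    also have "transpose_mat N *\<^sub>v (?J *\<^sub>v (N *\<^sub>v v)) = (transpose_mat N * ?J * N) *\<^sub>v v"
      using N J uv by (simp add: assoc_mult_mat_vec[of _ ?n ?n _ ?n])
    also have "u \<bullet> \<dots> = bform m u v"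
      unfolding NJN by (rule bform_scalar_prod[symmetric]) (use uv in auto)
    finally show ?thesis .
  qed
  define f where "f v = qform m a (N *\<^sub>v v) - qform m a v" for v
  have f_add: "f (u + v) = f u + f v" if uv: "u \<in> carrier_vec ?n" "v \<in> carrier_vec ?n" for u v
  proof -
    have Nu: "N *\<^sub>v (u + v) = N *\<^sub>v u + N *\<^sub>v v" by (rule mult_add_distrib_mat_vec) (use N uv in auto)
    have "N *\<^sub>v u \<in> carrier_vec ?n" "N *\<^sub>v v \<in> carrier_vec ?n" using N uv by auto
    note q1 = qform_add[OF two this, of a]
    note q2 = qform_add[OF two uv, of a]
    show ?thesis unfolding f_def Nu q1 q2 bN[OF uv] by simp
  qed
  have f_smult: "f (c \<cdot>\<^sub>v v) = c^2 * f v" if v: "v \<in> carrier_vec ?n" for c v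
  proof -
    have Nv: "N *\<^sub>v (c \<cdot>\<^sub>v v) = c \<cdot>\<^sub>v (N *\<^sub>v v)" using N v by (rule mult_mat_vec)
    have "N *\<^sub>v v \<in> carrier_vec ?n" using N v by auto
    note q1 = qform_smult[OF this, of a c]
    note q2 = qform_smult[OF v, of a c]
    show ?thesis unfolding f_def Nv q1 q2 by (simp only: right_diff_distrib)
  qed
  have f_unit: "f (unit_vec ?n j) = 0" if j: "j < ?n" for j
  proof -
    define w where "w = N *\<^sub>v unit_vec ?n j"
    have w: "w $ i =
    (if i < m then if j < m then A $$ (i,j) else 0
     else if i < m + 2 then if j < m then B $$ (i-m,j) else if i = j then 1 else 0
     else if j < m then C $$ (i-(m+2),j) else if j < m + 2 then D $$ (i-(m+2),j-m)
     else E $$ (i-(m+2),j-(m+2)))" if i: "i < ?n" for i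
    proof -
      have "w $ i = N $$ (i,j)" unfolding w_def using i j N by simp
      then show ?thesis unfolding Neq block_mat_index[OF car i j] .
    qed
    have s: "(\<Sum>i<m. w $ (2*m+1-i) * w $ i)
        = (\<Sum>i<m. if j < m then C $$ (m-1-i,j) * A $$ (i,j) else 0)"
    proof (rule sum.cong[OF refl])
      fix i assume "i \<in> {..<m}"
      then have i: "i < m" by simp
      then have "2*m+1-i < ?n" "\<not> 2*m+1-i < m" "\<not> 2*m+1-i < m+2" "2*m+1-i-(m+2) = m-1-i" by auto
      then have "j < m \<Longrightarrow> w $ (2*m+1-i) = C $$ (m-1-i,j)" using w[of "2*m+1-i"] by simp
      moreover have "w $ i = (if j < m then A $$ (i,j) else 0)" using w[of i] i by simp
      ultimately show "w $ (2*m+1-i) * w $ i = (if j < m then C $$ (m-1-i,j) * A $$ (i,j) else 0)"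
        by (cases "j < m") (simp_all only: if_True if_False mult_zero_right)
    qed
    have w1: "w $ m = (if j < m then B $$ (0,j) else if m = j then 1 else 0)"
      "w $ (m+1) = (if j < m then B $$ (1,j) else if m + 1 = j then 1 else 0)"
      using w[of m] w[of "m+1"] by auto
    show ?thesis
    proof (cases "j < m")
      case True
      have "(transpose_mat A * antidiag m * C) $$ (j,j)
          = (\<Sum>k<m. (\<Sum>i<m. A $$ (i,j) * (if i + k = m - 1 then 1 else 0)) * C $$ (k,j))"
        using True car by (auto simp: antidiag_def scalar_prod_def atLeast0LessThan intro!: sum.cong)
      also have "\<dots> = (\<Sum>k<m. (\<Sum>i<m. if i = m - 1 - k then A $$ (i,j) else 0) * C $$ (k,j))"
        by (intro sum.cong arg_cong2[where f="(*)"] refl) auto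
      also have "\<dots> = (\<Sum>k<m. A $$ (m-1-k,j) * C $$ (k,j))"
        by (rule sum.cong) auto
      also have "\<dots> = (\<Sum>i<m. C $$ (m-1-i,j) * A $$ (i,j))"
        by (rule sum.reindex_bij_witness[of _ "\<lambda>i. m-1-i" "\<lambda>i. m-1-i"]) (auto simp: mult.commute)
      finally have s': "(\<Sum>i<m. C $$ (m-1-i,j) * A $$ (i,j))
         = (B $$ (0,j))^2 + B $$ (0,j) * B $$ (1,j) + a * (B $$ (1,j))^2"
        using S[OF True] by simp
      have xx: "x + x = 0" for x :: 'a using two by (metis mult_2 mult_zero_left)
      show ?thesis
        unfolding f_def qform_unit_vec[OF j] unfolding w_def[symmetric] qform_def s w1
        using True s' xx[of "(B $$ (0,j))^2 + B $$ (0,j) * B $$ (1,j) + a * (B $$ (1,j))^2"]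
        by (simp add: add.assoc)
    next
      case False
      show ?thesis
        unfolding f_def qform_unit_vec[OF j] unfolding w_def[symmetric] qform_def s w1
        using False by simp
    qed
  qed
  have f_trunc: "f (vec ?n (\<lambda>j. if j < k then v $ j else 0)) = 0" if "k \<le> ?n" for k v
    using that
  proof (induction k)
    case 0
    have "vec ?n (\<lambda>j. if j < 0 then v $ j else 0) = 0 \<cdot>\<^sub>v vec ?n (\<lambda>j. 0)"
      by (rule eq_vecI) auto
    moreover have "f (0 \<cdot>\<^sub>v vec ?n (\<lambda>j. 0)) = 0"
      by (simp only: f_smult[OF vec_carrier] power2_eq_square mult_zero_left)
    ultimately show ?case by (simp only:)
  next
    case (Suc k)
    let ?u = "vec ?n (\<lambda>j. if j < k then v $ j else 0)"
    have "vec ?n (\<lambda>j. if j < Suc k then v $ j else 0) = ?u + v $ k \<cdot>\<^sub>v unit_vec ?n k"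
      using Suc.prems by (intro eq_vecI) (auto simp: less_Suc_eq unit_vec_def)
    moreover have "f (?u + v $ k \<cdot>\<^sub>v unit_vec ?n k) = f ?u + (v $ k)^2 * f (unit_vec ?n k)"
      by (simp only: f_add[OF vec_carrier smult_carrier_vec[THEN iffD2, OF unit_vec_carrier]]
          f_smult[OF unit_vec_carrier])
    moreover have "f ?u = 0" "f (unit_vec ?n k) = 0"
      by (rule Suc.IH f_unit; use Suc.prems in linarith)+
    ultimately show ?case by (simp only: mult_zero_right add_0_left)
  qed
  have "f v = 0" if "v \<in> carrier_vec ?n" for v
  proof -
    have "vec ?n (\<lambda>j. if j < ?n then v $ j else 0) = v"
      using that by (intro eq_vecI) auto
    with f_trunc[OF order.refl, of v] show ?thesis by (simp only:)
  qed
  then show "N \<in> O_minus m a"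
    using N inv by (simp add: O_minus_def point_eval_h1 f_def del: One_nat_def)
qed

end

theory Submission
  imports Defs
begin

text \<open>
  Write \<open>y\<^sub>j = x\<^sub>2\<^sub>m\<^sub>+\<^sub>3\<^sub>-\<^sub>j\<close> and let \<open>K\<^sub>t\<close> be the field generated by \<open>x\<^sub>1, \<dots>, x\<^sub>t\<close> and the given invariants, so that
  \<open>K\<^sub>2\<^sub>m\<^sub>+\<^sub>2\<close> is the field of all rational functions. An invariant \<open>f \<in> K\<^sub>t = K\<^sub>t\<^sub>-\<^sub>1(x\<^sub>t)\<close> already lies in \<open>K\<^sub>t\<^sub>-\<^sub>1\<close> as soon as
  \<open>x\<^sub>t\<close> is a root of a polynomial over \<open>K\<^sub>t\<^sub>-\<^sub>1\<close> whose degree is at most the number of images of \<open>x\<^sub>t\<close> under the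
  stabilizer of \<open>x\<^sub>1, \<dots>, x\<^sub>t\<^sub>-\<^sub>1\<close>. With \<open>d = min (t-1) m (2m+2-t)\<close>, Siegel transformations show that these images include
  \<open>x\<^sub>t + w\<close> for all \<open>w\<close> in the span \<open>W\<close> of \<open>x\<^sub>1, \<dots>, x\<^sub>d\<close>.

  For \<open>t \<le> m + 2\<close> the polynomial is \<open>\<Prod>w\<in>W. (T + w) - N(x\<^sub>t)\<close>. For \<open>x\<^sub>t = y\<^sub>j\<close> choose \<open>u\<^sub>0, \<dots>, u\<^sub>j\<^sub>-\<^sub>1\<close> in the field
  generated by \<open>x\<^sub>1, \<dots>, x\<^sub>j\<close> with \<open>\<Sum>\<^sub>k u\<^sub>k x\<^sub>i ^ q ^ k = \<delta>\<^sub>i\<^sub>j\<close> for \<open>i \<le> j\<close>. Then \<open>\<Sum>\<^sub>k u\<^sub>k y\<^sub>j ^ q ^ k = \<Sum>\<^sub>k\<^sub>,\<^sub>l u\<^sub>k u\<^sub>l a\<^sub>l\<^sub>k\<close> with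
  \<open>a\<^sub>l\<^sub>k = \<Sum>i\<le>j. x\<^sub>i ^ q ^ l * y\<^sub>i ^ q ^ k\<close>; this quadratic form in \<open>u\<close> depends only on \<open>a\<^sub>k\<^sub>k\<close> and \<open>a\<^sub>k\<^sub>l + a\<^sub>l\<^sub>k\<close>, which are
  Frobenius powers of \<open>h\<^sub>1, \<dots>, h\<^sub>j\<close> up to terms in \<open>x\<^sub>1, \<dots>, x\<^sub>t\<^sub>-\<^sub>1\<close>. Hence it lies in \<open>K\<^sub>t\<^sub>-\<^sub>1\<close>.
\<close>

section \<open>Subfields and descent\<close>

text \<open>Subfields are subsets of a field type, so that coefficients, evaluations and extension
  elements share one type. Closure under \<open>inverse\<close> covers zero because
  \<open>inverse 0 = 0\<close>.\<close>

locale subfield_set =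
  fixes K :: "'b::field set"
  assumes one_mem: "1 \<in> K"
    and add_mem: "\<And>x y. x \<in> K \<Longrightarrow> y \<in> K \<Longrightarrow> x + y \<in> K"
    and uminus_mem: "\<And>x. x \<in> K \<Longrightarrow> - x \<in> K"
    and mult_mem: "\<And>x y. x \<in> K \<Longrightarrow> y \<in> K \<Longrightarrow> x * y \<in> K"
    and inverse_mem: "\<And>x. x \<in> K \<Longrightarrow> inverse x \<in> K"
begin

lemma zero_mem: "0 \<in> K"
  using add_mem[OF one_mem uminus_mem[OF one_mem]] by simp

lemma diff_mem: "x \<in> K \<Longrightarrow> y \<in> K \<Longrightarrow> x - y \<in> K"
  using add_mem[of x "- y"] uminus_mem[of y] by simp

lemma divide_mem: "x \<in> K \<Longrightarrow> y \<in> K \<Longrightarrow> x / y \<in> K"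
  using mult_mem[of x "inverse y"] inverse_mem[of y] by (simp add: divide_inverse)

lemma sum_mem: "(\<And>i. i \<in> I \<Longrightarrow> f i \<in> K) \<Longrightarrow> sum f I \<in> K"
  by (induction I rule: infinite_finite_induct) (auto simp: zero_mem add_mem)

lemma prod_mem: "(\<And>i. i \<in> I \<Longrightarrow> f i \<in> K) \<Longrightarrow> prod f I \<in> K"
  by (induction I rule: infinite_finite_induct) (auto simp: one_mem mult_mem)

lemma power_mem: "x \<in> K \<Longrightarrow> x ^ k \<in> K"
  by (induction k) (auto simp: one_mem mult_mem)

lemmas mems = zero_mem one_mem add_mem uminus_mem diff_mem mult_mem inverse_mem divide_mem
  sum_mem prod_mem power_mem

section \<open>Polynomials with coefficients in a subfield\<close>

definition polys_over :: "'b poly set" where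
  "polys_over = {p. \<forall>i. coeff p i \<in> K}"

lemma polys_over_simps:
  "0 \<in> polys_over" "1 \<in> polys_over" "c \<in> K \<Longrightarrow> monom c k \<in> polys_over"
  "c \<in> K \<Longrightarrow> [:c:] \<in> polys_over"
  "p \<in> polys_over \<Longrightarrow> q \<in> polys_over \<Longrightarrow> p + q \<in> polys_over"
  "p \<in> polys_over \<Longrightarrow> - p \<in> polys_over"
  "p \<in> polys_over \<Longrightarrow> q \<in> polys_over \<Longrightarrow> p - q \<in> polys_over"
  "p \<in> polys_over \<Longrightarrow> q \<in> polys_over \<Longrightarrow> p * q \<in> polys_over"
  "c \<in> K \<Longrightarrow> p \<in> polys_over \<Longrightarrow> smult c p \<in> polys_over"
  by (auto simp: polys_over_def coeff_mult coeff_pCons mems split: nat.splits)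

lemma polys_over_sum: "(\<And>i. i \<in> I \<Longrightarrow> f i \<in> polys_over) \<Longrightarrow> sum f I \<in> polys_over"
  by (induction I rule: infinite_finite_induct) (auto simp: polys_over_simps)

lemma polys_over_prod: "(\<And>i. i \<in> I \<Longrightarrow> f i \<in> polys_over) \<Longrightarrow> prod f I \<in> polys_over"
  by (induction I rule: infinite_finite_induct) (auto simp: polys_over_simps)

text \<open>Long division divides only by the leading coefficient of \<open>g\<close>, so quotient
  and remainder stay over \<open>K\<close>. The bound on \<open>r\<close> is phrased by
  coefficients, which gives \<open>r = 0\<close> when \<open>g\<close> is constant.\<close>

lemma polys_over_division:
  assumes g: "g \<in> polys_over" "g \<noteq> 0" and p: "p \<in> polys_over"
  obtains s r where "s \<in> polys_over" "r \<in> polys_over" "p = g * s + r"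
    "\<And>i. i \<ge> degree g \<Longrightarrow> coeff r i = 0"
proof -
  \<comment> \<open>Induction on a bound for the support of \<open>p\<close>; each step removes the
    coefficient of index \<open>n\<close> by subtracting a monomial multiple of
    \<open>g\<close>.\<close>
  have "\<forall>p\<in>polys_over. (\<forall>i\<ge>n. coeff p i = 0) \<longrightarrow>
      (\<exists>s\<in>polys_over. \<exists>r\<in>polys_over. p = g * s + r \<and> (\<forall>i\<ge>degree g. coeff r i = 0))" for n
  proof (induction n)
    case 0
    then show ?case
      by (auto intro!: bexI[of _ 0] simp: polys_over_simps poly_eq_iff)
  next
    case (Suc n)
    show ?case
    proof (intro ballI impI)
      fix p assume p: "p \<in> polys_over" and pz: "\<forall>i\<ge>Suc n. coeff p i = 0"
      show "\<exists>s\<in>polys_over. \<exists>r\<in>polys_over. p = g * s + r \<and> (\<forall>i\<ge>degree g. coeff r i = 0)"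
      proof (cases "n < degree g")
        case True
        then show ?thesis using p pz
          by (intro bexI[of _ 0] bexI[of _ p]) (auto simp: polys_over_simps)
      next
        case False
        define c where "c = coeff p n / lead_coeff g"
        define u where "u = monom c (n - degree g)"
        have "c \<in> K" using p g(1) by (auto simp: c_def polys_over_def intro: mems)
        then have u: "u \<in> polys_over" by (simp add: u_def polys_over_simps)
        have "coeff (p - g * u) i = 0" if i: "i \<ge> n" for i
        proof (cases "i = n")
          case True
          then show ?thesis using False g(2)
            by (simp add: u_def c_def mult.commute[of g] coeff_monom_mult)
        next
          case neq: False
          then have "degree g < i - (n - degree g)" using i False by simp
          then have "coeff g (i - (n - degree g)) = 0" by (rule coeff_eq_0)
          then show ?thesis using neq i pz False
            by (simp add: u_def mult.commute[of g] coeff_monom_mult)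
        qed
        moreover have "p - g * u \<in> polys_over" using p g u by (simp add: polys_over_simps)
        ultimately obtain s r where sr: "s \<in> polys_over" "r \<in> polys_over" "p - g * u = g * s + r"
          "\<forall>i\<ge>degree g. coeff r i = 0"
          using Suc.IH by blast
        then show ?thesis using u
          by (intro bexI[of _ "s + u"] bexI[of _ r]) (auto simp: algebra_simps polys_over_simps)
      qed
    qed
  qed
  from this[of "Suc (degree p)"] p that show thesis
    by (metis Suc_le_eq coeff_eq_0)
qed

section \<open>Simple algebraic extensions\<close>

definition adjoin :: "'b \<Rightarrow> 'b set" where
  "adjoin t = {poly p t | p. p \<in> polys_over}"

text \<open>Let \<open>M\<close> have least degree \<open>d\<close> among the nonzero polynomials
  over \<open>K\<close> vanishing at \<open>t\<close>. For \<open>degree p < d\<close>, dividing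
  \<open>M\<close> by \<open>p\<close> gives \<open>p(t) s(t) = - r(t)\<close> with \<open>r\<close>
  of smaller degree than \<open>p\<close>; repeating this ends at a nonzero constant, which is
  invertible in \<open>K\<close>.\<close>

lemma adjoin_inverse:
  assumes Q: "Q \<in> polys_over" "Q \<noteq> 0" "poly Q t = 0"
    and x: "x \<in> adjoin t"
  shows "inverse x \<in> adjoin t"
proof -
  define d where "d = (LEAST d. \<exists>Q\<in>polys_over. Q \<noteq> 0 \<and> poly Q t = 0 \<and> degree Q = d)"
  have "\<exists>Q\<in>polys_over. Q \<noteq> 0 \<and> poly Q t = 0 \<and> degree Q = d"
    unfolding d_def by (rule LeastI_ex) (use Q in blast)
  then obtain M where M: "M \<in> polys_over" "M \<noteq> 0" "poly M t = 0" "degree M = d" by blast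
  have min: "p = 0" if "p \<in> polys_over" "poly p t = 0" "degree p < d" for p
    using that not_less_Least[of "degree p" "\<lambda>d. \<exists>Q\<in>polys_over. Q \<noteq> 0 \<and> poly Q t = 0 \<and> degree Q = d"]
    unfolding d_def by blast
  have step: "\<exists>s\<in>polys_over. poly p t * poly s t = 1"
    if "p \<in> polys_over" "poly p t \<noteq> 0" "degree p < d" for p
    using that
  proof (induction "degree p" arbitrary: p rule: less_induct)
    case less
    have p0: "p \<noteq> 0" using less.prems by auto
    from polys_over_division[OF less.prems(1) p0 M(1)] obtain s r
      where sr: "s \<in> polys_over" "r \<in> polys_over" "M = p * s + r"
        "\<And>i. i \<ge> degree p \<Longrightarrow> coeff r i = 0" by blast
    show ?case
    proof (cases "degree p = 0")
      case True
      then obtain c where c: "p = [:c:]" by (rule degree_eq_zeroE)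
      then have "c \<in> K" using less.prems(1) unfolding polys_over_def by (auto dest: spec[of _ 0])
      then show ?thesis using c p0
        by (intro bexI[of _ "[:inverse c:]"]) (auto intro: polys_over_simps mems)
    next
      case False
      then have dr: "degree r < degree p"
        using sr(4) by (metis coeff_0 degree_0 leading_coeff_0_iff linorder_not_less neq0_conv)
      have eq: "poly p t * poly s t = - poly r t"
        using M(3) sr(3) by (simp add: eq_neg_iff_add_eq_0)
      \<comment> \<open>Otherwise minimality forces \<open>r = 0\<close>, so
        \<open>M = p * s\<close> with \<open>p\<close> nonconstant, and \<open>s\<close> would be a
        nonzero polynomial of smaller degree vanishing at \<open>t\<close>.\<close>
      have "poly r t \<noteq> 0"
      proof
        assume r: "poly r t = 0"
        then have "r = 0" using min[of r] sr dr less.prems by simp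
        have "poly s t = 0" using eq r less.prems by simp
        moreover have "s \<noteq> 0" using sr M \<open>r = 0\<close> by auto
        then have "degree s < d" using sr(3) M p0 \<open>r = 0\<close> False by (auto simp: degree_mult_eq)
        ultimately show False using min[of s] sr \<open>s \<noteq> 0\<close> by simp
      qed
      then obtain u where u: "u \<in> polys_over" "poly r t * poly u t = 1"
        using less.hyps[OF dr sr(2)] dr less.prems by auto
      then have "poly p t * poly (- (s * u)) t = 1"
        using eq by (simp add: mult.assoc[symmetric])
      then show ?thesis using sr u by (intro bexI[of _ "- (s * u)"]) (auto intro: polys_over_simps)
    qed
  qed
  from x obtain p where p: "p \<in> polys_over" "x = poly p t" unfolding adjoin_def by blast
  show ?thesis
  proof (cases "x = 0")
    case True
    then show ?thesis unfolding adjoin_def using polys_over_simps(1) by force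
  next
    case False
    from polys_over_division[OF M(1,2) p(1)] obtain s r
      where sr: "s \<in> polys_over" "r \<in> polys_over" "p = M * s + r"
        "\<And>i. i \<ge> degree M \<Longrightarrow> coeff r i = 0" by blast
    \<comment> \<open>A nonzero constant has no root, so \<open>d\<close> is positive; hence the
      remainder has degree below \<open>d\<close> even if it is zero.\<close>
    have "M \<noteq> [:coeff M 0:]" using M(2,3) by (metis mult_zero_right add.right_neutral poly_0 poly_pCons pCons_0_0)
    then have "d \<noteq> 0" using M(4) by (metis degree_eq_zeroE coeff_pCons_0)
    then have "degree r < d"
      using sr(4) M(4) by (metis coeff_0 degree_0 leading_coeff_0_iff linorder_not_less neq0_conv)
    moreover have "poly r t = x" using sr p M by simp
    ultimately obtain u where "u \<in> polys_over" "x * poly u t = 1"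
      using step[OF sr(2)] False by auto
    then show ?thesis unfolding adjoin_def by (auto dest: inverse_unique)
  qed
qed

lemma subfield_adjoin:
  assumes Q: "Q \<in> polys_over" "Q \<noteq> 0" "poly Q t = 0"
  shows "subfield_set (adjoin t)"
proof
  show "1 \<in> adjoin t" unfolding adjoin_def using polys_over_simps(2) by force
next
  fix x y assume "x \<in> adjoin t" "y \<in> adjoin t"
  then obtain p q where "p \<in> polys_over" "q \<in> polys_over" "x = poly p t" "y = poly q t"
    unfolding adjoin_def by blast
  then have "p + q \<in> polys_over" "p * q \<in> polys_over" "x + y = poly (p + q) t" "x * y = poly (p * q) t"
    by (auto simp: polys_over_simps)
  then show "x + y \<in> adjoin t" "x * y \<in> adjoin t" unfolding adjoin_def by blast+
next
  fix x assume x: "x \<in> adjoin t"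
  then obtain p where "p \<in> polys_over" "x = poly p t" unfolding adjoin_def by blast
  then have "- p \<in> polys_over" "- x = poly (- p) t" by (auto simp: polys_over_simps)
  then show "- x \<in> adjoin t" unfolding adjoin_def by blast
  show "inverse x \<in> adjoin t" using adjoin_inverse[OF Q x] .
qed

lemma subset_adjoin: "K \<subseteq> adjoin t" "t \<in> adjoin t"
proof -
  show "K \<subseteq> adjoin t"
    unfolding adjoin_def using polys_over_simps(4) by (force intro!: exI[of _ "[:_:]"])
  have "monom 1 1 \<in> polys_over" by (simp add: polys_over_simps one_mem)
  then show "t \<in> adjoin t" unfolding adjoin_def by (force simp: poly_monom)
qed

text \<open>
  Reducing modulo \<open>Q\<close>, \<open>f = p(t)\<close> with \<open>deg p < deg Q\<close>; then \<open>p - f\<close> has more roots than its degree,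
  so \<open>f\<close> is the constant coefficient of \<open>p\<close>.
\<close>

lemma descent:
  assumes Q: "Q \<in> polys_over" "Q \<noteq> 0" "poly Q t = 0"
    and S: "finite S" "degree Q \<le> card S"
    and conj: "\<And>s p. s \<in> S \<Longrightarrow> p \<in> polys_over \<Longrightarrow> f = poly p t \<Longrightarrow> f = poly p s"
    and f: "f \<in> adjoin t"
  shows "f \<in> K"
proof -
  from f obtain p where p: "p \<in> polys_over" "f = poly p t" unfolding adjoin_def by blast
  from polys_over_division[OF Q(1,2) p(1)] obtain s r
    where sr: "s \<in> polys_over" "r \<in> polys_over" "p = Q * s + r"
      "\<And>i. i \<ge> degree Q \<Longrightarrow> coeff r i = 0" by blast
  have r: "f = poly r t" using p sr Q by simp
  have "Q \<noteq> [:coeff Q 0:]" using Q(2,3) by (metis mult_zero_right add.right_neutral poly_0 poly_pCons pCons_0_0)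
  then have "degree Q \<noteq> 0" by (metis degree_eq_zeroE coeff_pCons_0)
  have "r - [:f:] = 0"
  proof (rule ccontr)
    assume nz: "r - [:f:] \<noteq> 0"
    have "coeff (r - [:f:]) i = 0" if "i \<ge> degree Q" for i
      using that sr(4) \<open>degree Q \<noteq> 0\<close> by (cases i) auto
    then have "degree (r - [:f:]) < degree Q"
      using nz by (metis leading_coeff_0_iff linorder_not_less)
    moreover have "S \<subseteq> {x. poly (r - [:f:]) x = 0}" using conj[OF _ sr(2) r] by auto
    then have "card S \<le> card {x. poly (r - [:f:]) x = 0}"
      by (rule card_mono[OF poly_roots_finite[OF nz]])
    moreover have "card {x. poly (r - [:f:]) x = 0} \<le> degree (r - [:f:])"
      by (rule card_poly_roots_bound[OF nz])
    ultimately show False using S by simp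
  qed
  then have "coeff r 0 = f" by (metis coeff_pCons_0 eq_iff_diff_eq_0)
  then show ?thesis using sr(2) unfolding polys_over_def by blast
qed

end

section \<open>Fields generated over the constants\<close>

lemma subfield_field_gen: "subfield_set (field_gen H)"
proof -
  interpret R: field "ring_of_type_algebra :: 'a mpoly fract ring"
    by (rule field_from_type_algebra)
  note gf = generate_field.intros[where R = "ring_of_type_algebra :: 'a mpoly fract ring"]
  let ?G = "range (\<lambda>c. to_fract (Const c)) \<union> H"
  have zero: "0 \<in> field_gen H"
    using R.zero_in_generate[of ?G] unfolding field_gen_def by (simp add: ring_of_type_algebra_def)
  \<comment> \<open>The inverses of the record structure are identified with the type class
    operations, the multiplicative one only for nonzero elements; zero is treated
    separately.\<close>
  have neg: "\<ominus>\<^bsub>ring_of_type_algebra\<^esub> x = - x" for x :: "'a mpoly fract"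
    by (rule R.minus_equality) (auto simp: ring_of_type_algebra_def)
  have inv: "inv\<^bsub>ring_of_type_algebra\<^esub> x = inverse x" if "x \<noteq> 0" for x :: "'a mpoly fract"
    by (rule R.comm_inv_char) (use that in \<open>auto simp: ring_of_type_algebra_def\<close>)
  show ?thesis
  proof
    show "1 \<in> field_gen H"
      using gf(1)[of ?G] unfolding field_gen_def by (simp add: ring_of_type_algebra_def)
    fix x assume x: "x \<in> field_gen H"
    show "- x \<in> field_gen H"
      using gf(3)[of x ?G] x unfolding field_gen_def neg by simp
    show "inverse x \<in> field_gen H"
      using gf(4)[of x ?G] x inv[of x] zero unfolding field_gen_def
      by (cases "x = 0") (simp_all add: ring_of_type_algebra_def)
    fix y assume y: "y \<in> field_gen H"
    show "x + y \<in> field_gen H" "x * y \<in> field_gen H"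
      using gf(5,6)[of x ?G y] x y unfolding field_gen_def by (simp_all add: ring_of_type_algebra_def)
  qed
qed

lemma field_gen_gens: "to_fract (Const c) \<in> field_gen H" "x \<in> H \<Longrightarrow> x \<in> field_gen H"
  unfolding field_gen_def by (auto intro: generate_field.incl)

lemma field_gen_least:
  assumes "subfield_set K" "\<And>c. to_fract (Const c) \<in> K" "H \<subseteq> K"
  shows "field_gen H \<subseteq> K"
proof
  interpret R: field "ring_of_type_algebra :: 'a mpoly fract ring"
    by (rule field_from_type_algebra)
  interpret K: subfield_set K by fact
  have neg: "\<ominus>\<^bsub>ring_of_type_algebra\<^esub> x = - x" for x :: "'a mpoly fract"
    by (rule R.minus_equality) (auto simp: ring_of_type_algebra_def)
  have inv: "inv\<^bsub>ring_of_type_algebra\<^esub> x = inverse x" if "x \<noteq> 0" for x :: "'a mpoly fract"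
    by (rule R.comm_inv_char) (use that in \<open>auto simp: ring_of_type_algebra_def\<close>)
  fix x assume "x \<in> field_gen H"
  then show "x \<in> K" unfolding field_gen_def
  proof (induction rule: generate_field.induct)
    case (m_inv h)
    then have "h \<noteq> 0" by (simp add: ring_of_type_algebra_def)
    then show ?case using m_inv inv K.inverse_mem by simp
  qed (use assms K.mems neg in \<open>auto simp: ring_of_type_algebra_def\<close>)
qed

section \<open>Frobenius and \<open>q\<close>-polynomials\<close>

text \<open>Multiplication by a nonzero \<open>x\<close> permutes the nonzero elements. Comparing
  their products gives \<open>x ^ (CARD('a) - 1) = 1\<close>.\<close>

lemma finite_field_power_card:
  fixes x :: "'a::{finite,field}"
  shows "x ^ CARD('a) = x"
proof (cases "x = 0")
  case True
  then show ?thesis by (simp add: power_0_left)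
next
  case False
  let ?U = "UNIV - {0::'a}"
  have "(\<Prod>y\<in>?U. y) = (\<Prod>y\<in>?U. x * y)"
    by (rule prod.reindex_bij_witness[of _ "\<lambda>y. x * y" "\<lambda>y. y / x"]) (use False in auto)
  also have "\<dots> = x ^ card ?U * (\<Prod>y\<in>?U. y)" by (simp add: prod.distrib)
  finally have "x ^ card ?U = 1" by simp
  moreover have "CARD('a) = Suc (card ?U)" by (subst card_Suc_Diff1) auto
  ultimately show ?thesis by (simp only: power_Suc mult_1_right)
qed

lemma card_gt_1: "CARD('a::{finite,field}) > 1"
proof -
  have "card {0, 1::'a} \<le> CARD('a)" by (rule card_mono) auto
  then show ?thesis by simp
qed

lemma two_power_add:
  fixes x y :: "'b::comm_ring_1"
  assumes "(2::'b) = 0"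
  shows "(x + y) ^ (2 ^ e) = x ^ (2 ^ e) + y ^ (2 ^ e)"
proof (induction e)
  case (Suc e)
  have "(u + v)\<^sup>2 = u\<^sup>2 + v\<^sup>2" for u v :: 'b
    using assms by (simp add: power2_sum)
  then show ?case using Suc by (simp add: power_mult mult.commute[of 2])
qed simp

lemma frob_add:
  fixes x y :: "'b::comm_ring_1"
  assumes "(2::'b) = 0" "q = 2 ^ r"
  shows "(x + y) ^ (q ^ k) = x ^ (q ^ k) + y ^ (q ^ k)"
  using two_power_add[OF assms(1), of x y "r * k"] by (simp add: assms(2) power_mult)

lemma frob_sum:
  fixes f :: "'c \<Rightarrow> 'b::comm_ring_1"
  assumes "(2::'b) = 0" "q = 2 ^ r"
  shows "(\<Sum>i\<in>I. f i) ^ (q ^ k) = (\<Sum>i\<in>I. f i ^ (q ^ k))"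
proof (induction I rule: infinite_finite_induct)
  case (insert i I)
  then show ?case by (simp add: frob_add[OF assms])
qed (use assms in \<open>auto simp: power_0_left\<close>)

lemma minus_eq_self:
  fixes x :: "'b::comm_ring_1"
  assumes "(2::'b) = 0"
  shows "- x = x" "x - y = x + y" "x + x = 0"
proof -
  show *: "x + x = 0" for x :: 'b using assms by (metis mult_2 mult_zero_left)
  show "- x = x" for x :: 'b using *[of x] by (rule minus_unique)
  then show "x - y = x + y" by (metis diff_conv_add_uminus)
qed

section \<open>Spans over the finite field and q-polynomials\<close>

definition lspan :: "('a \<Rightarrow> 'b::comm_ring_1) \<Rightarrow> (nat \<Rightarrow> 'b) \<Rightarrow> nat \<Rightarrow> 'b set" where
  "lspan C x j = range (\<lambda>c. \<Sum>i=1..j. C (c i) * x i)"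

lemma lspanI: "v = (\<Sum>i=1..j. C (c i) * x i) \<Longrightarrow> v \<in> lspan C x j"
  by (simp add: lspan_def)

text \<open>The finite field with \<open>q\<close> elements, embedded by \<open>C\<close> into a
  field of characteristic two. It is instantiated later with the constant rational
  functions.\<close>

locale scalars = field_hom C
  for C :: "'a::{finite,field} \<Rightarrow> 'b::field" +
  fixes q r :: nat
  assumes q_def: "q = CARD('a)" and q_pow: "CARD('a) = 2 ^ r" and two: "(2::'b) = 0"
begin

lemma q_eq: "q = 2 ^ r" using q_def q_pow by simp

lemma C_frob: "C c ^ (q ^ k) = C c"
proof (induction k)
  case (Suc k)
  have "C c ^ q = C c"
    by (simp add: q_def hom_power[symmetric] finite_field_power_card)
  then show ?case using Suc by (metis power_Suc power_mult)
qed simp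

text \<open>The polynomial \<open>T ^ q - T\<close> has at most \<open>q\<close> roots, and the
  \<open>q\<close> elements of \<open>range C\<close> are already roots.\<close>

lemma frob_fixed:
  assumes "\<rho> ^ q = \<rho>"
  shows "\<rho> \<in> range C"
proof -
  define p :: "'b poly" where "p = monom 1 q - monom 1 1"
  have q: "q > 1" using card_gt_1[where 'a='a] q_def by simp
  have "coeff p q = 1" using q by (simp add: p_def)
  then have p0: "p \<noteq> 0" by auto
  have deg: "degree p \<le> q" unfolding p_def using q
    by (intro degree_diff_le) (auto intro: order.trans[OF degree_monom_le])
  have "range C \<subseteq> {x. poly p x = 0}"
    using C_frob[of _ 1] by (auto simp: p_def poly_monom)
  moreover have "card {x. poly p x = 0} \<le> card (range C)"
    using card_poly_roots_bound[OF p0] deg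
    by (simp add: card_image[OF injI[OF injectivity]] q_def[symmetric])
  ultimately have "range C = {x. poly p x = 0}"
    by (intro card_seteq poly_roots_finite[OF p0])
  moreover have "poly p \<rho> = 0" using assms by (simp add: p_def poly_monom)
  ultimately show ?thesis by blast
qed

lemma lspan_Suc:
  "v \<in> lspan C x (Suc j) \<longleftrightarrow> (\<exists>c. v - C c * x (Suc j) \<in> lspan C x j)"
proof
  assume "v \<in> lspan C x (Suc j)"
  then obtain c where "v = (\<Sum>i=1..Suc j. C (c i) * x i)" unfolding lspan_def by blast
  then have "v - C (c (Suc j)) * x (Suc j) = (\<Sum>i=1..j. C (c i) * x i)" by simp
  then show "\<exists>c. v - C c * x (Suc j) \<in> lspan C x j" unfolding lspan_def by blast
next
  assume "\<exists>c. v - C c * x (Suc j) \<in> lspan C x j"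
  then obtain c d where v: "v - C c * x (Suc j) = (\<Sum>i=1..j. C (d i) * x i)" unfolding lspan_def by blast
  have "(\<Sum>i=1..Suc j. C ((d(Suc j := c)) i) * x i) = (\<Sum>i=1..j. C (d i) * x i) + C c * x (Suc j)"
    by simp
  also have "\<dots> = v" unfolding v[symmetric] by simp
  finally show "v \<in> lspan C x (Suc j)" by (rule lspanI[OF sym])
qed

text \<open>
  The polynomials \<open>L\<^sub>j(T) = \<Sum> l\<^sub>k T ^ (q ^ k)\<close> are given by
  \<open>L\<^sub>j\<^sub>+\<^sub>1(T) = L\<^sub>j(T) ^ q - L\<^sub>j(x\<^sub>j\<^sub>+\<^sub>1) ^ (q - 1) * L\<^sub>j(T)\<close>.
\<close>

lemma vanishing_qpoly:
  assumes "subfield_set K" "\<And>i. 1 \<le> i \<Longrightarrow> i \<le> j \<Longrightarrow> x i \<in> K"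
  shows "\<exists>l. (\<forall>k. l k \<in> K) \<and> (\<forall>v. (\<Sum>k\<le>j. l k * v ^ (q ^ k)) = 0 \<longleftrightarrow> v \<in> lspan C x j)"
  using assms(2)
proof (induction j)
  case 0
  interpret K: subfield_set K by fact
  \<comment> \<open>The polynomial is \<open>T\<close> itself, whose only root is the single element
    of the empty span.\<close>
  show ?case by (rule exI[of _ "\<lambda>_. 1"]) (simp add: lspan_def K.one_mem)
next
  case (Suc j)
  interpret K: subfield_set K by fact
  obtain l where l: "\<And>k. l k \<in> K"
    and ker: "\<And>v. (\<Sum>k\<le>j. l k * v ^ (q ^ k)) = 0 \<longleftrightarrow> v \<in> lspan C x j"
    using Suc by fastforce
  define L where "L v = (\<Sum>k\<le>j. l k * v ^ (q ^ k))" for v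
  define s where "s = L (x (Suc j))"
  have L_diff: "L (v - C c * w) = L v - C c * L w" for v c w
  proof -
    have "l k * (v - C c * w) ^ (q ^ k) = l k * v ^ (q ^ k) + C c * (l k * w ^ (q ^ k))" for k
      unfolding minus_eq_self(2)[OF two] frob_add[OF two q_eq] power_mult_distrib C_frob
      by (simp add: distrib_left mult.left_commute)
    then show ?thesis
      by (simp only: L_def minus_eq_self(2)[OF two] sum.distrib sum_distrib_left)
  qed
  have s: "s \<in> K" unfolding s_def L_def by (intro K.mems l Suc.prems) auto
  \<comment> \<open>Coefficients of \<open>L ^ q - s ^ (q - 1) * L\<close>. Frobenius shifts the
    indices up by one, so the first part is absent at \<open>0\<close> and the second at
    \<open>Suc j\<close>.\<close>
  define l' where "l' k = (if k = 0 then 0 else l (k - 1) ^ q) - (if k = Suc j then 0 else s ^ (q - 1) * l k)" for k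
  have l': "l' k \<in> K" for k unfolding l'_def by (auto intro!: K.mems l s)
  have q1: "q > 1" using card_gt_1[where 'a='a] q_def by simp
  have L': "(\<Sum>k\<le>Suc j. l' k * v ^ (q ^ k)) = L v ^ q - s ^ (q - 1) * L v" for v
  proof -
    have "(\<Sum>k\<le>Suc j. l' k * v ^ (q ^ k)) =
        (\<Sum>k\<le>Suc j. (if k = 0 then 0 else l (k - 1) ^ q) * v ^ (q ^ k))
         - (\<Sum>k\<le>Suc j. (if k = Suc j then 0 else s ^ (q - 1) * l k) * v ^ (q ^ k))"
      unfolding l'_def by (simp only: left_diff_distrib sum_subtractf)
    also have "(\<Sum>k\<le>Suc j. (if k = 0 then 0 else l (k - 1) ^ q) * v ^ (q ^ k)) = (\<Sum>k\<le>j. l k ^ q * v ^ (q ^ Suc k))"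
      by (subst sum.atMost_Suc_shift) simp
    also have "\<dots> = L v ^ q"
      using frob_sum[OF two q_eq, of "\<lambda>k. l k * v ^ (q ^ k)" "{..j}" 1]
      by (simp add: L_def power_mult_distrib power_mult[symmetric] mult.commute)
    also have "(\<Sum>k\<le>Suc j. (if k = Suc j then 0 else s ^ (q - 1) * l k) * v ^ (q ^ k)) = s ^ (q - 1) * L v"
      by (simp add: L_def sum_distrib_left mult.assoc)
    finally show ?thesis .
  qed
  have "(\<Sum>k\<le>Suc j. l' k * v ^ (q ^ k)) = 0 \<longleftrightarrow> v \<in> lspan C x (Suc j)" for v
  proof -
    \<comment> \<open>For \<open>s \<noteq> 0\<close> the left side says that \<open>L v / s\<close>
      is fixed by Frobenius, hence is a scalar; for \<open>s = 0\<close> both sides say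
      \<open>L v = 0\<close>.\<close>
    have "L v ^ q - s ^ (q - 1) * L v = 0 \<longleftrightarrow> (\<exists>c. L v = C c * s)"
    proof
      assume eq: "L v ^ q - s ^ (q - 1) * L v = 0"
      show "\<exists>c. L v = C c * s"
      proof (cases "s = 0")
        case True
        then show ?thesis using eq q1 by (simp add: power_0_left)
      next
        case False
        have "s ^ q = s * s ^ (q - 1)" using power_minus_mult[of q s] q1 by (simp add: mult.commute)
        then have "(L v / s) ^ q = L v / s"
          using eq False by (simp add: power_divide field_simps)
        then obtain c where "L v / s = C c" using frob_fixed by blast
        then show ?thesis using False by (auto simp: field_simps)
      qed
    next
      assume "\<exists>c. L v = C c * s"
      then obtain c where c: "L v = C c * s" by blast
      have "s ^ q = s ^ (q - 1) * s" using power_minus_mult[of q s] q1 by simp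
      then show "L v ^ q - s ^ (q - 1) * L v = 0"
        using C_frob[of c 1] by (simp add: c power_mult_distrib)
    qed
    also have "\<dots> \<longleftrightarrow> (\<exists>c. L (v - C c * x (Suc j)) = 0)"
      by (simp add: L_diff s_def)
    also have "\<dots> \<longleftrightarrow> v \<in> lspan C x (Suc j)"
      using ker by (simp add: L_def lspan_Suc)
    finally show ?thesis unfolding L' .
  qed
  then show ?case using l' by blast
qed

text \<open>The vanishing q-polynomial of the span of the first \<open>j\<close> elements is nonzero
  at \<open>x (Suc j)\<close> by independence; dividing by that value yields the required
  coefficients.\<close>

lemma dual_qpoly:
  assumes "subfield_set K" "\<And>i. 1 \<le> i \<Longrightarrow> i \<le> Suc j \<Longrightarrow> x i \<in> K" and "x (Suc j) \<notin> lspan C x j"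
  shows "\<exists>u. (\<forall>k. u k \<in> K) \<and>
    (\<forall>i\<in>{1..Suc j}. (\<Sum>k<Suc j. u k * x i ^ (q ^ k)) = (if i = Suc j then 1 else 0))"
proof -
  interpret K: subfield_set K by fact
  obtain l where l: "\<And>k. l k \<in> K"
    and ker: "\<And>v. (\<Sum>k\<le>j. l k * v ^ (q ^ k)) = 0 \<longleftrightarrow> v \<in> lspan C x j"
    using vanishing_qpoly[OF assms(1), of j x] assms(2) by (metis le_SucI)
  define s where "s = (\<Sum>k\<le>j. l k * x (Suc j) ^ (q ^ k))"
  have s0: "s \<noteq> 0" using assms(3) ker s_def by simp
  have s: "s \<in> K" unfolding s_def by (intro K.mems l assms(2)) auto
  have z: "(\<Sum>k\<le>j. l k * x i ^ (q ^ k)) = 0" if "1 \<le> i" "i \<le> j" for i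
  proof -
    have "(\<Sum>i'=1..j. C (if i' = i then 1 else 0) * x i') = (\<Sum>i'=1..j. if i' = i then x i' else 0)"
      by (rule sum.cong) auto
    also have "\<dots> = x i" using that by simp
    finally have "x i \<in> lspan C x j" by (rule lspanI[OF sym])
    then show ?thesis using ker by simp
  qed
  have "(\<Sum>k<Suc j. l k / s * x i ^ (q ^ k)) = (\<Sum>k\<le>j. l k * x i ^ (q ^ k)) / s" for i
    by (simp add: lessThan_Suc_atMost sum_divide_distrib)
  then have "(\<Sum>k<Suc j. l k / s * x i ^ (q ^ k)) = (if i = Suc j then 1 else 0)" if "i \<in> {1..Suc j}" for i
    using that z[of i] s0 s_def by (cases "i = Suc j") auto
  moreover have "l k / s \<in> K" for k using l s by (rule K.divide_mem)
  ultimately show ?thesis by (intro exI[of _ "\<lambda>k. l k / s"]) simp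
qed

lemma sum_square_split:
  fixes f :: "nat \<Rightarrow> nat \<Rightarrow> 'b"
  shows "(\<Sum>k<j. \<Sum>l<j. f k l) = (\<Sum>k<j. f k k) + (\<Sum>l<j. \<Sum>k<l. f k l + f l k)"
  by (induction j) (simp_all add: sum.distrib algebra_simps)

text \<open>
  Both sides are the value at \<open>u\<close> of the quadratic form with matrix
  \<open>a\<^sub>l\<^sub>k = \<Sum>\<^sub>i x\<^sub>i ^ (q ^ l) * y\<^sub>i ^ (q ^ k)\<close>; only \<open>a\<^sub>k\<^sub>k\<close> and \<open>a\<^sub>k\<^sub>l + a\<^sub>l\<^sub>k\<close> enter on the right.
\<close>

lemma qpoly_of_forms:
  fixes u x y :: "nat \<Rightarrow> 'b"
  assumes u: "\<And>i. i \<in> {1..j} \<Longrightarrow> (\<Sum>k<j. u k * x i ^ (q ^ k)) = (if i = j then 1 else 0)" and j: "j \<ge> 1"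
  shows "(\<Sum>k<j. u k * y j ^ (q ^ k)) =
    (\<Sum>k<j. (u k)\<^sup>2 * (\<Sum>i=1..j. y i * x i) ^ (q ^ k)) +
    (\<Sum>l<j. \<Sum>k<l. u k * u l * (\<Sum>i=1..j. y i ^ (q ^ (l - k)) * x i + y i * x i ^ (q ^ (l - k))) ^ (q ^ k))"
proof -
  define b where "b k l = (\<Sum>i=1..j. y i ^ (q ^ k) * x i ^ (q ^ l))" for k l
  \<comment> \<open>The duality relation, weighted by the Frobenius powers of the
    \<open>y i\<close>, leaves only the term \<open>i = j\<close>.\<close>
  have y: "y j ^ (q ^ k) = (\<Sum>l<j. u l * b k l)" for k
  proof -
    have "(\<Sum>l<j. u l * b k l) = (\<Sum>l<j. \<Sum>i=1..j. y i ^ (q ^ k) * (u l * x i ^ (q ^ l)))"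
      by (intro sum.cong refl) (simp add: b_def sum_distrib_left mult.left_commute)
    also have "\<dots> = (\<Sum>i=1..j. \<Sum>l<j. y i ^ (q ^ k) * (u l * x i ^ (q ^ l)))"
      by (rule sum.swap)
    also have "\<dots> = (\<Sum>i=1..j. if i = j then y j ^ (q ^ k) else 0)"
      unfolding sum_distrib_left[symmetric] by (rule sum.cong) (simp_all add: u)
    also have "\<dots> = y j ^ (q ^ k)" using j by simp
    finally show ?thesis by simp
  qed
  have diag: "b k k = (\<Sum>i=1..j. y i * x i) ^ (q ^ k)" for k
    by (simp add: b_def frob_sum[OF two q_eq] power_mult_distrib)
  \<comment> \<open>Writing \<open>q ^ l = q ^ (l - k) * q ^ k\<close>, the \<open>q ^ k\<close>
    power is pulled out of the whole symmetric sum.\<close>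
  have off: "b k l + b l k = (\<Sum>i=1..j. y i ^ (q ^ (l - k)) * x i + y i * x i ^ (q ^ (l - k))) ^ (q ^ k)"
    if "k < l" for k l
  proof -
    have "q ^ l = q ^ (l - k) * q ^ k" using that by (simp flip: power_add)
    then show ?thesis
      by (simp add: b_def frob_sum[OF two q_eq] frob_add[OF two q_eq] power_mult_distrib sum.distrib
          power_mult add.commute)
  qed
  have "(\<Sum>k<j. u k * y j ^ (q ^ k)) = (\<Sum>k<j. \<Sum>l<j. u k * u l * b k l)"
    by (simp add: y sum_distrib_left mult.assoc)
  also have "\<dots> = (\<Sum>k<j. (u k)\<^sup>2 * b k k) + (\<Sum>l<j. \<Sum>k<l. u k * u l * (b k l + b l k))"
    unfolding sum_square_split by (simp add: power2_eq_square algebra_simps)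
  also have "(\<Sum>l<j. \<Sum>k<l. u k * u l * (b k l + b l k)) = (\<Sum>l<j. \<Sum>k<l. u k * u l * (\<Sum>i=1..j. y i ^ (q ^ (l - k)) * x i + y i * x i ^ (q ^ (l - k))) ^ (q ^ k))"
    by (intro sum.cong refl) (simp add: off)
  finally show ?thesis by (simp only: diag)
qed

text \<open>Independence makes the map from coefficient tuples to the span injective. Tuples are
  taken as extensional functions, so that values outside \<open>{1..j}\<close> are not
  counted.\<close>

lemma card_lspan:
  assumes indep: "\<And>c. (\<Sum>i=1..j. C (c i) * x i) = 0 \<Longrightarrow> \<forall>i\<in>{1..j}. c i = 0"
  shows "finite (lspan C x j)" "card (lspan C x j) = q ^ j"
proof -
  let ?P = "{1..j} \<rightarrow>\<^sub>E (UNIV :: 'a set)" and ?f = "\<lambda>c. \<Sum>i=1..j. C (c i) * x i"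
  have "lspan C x j = ?f ` ?P"
  proof
    show "lspan C x j \<subseteq> ?f ` ?P"
    proof
      fix v assume "v \<in> lspan C x j"
      then obtain c where "v = ?f c" unfolding lspan_def by blast
      also have "\<dots> = ?f (restrict c {1..j})" by (rule sum.cong) auto
      finally show "v \<in> ?f ` ?P" by (rule image_eqI[where x = "restrict c {1..j}"]) simp
    qed
  qed (auto simp: lspan_def)
  moreover have "inj_on ?f ?P"
  proof (rule inj_onI)
    fix c d assume cd: "c \<in> ?P" "d \<in> ?P" "?f c = ?f d"
    have "?f (\<lambda>i. c i - d i) = ?f c - ?f d"
      by (simp add: hom_minus left_diff_distrib sum_subtractf)
    then have "\<forall>i\<in>{1..j}. c i - d i = 0" using cd indep[of "\<lambda>i. c i - d i"] by simp
    then show "c = d" using cd by (intro PiE_ext) auto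
  qed
  ultimately show "finite (lspan C x j)" "card (lspan C x j) = q ^ j"
    by (simp_all add: card_image card_PiE q_def finite_PiE)
qed

end

section \<open>Rational functions\<close>

lemma polys_simps:
  fixes p p' :: "'a::comm_ring_1 mpoly"
  shows "0 \<in> polys n" "1 \<in> polys n" "Const c \<in> polys n"
    "1 \<le> i \<Longrightarrow> i \<le> n \<Longrightarrow> (Var i :: 'a mpoly) \<in> polys n"
    "p \<in> polys n \<Longrightarrow> p' \<in> polys n \<Longrightarrow> p + p' \<in> polys n"
    "p \<in> polys n \<Longrightarrow> p' \<in> polys n \<Longrightarrow> p * p' \<in> polys n"
    "p \<in> polys n \<Longrightarrow> - p \<in> polys n"
proof -
  show "0 \<in> polys n" "1 \<in> polys n" "Const c \<in> polys n" by (auto simp: polys_def Const_def)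
  show "1 \<le> i \<Longrightarrow> i \<le> n \<Longrightarrow> (Var i :: 'a mpoly) \<in> polys n" by (auto simp: polys_def Var_def)
  show "p \<in> polys n \<Longrightarrow> p' \<in> polys n \<Longrightarrow> p + p' \<in> polys n"
    unfolding polys_def using Poly_Mapping.keys_add[of p p'] by blast
  show mult: "p \<in> polys n \<Longrightarrow> p' \<in> polys n \<Longrightarrow> p * p' \<in> polys n" for p p' :: "'a mpoly"
  proof -
    assume "p \<in> polys n" "p' \<in> polys n"
    moreover have "Poly_Mapping.keys (\<mu> + \<nu>) \<subseteq> {1..n}"
      if "Poly_Mapping.keys \<mu> \<subseteq> {1..n}" "Poly_Mapping.keys \<nu> \<subseteq> {1..n}" for \<mu> \<nu> :: "nat \<Rightarrow>\<^sub>0 nat"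
      using that Poly_Mapping.keys_add[of \<mu> \<nu>] by blast
    ultimately show "p * p' \<in> polys n"
      unfolding polys_def using keys_mult[of p p'] by blast
  qed
  interpret K: comm_ring_hom "Const :: 'a \<Rightarrow> 'a mpoly" by (rule comm_ring_hom_Const)
  have "- p = Const (- 1) * p" by (simp add: K.hom_uminus)
  moreover have "Const (- 1) \<in> polys n" by (auto simp: polys_def Const_def)
  ultimately show "p \<in> polys n \<Longrightarrow> - p \<in> polys n" using mult by metis
qed

lemma polys_sum:
  fixes f :: "'c \<Rightarrow> 'a::comm_ring_1 mpoly"
  shows "(\<And>i. i \<in> I \<Longrightarrow> f i \<in> polys n) \<Longrightarrow> sum f I \<in> polys n"
  by (induction I rule: infinite_finite_induct) (auto simp: polys_simps)

lemma polys_prod: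
  fixes f :: "'c \<Rightarrow> 'a::comm_ring_1 mpoly"
  shows "(\<And>i. i \<in> I \<Longrightarrow> f i \<in> polys n) \<Longrightarrow> prod f I \<in> polys n"
  by (induction I rule: infinite_finite_induct) (auto simp: polys_simps)

lemma polys_power:
  fixes p :: "'a::comm_ring_1 mpoly"
  shows "p \<in> polys n \<Longrightarrow> p ^ k \<in> polys n"
  by (induction k) (auto simp: polys_simps)

lemma mpoly_act_polys:
  fixes p :: "'a::field mpoly"
  assumes "p \<in> polys n"
  shows "mpoly_act n g p \<in> polys n"
  unfolding mpoly_act_def mpoly_eval_def
proof (intro polys_sum polys_simps(6) polys_prod polys_power)
  fix j assume "j \<in> {1..n}"
  then show "(Var j :: 'a mpoly) \<in> polys n" by (simp add: polys_simps)
qed (rule polys_simps)+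

lemma mpoly_act_Var: "mpoly_act n g (Var i) = (\<Sum>j=1..n. Const (the (mat_inverse g) $$ (i - 1, j - 1)) * Var j)"
  unfolding mpoly_act_def by (rule mpoly_eval_Var[OF comm_ring_hom_Const])

lemma mpoly_act_Const: "mpoly_act n g (Const c) = Const c"
  unfolding mpoly_act_def by (rule mpoly_eval_Const[OF comm_ring_hom_Const])

section \<open>Polynomials inside their fraction field\<close>

lemma comm_ring_hom_to_fract: "comm_ring_hom (to_fract :: 'a::idom \<Rightarrow> 'a fract)"
  by unfold_locales simp_all

lemma to_fract_sum:
  fixes f :: "'c \<Rightarrow> 'a::idom"
  shows "to_fract (sum f I) = (\<Sum>i\<in>I. to_fract (f i))"
proof -
  interpret comm_ring_hom "to_fract :: 'a \<Rightarrow> 'a fract" by (rule comm_ring_hom_to_fract)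
  show ?thesis by (rule hom_sum)
qed

lemma to_fract_prod:
  fixes f :: "'c \<Rightarrow> 'a::idom"
  shows "to_fract (prod f I) = (\<Prod>i\<in>I. to_fract (f i))"
proof -
  interpret comm_ring_hom "to_fract :: 'a \<Rightarrow> 'a fract" by (rule comm_ring_hom_to_fract)
  show ?thesis by (rule hom_prod)
qed

lemma to_fract_power:
  fixes x :: "'a::idom"
  shows "to_fract (x ^ k) = to_fract x ^ k"
proof -
  interpret comm_ring_hom "to_fract :: 'a \<Rightarrow> 'a fract" by (rule comm_ring_hom_to_fract)
  show ?thesis by (rule hom_power)
qed

text \<open>Evaluating \<open>p\<close> at its own variables returns \<open>p\<close>, which
  exhibits it as a sum of products of constants and variables.\<close>

lemma to_fract_polys_mem:
  fixes p :: "'a::idom mpoly"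
  assumes "subfield_set K" "\<And>c. to_fract (Const c) \<in> K"
    and "\<And>i. 1 \<le> i \<Longrightarrow> i \<le> n \<Longrightarrow> to_fract (Var i) \<in> K" and p: "p \<in> polys n"
  shows "to_fract p \<in> K"
proof -
  interpret K: subfield_set K by fact
  have "to_fract (mpoly_eval Const Var p) \<in> K"
    unfolding mpoly_eval_def to_fract_sum to_fract_mult to_fract_prod to_fract_power
  proof (intro K.mems assms(2))
    fix \<mu> i assume "\<mu> \<in> Poly_Mapping.keys p" "i \<in> Poly_Mapping.keys \<mu>"
    then have "i \<in> {1..n}" using p unfolding polys_def by blast
    then show "to_fract (Var i) \<in> K" using assms(3) by simp
  qed
  then show ?thesis by (simp only: mpoly_eval_Const_Var)
qed

lemma to_fract_ratfuns: "p \<in> polys n \<Longrightarrow> to_fract p \<in> ratfuns n"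
  unfolding ratfuns_def to_fract_def using polys_simps(2) by (force simp: mem_Collect_eq)

lemma subfield_ratfuns: "subfield_set (ratfuns n :: 'a::idom mpoly fract set)"
proof
  show "1 \<in> (ratfuns n :: 'a mpoly fract set)"
    using to_fract_ratfuns[of 1 n] polys_simps(2) by force
next
  fix x y :: "'a mpoly fract"
  assume "x \<in> ratfuns n" "y \<in> ratfuns n"
  then obtain p h p' h' where *: "p \<in> polys n" "h \<in> polys n" "h \<noteq> 0" "x = Fract p h"
     "p' \<in> polys n" "h' \<in> polys n" "h' \<noteq> 0" "y = Fract p' h'"
    unfolding ratfuns_def by blast
  then have "x + y = Fract (p * h' + p' * h) (h * h')" "x * y = Fract (p * p') (h * h')" by simp_all
  moreover have "p * h' + p' * h \<in> polys n" "p * p' \<in> polys n" "h * h' \<in> polys n" "h * h' \<noteq> 0"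
    using * by (simp_all add: polys_simps)
  ultimately show "x + y \<in> ratfuns n" "x * y \<in> ratfuns n" unfolding ratfuns_def by blast+
next
  fix x :: "'a mpoly fract"
  assume "x \<in> ratfuns n"
  then obtain p h where *: "p \<in> polys n" "h \<in> polys n" "h \<noteq> 0" "x = Fract p h"
    unfolding ratfuns_def by blast
  have "- x = Fract (- p) h" "- p \<in> polys n" using * by (simp_all add: polys_simps)
  then show "- x \<in> ratfuns n" unfolding ratfuns_def using * by blast
  show "inverse x \<in> ratfuns n"
  proof (cases "p = 0")
    case True
    then have "inverse x = to_fract 0" using * by (simp add: Fract_conv_to_fract)
    then show ?thesis using to_fract_ratfuns polys_simps(1) by metis
  next
    case False
    have "inverse x = Fract h p" using * by simp
    then show ?thesis unfolding ratfuns_def using * False by blast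
  qed
qed

text \<open>Describes the ambient field by generators, so that it can be compared with the top field
  of the tower.\<close>

lemma ratfuns_eq_field_gen:
  "(ratfuns n :: 'a::idom mpoly fract set) = field_gen ((\<lambda>i. to_fract (Var i)) ` {1..n})"
proof
  interpret K: subfield_set "field_gen ((\<lambda>i. to_fract (Var i :: 'a mpoly)) ` {1..n})"
    by (rule subfield_field_gen)
  have *: "to_fract p \<in> field_gen ((\<lambda>i. to_fract (Var i :: 'a mpoly)) ` {1..n})" if "p \<in> polys n" for p
    by (rule to_fract_polys_mem[OF K.subfield_set_axioms _ _ that]) (auto intro: field_gen_gens)
  show "(ratfuns n :: 'a mpoly fract set) \<subseteq> field_gen ((\<lambda>i. to_fract (Var i)) ` {1..n})"
    unfolding ratfuns_def Fract_conv_to_fract using * K.divide_mem by blast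
  show "field_gen ((\<lambda>i. to_fract (Var i)) ` {1..n}) \<subseteq> (ratfuns n :: 'a mpoly fract set)"
    by (rule field_gen_least) (auto intro!: subfield_ratfuns to_fract_ratfuns polys_simps)
qed

section \<open>Matrices as automorphisms of the rational functions\<close>

context
  fixes n :: nat and g :: "'a::field mat"
  assumes g: "g \<in> carrier_mat n n" "invertible_mat g"
begin

lemma ratfun_act_to_fract:
  "p \<in> polys n \<Longrightarrow> ratfun_act n g (to_fract p) = to_fract (mpoly_act n g p)"
proof -
  interpret A: comm_ring_hom "mpoly_act n g" by (rule comm_ring_hom_mpoly_act)
  assume "p \<in> polys n"
  then show ?thesis
    unfolding to_fract_def by (subst ratfun_act_Fract[OF g]) (simp_all add: polys_simps)
qed

lemma ratfun_act_hom:
  assumes "x \<in> ratfuns n" "y \<in> ratfuns n"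
  shows "ratfun_act n g (x + y) = ratfun_act n g x + ratfun_act n g y"
    "ratfun_act n g (x * y) = ratfun_act n g x * ratfun_act n g y"
proof -
  interpret A: comm_ring_hom "mpoly_act n g" by (rule comm_ring_hom_mpoly_act)
  obtain p h p' h' where *: "p \<in> polys n" "h \<in> polys n" "h \<noteq> 0" "x = Fract p h"
     "p' \<in> polys n" "h' \<in> polys n" "h' \<noteq> 0" "y = Fract p' h'"
    using assms unfolding ratfuns_def by blast
  have nz: "mpoly_act n g h \<noteq> 0" "mpoly_act n g h' \<noteq> 0"
    using mpoly_act_eq_0_iff[OF g] * by auto
  have "x + y = Fract (p * h' + p' * h) (h * h')" "x * y = Fract (p * p') (h * h')"
    using * by simp_all
  moreover have "p * h' + p' * h \<in> polys n" "p * p' \<in> polys n" "h * h' \<in> polys n" "h * h' \<noteq> 0"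
    using * by (simp_all add: polys_simps)
  ultimately show "ratfun_act n g (x + y) = ratfun_act n g x + ratfun_act n g y"
    "ratfun_act n g (x * y) = ratfun_act n g x * ratfun_act n g y"
    using * nz by (simp_all add: ratfun_act_Fract[OF g] A.hom_add A.hom_mult)
qed

lemma ratfun_act_Const: "ratfun_act n g (to_fract (Const c)) = to_fract (Const c)"
  by (simp add: ratfun_act_to_fract polys_simps mpoly_act_Const)

text \<open>Since the fixed elements form a field, invariance of a generated field has to be checked
  on generators only.\<close>

lemma subfield_ratfun_act_fixed: "subfield_set {f \<in> ratfuns n. ratfun_act n g f = f}"
proof -
  interpret R: subfield_set "ratfuns n :: 'a mpoly fract set" by (rule subfield_ratfuns)
  interpret K: comm_ring_hom "Const :: 'a \<Rightarrow> 'a mpoly" by (rule comm_ring_hom_Const)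
  show ?thesis
  proof
    show "1 \<in> {f \<in> ratfuns n. ratfun_act n g f = f}"
      using ratfun_act_Const[of 1] R.one_mem by simp
  next
    fix x y assume "x \<in> {f \<in> ratfuns n. ratfun_act n g f = f}" "y \<in> {f \<in> ratfuns n. ratfun_act n g f = f}"
    then show "x + y \<in> {f \<in> ratfuns n. ratfun_act n g f = f}" "x * y \<in> {f \<in> ratfuns n. ratfun_act n g f = f}"
      using R.mems by (auto simp: ratfun_act_hom)
  next
    fix x assume x: "x \<in> {f \<in> ratfuns n. ratfun_act n g f = f}"
    have "to_fract (Const (- 1)) \<in> ratfuns n" by (intro to_fract_ratfuns polys_simps)
    \<comment> \<open>Negation is reduced to multiplication by a constant, which the action
      fixes.\<close>
    moreover have "- x = to_fract (Const (- 1)) * x" by (simp add: K.hom_uminus)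
    ultimately show "- x \<in> {f \<in> ratfuns n. ratfun_act n g f = f}"
      using x ratfun_act_hom(2)[of "to_fract (Const (- 1))" x] R.uminus_mem[of x]
      by (simp add: ratfun_act_Const)
    have inv: "inverse x \<in> ratfuns n" using x R.inverse_mem by simp
    show "inverse x \<in> {f \<in> ratfuns n. ratfun_act n g f = f}"
    proof (cases "x = 0")
      case True
      then show ?thesis using x inv by simp
    next
      case False
      have "ratfun_act n g x * ratfun_act n g (inverse x) = 1"
        using ratfun_act_hom(2)[of x "inverse x"] ratfun_act_Const[of 1] x inv False by simp
      then have "ratfun_act n g (inverse x) = inverse x"
        using x by (auto dest: inverse_unique)
      then show ?thesis using inv by simp
    qed
  qed
qed

text \<open>An automorphism that fixes the coefficients sends a value at \<open>t\<close> to the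
  value at the image of \<open>t\<close>. This supplies the conjugates in the descent.\<close>

lemma ratfun_act_poly:
  assumes K: "subfield_set K" "K \<subseteq> ratfuns n" "\<And>x. x \<in> K \<Longrightarrow> ratfun_act n g x = x"
    and p: "p \<in> subfield_set.polys_over K" and t: "t \<in> ratfuns n"
  shows "ratfun_act n g (poly p t) = poly p (ratfun_act n g t)"
proof -
  interpret K: subfield_set K by fact
  interpret R: subfield_set "ratfuns n :: 'a mpoly fract set" by (rule subfield_ratfuns)
  \<comment> \<open>Membership in \<open>ratfuns n\<close> is carried through the induction, because
    the homomorphism laws are available only there.\<close>
  have "poly p t \<in> ratfuns n \<and> ratfun_act n g (poly p t) = poly p (ratfun_act n g t)"
    using p
  proof (induction p)
    case 0
    show ?case using K(3)[OF K.zero_mem] R.zero_mem by simp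
  next
    case (pCons a p)
    have c: "coeff (pCons a p) i \<in> K" for i using pCons.prems by (simp add: K.polys_over_def)
    have a: "a \<in> K" using c[of 0] by simp
    have p: "p \<in> K.polys_over" using c[of "Suc _"] by (simp add: K.polys_over_def)
    have "a \<in> ratfuns n" "t * poly p t \<in> ratfuns n" using a K(2) pCons.IH[OF p] t R.mult_mem by blast+
    then show ?case
      using pCons.IH[OF p] t K(3)[OF a] R.add_mem by (simp add: ratfun_act_hom)
  qed
  then show ?thesis by simp
qed

end

section \<open>Constants and variables as scalars and independent elements\<close>

lemma two_eq_0_fract:
  assumes "CARD('a::{finite,field}) = 2 ^ r"
  shows "(2 :: 'a mpoly) = 0" "(2 :: 'a mpoly fract) = 0"
proof -
  interpret K: comm_ring_hom "Const :: 'a \<Rightarrow> 'a mpoly" by (rule comm_ring_hom_Const)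
  have "Const 2 = (2 :: 'a mpoly)" by (metis K.hom_add K.hom_one one_add_one)
  then show *: "(2 :: 'a mpoly) = 0" using two_eq_0[OF assms] by simp
  have "to_fract 2 = (2 :: 'a mpoly fract)" by (metis to_fract_1 to_fract_add one_add_one)
  then show "(2 :: 'a mpoly fract) = 0" using * by simp
qed

lemma scalars_Const:
  assumes "CARD('a::{finite,field}) = 2 ^ r"
  shows "scalars (\<lambda>c::'a. to_fract (Const c)) CARD('a) r"
proof -
  interpret K: comm_ring_hom "Const :: 'a \<Rightarrow> 'a mpoly" by (rule comm_ring_hom_Const)
  show ?thesis
    by unfold_locales (simp_all add: assms two_eq_0_fract[OF assms] K.hom_add K.hom_mult)
qed

text \<open>After clearing the embedding, the coefficient of the monomial \<open>x_i\<close> in the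
  sum is \<open>c i\<close>.\<close>

lemma Var_independent:
  fixes c :: "nat \<Rightarrow> 'a::idom"
  assumes "(\<Sum>i=1..j. to_fract (Const (c i)) * to_fract (Var i)) = 0" "i \<in> {1..j}"
  shows "c i = 0"
proof -
  have "to_fract (\<Sum>i=1..j. Const (c i) * Var i) = 0" using assms(1) by (simp add: to_fract_sum)
  then have "(\<Sum>i=1..j. Const (c i) * Var i) = 0" by (simp only: to_fract_eq_0_iff)
  then have "Poly_Mapping.lookup (\<Sum>i=1..j. Const (c i) * Var i) (Poly_Mapping.single i 1) = 0" by simp
  moreover have "Poly_Mapping.single i' (1::nat) = Poly_Mapping.single i 1 \<longleftrightarrow> i' = i" for i'
    by (auto dest: arg_cong[of _ _ Poly_Mapping.keys])
  then have "Poly_Mapping.lookup (Const (c i') * Var i') (Poly_Mapping.single i 1) = (if i' = i then c i else 0)" for i'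
    by (auto simp: Const_def Var_def mult_single lookup_single when_def)
  ultimately show ?thesis using assms(2) by (simp add: lookup_sum)
qed

section \<open>Isometries and the group \<open>G\<^sub>1\<close>\<close>

text \<open>Additivity and the square rule for scalars determine \<open>f\<close> from the unit
  vectors. It is applied to the difference of two quadratic forms with the same polar form.\<close>

lemma quadratic_zero:
  fixes f :: "'b::comm_ring_1 vec \<Rightarrow> 'b"
  assumes add: "\<And>u v. u \<in> carrier_vec n \<Longrightarrow> v \<in> carrier_vec n \<Longrightarrow> f (u + v) = f u + f v"
    and smult: "\<And>c v. v \<in> carrier_vec n \<Longrightarrow> f (c \<cdot>\<^sub>v v) = c\<^sup>2 * f v"
    and unit: "\<And>j. j < n \<Longrightarrow> f (unit_vec n j) = 0"
    and v: "v \<in> carrier_vec n"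
  shows "f v = 0"
proof -
  \<comment> \<open>Induction on the number of leading coordinates of \<open>v\<close> that are
    kept.\<close>
  have "f (vec n (\<lambda>j. if j < k then v $ j else 0)) = 0" if "k \<le> n" for k
    using that
  proof (induction k)
    case 0
    have "f (0 \<cdot>\<^sub>v vec n (\<lambda>j. 0)) = 0" by (subst smult) auto
    moreover have "vec n (\<lambda>j. if j < 0 then v $ j else 0) = 0 \<cdot>\<^sub>v vec n (\<lambda>j. 0)"
      by (rule eq_vecI) auto
    ultimately show ?case by (simp only:)
  next
    case (Suc k)
    let ?u = "vec n (\<lambda>j. if j < k then v $ j else 0)"
    have "vec n (\<lambda>j. if j < Suc k then v $ j else 0) = ?u + v $ k \<cdot>\<^sub>v unit_vec n k"
      using Suc.prems by (intro eq_vecI) (auto simp: less_Suc_eq unit_vec_def)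
    moreover have "f (?u + v $ k \<cdot>\<^sub>v unit_vec n k) = f ?u + (v $ k)\<^sup>2 * f (unit_vec n k)"
      by (subst add) (auto simp: smult)
    moreover have "f ?u = 0" "f (unit_vec n k) = 0"
      using Suc unit by auto
    ultimately show ?case by (simp only: mult_zero_right add_0_left)
  qed
  moreover have "vec n (\<lambda>j. if j < n then v $ j else 0) = v"
    using v by (intro eq_vecI) auto
  ultimately show ?thesis by (metis order_refl)
qed

section \<open>The antidiagonal matrix and the polar form\<close>

lemma antidiag_carrier: "antidiag n \<in> carrier_mat n n"
  by (simp add: antidiag_def)

lemma antidiag_mult_index:
  fixes M :: "'b::comm_ring_1 mat"
  assumes "M \<in> carrier_mat n n'" "i < n" "j < n'"
  shows "(antidiag n * M) $$ (i,j) = M $$ (n - 1 - i, j)"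
proof -
  have "(antidiag n * M) $$ (i,j) = (\<Sum>k<n. (if i + k = n - 1 then 1 else 0) * M $$ (k,j))"
    using assms by (auto simp: antidiag_def scalar_prod_def atLeast0LessThan intro!: sum.cong)
  also have "\<dots> = (\<Sum>k<n. if k = n - 1 - i then M $$ (k,j) else 0)"
    by (rule sum.cong) (use assms in auto)
  also have "\<dots> = M $$ (n - 1 - i, j)" using assms by (subst sum.delta) auto
  finally show ?thesis .
qed

lemma mult_antidiag_index:
  fixes M :: "'b::comm_ring_1 mat"
  assumes "M \<in> carrier_mat n' n" "i < n'" "j < n"
  shows "(M * antidiag n) $$ (i,j) = M $$ (i, n - 1 - j)"
proof -
  have "(M * antidiag n) $$ (i,j) = (\<Sum>k<n. M $$ (i,k) * (if k + j = n - 1 then 1 else 0))"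
    using assms by (auto simp: antidiag_def scalar_prod_def atLeast0LessThan intro!: sum.cong)
  also have "\<dots> = (\<Sum>k<n. if k = n - 1 - j then M $$ (i,k) else 0)"
    by (rule sum.cong) (use assms in auto)
  also have "\<dots> = M $$ (i, n - 1 - j)" using assms by (subst sum.delta) auto
  finally show ?thesis .
qed

lemma bform_mult_mat:
  fixes N :: "'b::comm_ring_1 mat"
  assumes N: "N \<in> carrier_mat (2*m+2) (2*m+2)"
    and uv: "u \<in> carrier_vec (2*m+2)" "v \<in> carrier_vec (2*m+2)"
  shows "bform m (N *\<^sub>v u) (N *\<^sub>v v) = u \<bullet> ((transpose_mat N * antidiag (2*m+2) * N) *\<^sub>v v)"
proof -
  let ?n = "2*m+2" and ?J = "antidiag (2*m+2) :: 'b mat"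
  have J: "?J \<in> carrier_mat ?n ?n" by (rule antidiag_carrier)
  have "bform m (N *\<^sub>v u) (N *\<^sub>v v) = (N *\<^sub>v u) \<bullet> (?J *\<^sub>v (N *\<^sub>v v))"
    by (rule bform_scalar_prod) (use uv N in auto)
  also have "\<dots> = u \<bullet> (transpose_mat N *\<^sub>v (?J *\<^sub>v (N *\<^sub>v v)))"
    using transpose_vec_mult_scalar[of "transpose_mat N" ?n ?n "?J *\<^sub>v (N *\<^sub>v v)" u] N J uv by simp
  also have "transpose_mat N *\<^sub>v (?J *\<^sub>v (N *\<^sub>v v)) = (transpose_mat N * ?J * N) *\<^sub>v v"
    using N J uv by (simp add: assoc_mult_mat_vec[of _ ?n ?n _ ?n])
  finally show ?thesis .
qed

text \<open>The entries of the matrix product on the left are the values of \<open>bform\<close> at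
  pairs of columns of \<open>N\<close>, which are the images of the unit vectors.\<close>

lemma bform_preserved_iff:
  fixes N :: "'b::comm_ring_1 mat"
  assumes N: "N \<in> carrier_mat (2*m+2) (2*m+2)"
  shows "transpose_mat N * antidiag (2*m+2) * N = antidiag (2*m+2) \<longleftrightarrow>
    (\<forall>u\<in>carrier_vec (2*m+2). \<forall>v\<in>carrier_vec (2*m+2). bform m (N *\<^sub>v u) (N *\<^sub>v v) = bform m u v)"
proof
  assume "transpose_mat N * antidiag (2*m+2) * N = antidiag (2*m+2)"
  then show "\<forall>u\<in>carrier_vec (2*m+2). \<forall>v\<in>carrier_vec (2*m+2). bform m (N *\<^sub>v u) (N *\<^sub>v v) = bform m u v"
    by (simp add: bform_mult_mat[OF N] bform_scalar_prod del: add_2_eq_Suc')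
next
  let ?n = "2*m+2" and ?J = "antidiag (2*m+2) :: 'b mat"
  let ?M = "transpose_mat N * ?J * N"
  assume *: "\<forall>u\<in>carrier_vec ?n. \<forall>v\<in>carrier_vec ?n. bform m (N *\<^sub>v u) (N *\<^sub>v v) = bform m u v"
  have J: "?J \<in> carrier_mat ?n ?n" by (rule antidiag_carrier)
  have M: "?M \<in> carrier_mat ?n ?n" using N J by auto
  have entry: "unit_vec ?n i \<bullet> (M *\<^sub>v unit_vec ?n j) = M $$ (i,j)"
    if "M \<in> carrier_mat ?n ?n" "i < ?n" "j < ?n" for M :: "'b mat" and i j
    using that by (subst scalar_prod_left_unit[of _ ?n]) auto
  show "?M = ?J"
  proof (rule eq_matI)
    fix i j assume "i < dim_row ?J" "j < dim_col ?J"
    then have ij: "i < ?n" "j < ?n" using J by auto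
    have "?M $$ (i,j) = bform m (N *\<^sub>v unit_vec ?n i) (N *\<^sub>v unit_vec ?n j)"
      unfolding bform_mult_mat[OF N unit_vec_carrier unit_vec_carrier] by (rule entry[OF M ij, symmetric])
    also have "\<dots> = bform m (unit_vec ?n i) (unit_vec ?n j)" using * by simp
    also have "\<dots> = ?J $$ (i,j)"
      unfolding bform_scalar_prod[OF unit_vec_carrier unit_vec_carrier] by (rule entry[OF J ij])
    finally show "?M $$ (i,j) = ?J $$ (i,j)" .
  qed (use M J in auto)
qed

text \<open>Polarization: \<open>bform m u v\<close> is determined by the values of
  \<open>qform\<close> at \<open>u\<close>, \<open>v\<close> and \<open>u + v\<close>.\<close>

lemma bform_preserved:
  fixes N :: "'b::comm_ring_1 mat"
  assumes two: "(2::'b) = 0" and N: "N \<in> carrier_mat (2*m+2) (2*m+2)"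
    and Q: "\<And>v. v \<in> carrier_vec (2*m+2) \<Longrightarrow> qform m a (N *\<^sub>v v) = qform m a v"
    and uv: "u \<in> carrier_vec (2*m+2)" "v \<in> carrier_vec (2*m+2)"
  shows "bform m (N *\<^sub>v u) (N *\<^sub>v v) = bform m u v"
proof -
  have "qform m a (N *\<^sub>v u) + qform m a (N *\<^sub>v v) + bform m (N *\<^sub>v u) (N *\<^sub>v v) = qform m a (N *\<^sub>v (u + v))"
    unfolding mult_add_distrib_mat_vec[OF N uv] by (rule qform_add[OF two, symmetric]) (use N uv in auto)
  also have "\<dots> = qform m a u + qform m a v + bform m u v"
    using Q[of "u + v"] uv qform_add[OF two uv] by simp
  finally show ?thesis using Q uv by simp
qed

text \<open>With \<open>J\<close> the antidiagonal matrix, the hypothesis and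
  \<open>J * J = 1\<close> show that the inverse is \<open>J * transpose_mat N * J\<close>, the
  reflection of \<open>N\<close> in the antidiagonal.\<close>

lemma mat_inverse_index:
  fixes N :: "'a::field mat"
  assumes N: "N \<in> carrier_mat n n" and NJN: "transpose_mat N * antidiag n * N = antidiag n"
    and ij: "i < n" "j < n"
  shows "the (mat_inverse N) $$ (i,j) = N $$ (n - 1 - j, n - 1 - i)"
proof -
  let ?J = "antidiag n :: 'a mat"
  have J: "?J \<in> carrier_mat n n" by (rule antidiag_carrier)
  have Nt: "transpose_mat N \<in> carrier_mat n n" using N by simp
  define L where "L = ?J * transpose_mat N * ?J"
  have L: "L \<in> carrier_mat n n" using J Nt by (auto simp: L_def)
  have "L * N = ?J * (transpose_mat N * ?J * N)"
    unfolding L_def using J N Nt by (simp only: assoc_mult_mat[of _ n n _ n _ n] mult_carrier_mat[of _ n n _ n])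
  then have LN: "L * N = 1\<^sub>m n" by (simp only: NJN antidiag_square)
  have "N * L = 1\<^sub>m n" using mat_mult_left_right_inverse[OF L N LN] .
  then have inv: "invertible_mat N"
    using LN L N unfolding invertible_mat_def inverts_mat_def square_mat.simps by (metis carrier_matD)
  note G = mat_inverse_invertible[OF N inv]
  have "L = L * (N * the (mat_inverse N))" using G L by simp
  also have "\<dots> = L * N * the (mat_inverse N)" using assoc_mult_mat[OF L N G(1)] by simp
  finally have "the (mat_inverse N) = L" using LN G by simp
  moreover have "L $$ (i,j) = N $$ (n - 1 - j, n - 1 - i)"
    unfolding L_def using ij N
    by (subst mult_antidiag_index[of _ n n]) (use mult_carrier_mat[OF J Nt] in \<open>auto simp: antidiag_mult_index[OF Nt]\<close>)
  ultimately show ?thesis by simp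
qed

section \<open>Members of \<open>G1\<close> as unitriangular isometries\<close>

lemma G1D:
  fixes a :: "'a::{finite,field}"
  assumes card: "CARD('a) = 2 ^ r" and N: "N \<in> G1 m a"
  shows "N \<in> unitri (2*m+2)" "N \<in> carrier_mat (2*m+2) (2*m+2)" "invertible_mat N" "N $$ (m+1,m) = 0"
    "\<And>v. v \<in> carrier_vec (2*m+2) \<Longrightarrow> qform m a (N *\<^sub>v v) = qform m a v"
    "transpose_mat N * antidiag (2*m+2) * N = antidiag (2*m+2)"
proof -
  show 1: "N \<in> unitri (2*m+2)" using N unfolding G1_def by blast
  then show "N \<in> carrier_mat (2*m+2) (2*m+2)" unfolding unitri_def by blast
  from N obtain A B C D E where *: "A \<in> unitri m" "E \<in> unitri m"
     "B \<in> carrier_mat 2 m" "C \<in> carrier_mat m m" "D \<in> carrier_mat m 2"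
     "N = block_mat m A B C D E"
     "transpose_mat N * antidiag (2*m+2) * N = antidiag (2*m+2)"
    unfolding G1_def by blast
  then show "transpose_mat N * antidiag (2*m+2) * N = antidiag (2*m+2)" by blast
  have "A \<in> carrier_mat m m" "E \<in> carrier_mat m m" using * unfolding unitri_def by blast+
  \<comment> \<open>This is the one entry of the middle block \<open>I_2\<close> that
    unitriangularity leaves open.\<close>
  then show "N $$ (m+1,m) = 0" unfolding *(6) by (subst block_mat_index) (use * in auto)
  have "N \<in> O_minus m a" using G1_subset_O_minus[OF card] N by blast
  then show "invertible_mat N" "\<And>v. v \<in> carrier_vec (2*m+2) \<Longrightarrow> qform m a (N *\<^sub>v v) = qform m a v"
    unfolding O_minus_def mem_Collect_eq point_eval_h1 by blast+
qed

text \<open>Converse of \<open>G1D\<close>: the blocks are cut out of \<open>N\<close>, and the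
  condition on the diagonal of \<open>S\<close> says that each of the first \<open>m\<close> columns
  of \<open>N\<close> is a singular vector.\<close>

lemma G1I:
  fixes a :: "'a::{finite,field}"
  assumes two: "(2::'a) = 0" and N: "N \<in> unitri (2*m+2)" "N $$ (m+1,m) = 0"
    and Q: "\<And>v. v \<in> carrier_vec (2*m+2) \<Longrightarrow> qform m a (N *\<^sub>v v) = qform m a v"
  shows "N \<in> G1 m a"
proof -
  let ?n = "2*m+2"
  have c: "N \<in> carrier_mat ?n ?n" using N unfolding unitri_def by blast
  have diag: "N $$ (i,i) = 1" if "i < ?n" for i using N that unfolding unitri_def by blast
  have upper: "N $$ (i,j) = 0" if "j < ?n" "i < j" for i j
    using N that unfolding unitri_def by (auto dest: order.strict_trans)
  define A where "A = mat m m (\<lambda>(i,j). N $$ (i,j))"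
  define B where "B = mat 2 m (\<lambda>(i,j). N $$ (m+i,j))"
  define C where "C = mat m m (\<lambda>(i,j). N $$ (m+2+i,j))"
  define D where "D = mat m 2 (\<lambda>(i,j). N $$ (m+2+i,m+j))"
  define E where "E = mat m m (\<lambda>(i,j). N $$ (m+2+i,m+2+j))"
  have car: "A \<in> carrier_mat m m" "B \<in> carrier_mat 2 m" "C \<in> carrier_mat m m"
      "D \<in> carrier_mat m 2" "E \<in> carrier_mat m m"
    by (simp_all add: A_def B_def C_def D_def E_def)
  have "A \<in> unitri m" "E \<in> unitri m"
    by (auto simp: unitri_def A_def E_def intro: diag upper)
  moreover have "N = block_mat m A B C D E"
  proof (rule eq_matI)
    fix i j assume "i < dim_row (block_mat m A B C D E)" "j < dim_col (block_mat m A B C D E)"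
    then have ij: "i < ?n" "j < ?n"
      using car by (auto simp: block_mat_def append_rows_def)
    have "N $$ (i,j) = 0" if "i < m" "\<not> j < m" using that ij upper[of j i] by simp
    moreover have "N $$ (i,j) = (if i = j then 1 else 0)" if "\<not> i < m" "i < m + 2" "\<not> j < m"
    proof -
      have "i = j \<or> i < j \<or> (i = m + 1 \<and> j = m)" using that by presburger
      then show ?thesis using ij diag upper N(2) by auto
    qed
    moreover have "N $$ (i,j) = 0" if "\<not> i < m" "i < m + 2" "\<not> j < m + 2" using that ij upper[of j i] by simp
    moreover have "Suc (Suc (k - 2)) = k" if "\<not> k < Suc (Suc m)" for k using that by linarith
    ultimately show "N $$ (i,j) = block_mat m A B C D E $$ (i,j)"
      unfolding block_mat_index[OF car ij] using ij
      by (auto simp: A_def B_def C_def D_def E_def)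
  qed (use c car in \<open>auto simp: block_mat_def append_rows_def\<close>)
  moreover have "transpose_mat N * antidiag ?n * N = antidiag ?n"
    unfolding bform_preserved_iff[OF c] using bform_preserved[OF two c Q] by blast
  moreover have "(transpose_mat A * antidiag m * C) $$ (j,j)
      = (B $$ (0,j))\<^sup>2 + B $$ (0,j) * B $$ (1,j) + a * (B $$ (1,j))\<^sup>2" if j: "j < m" for j
  proof -
    have "(transpose_mat A * antidiag m * C) $$ (j,j)
        = (\<Sum>k<m. (transpose_mat A * antidiag m) $$ (j,k) * C $$ (k,j))"
      using j car by (auto simp: antidiag_def scalar_prod_def atLeast0LessThan intro!: sum.cong)
    also have "\<dots> = (\<Sum>k<m. A $$ (m-1-k,j) * C $$ (k,j))"
      by (rule sum.cong) (use j car in \<open>auto simp: mult_antidiag_index[of _ m m]\<close>)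
    also have "\<dots> = (\<Sum>i<m. N $$ (2*m+1-i,j) * N $$ (i,j))"
      by (rule sum.reindex_bij_witness[of _ "\<lambda>i. m-1-i" "\<lambda>i. m-1-i"])
        (use j in \<open>auto simp: A_def C_def mult.commute intro!: arg_cong2[where f = "(*)"] arg_cong2[where f = "($$)"]\<close>)
    finally have S: "(transpose_mat A * antidiag m * C) $$ (j,j) = (\<Sum>i<m. N $$ (2*m+1-i,j) * N $$ (i,j))" .
    define z where "z = N *\<^sub>v unit_vec ?n j"
    have w: "z $ i = N $$ (i,j)" if "i < ?n" for i
      unfolding z_def using that j c by simp
    have "(\<Sum>i<m. z $ (2*m+1-i) * z $ i) = (\<Sum>i<m. N $$ (2*m+1-i,j) * N $$ (i,j))"
      by (intro sum.cong refl arg_cong2[where f = "(*)"] w) auto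
    note w' = this w[of m] w[of "m+1"]
    \<comment> \<open>The column \<open>z\<close> is the image of a unit vector with
      \<open>j < m\<close>, which is singular.\<close>
    have "0 = qform m a z"
      unfolding z_def using Q[of "unit_vec ?n j"] qform_unit_vec[of j m a] j by simp
    also have "\<dots> = (\<Sum>i<m. N $$ (2*m+1-i,j) * N $$ (i,j)) + (N $$ (m,j))\<^sup>2 + N $$ (m,j) * N $$ (m+1,j) + a * (N $$ (m+1,j))\<^sup>2"
      unfolding qform_def using w' by simp
    finally have "(\<Sum>i<m. N $$ (2*m+1-i,j) * N $$ (i,j)) + (N $$ (m,j))\<^sup>2 + N $$ (m,j) * N $$ (m+1,j) + a * (N $$ (m+1,j))\<^sup>2 = 0"
      by (rule sym)
    then have "(\<Sum>i<m. N $$ (2*m+1-i,j) * N $$ (i,j)) =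
        - ((N $$ (m,j))\<^sup>2 + N $$ (m,j) * N $$ (m+1,j) + a * (N $$ (m+1,j))\<^sup>2)"
      by (simp only: eq_neg_iff_add_eq_0 add.assoc)
    then show ?thesis
      unfolding S minus_eq_self(1)[OF two] using j by (simp add: B_def)
  qed
  ultimately show ?thesis
    unfolding G1_def Let_def using N car by blast
qed

section \<open>Siegel transformations\<close>

text \<open>
  The matrix of \<open>v \<mapsto> v + \<beta>(v,w) u + (\<beta>(v,u) + Q(u) \<beta>(v,w)) w\<close>, where \<open>u\<close> is the \<open>t\<close>-th unit vector and
  \<open>w\<close> is the singular vector with \<open>\<beta>(v,w) = \<Sum>j<d. c\<^sub>j v\<^sub>j\<close>; it is orthogonal to \<open>u\<close>.
\<close>

definition eichler :: "nat \<Rightarrow> 'a::comm_ring_1 \<Rightarrow> nat \<Rightarrow> nat \<Rightarrow> (nat \<Rightarrow> 'a) \<Rightarrow> 'a mat" where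
  "eichler m a t d c = mat (2*m+2) (2*m+2) (\<lambda>(i,j).
     (if i = j then 1 else 0) + (if i = t \<and> j < d then c j else 0) +
     (if 2*m+1-i < d then c (2*m+1-i) else 0) *
       ((if j = 2*m+1-t then 1 else 0) +
        (if t = m then 1 else if t = m+1 then a else 0) * (if j < d then c j else 0)))"

text \<open>The bound \<open>d \<le> m\<close> makes the vector \<open>w\<close> singular,
  \<open>d \<le> t\<close> makes it orthogonal to the unit vector, and
  \<open>d \<le> 2*m+1-t\<close> places its support at indices greater than
  \<open>t\<close>.\<close>

context
  fixes m t d :: nat and a :: "'a::comm_ring_1" and c :: "nat \<Rightarrow> 'a"
  assumes t: "t < 2*m+2" and d: "d \<le> t" "d \<le> m" "d \<le> 2*m+1-t"
begin

lemma eichler_carrier: "eichler m a t d c \<in> carrier_mat (2*m+2) (2*m+2)"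
  by (simp add: eichler_def)

lemma eichler_vec_index:
  assumes v: "v \<in> carrier_vec (2*m+2)" and i: "i < 2*m+2"
  shows "(eichler m a t d c *\<^sub>v v) $ i = v $ i + (if i = t then \<Sum>j<d. c j * v $ j else 0) +
    (if 2*m+1-i < d then c (2*m+1-i) else 0) *
      (v $ (2*m+1-t) + (if t = m then 1 else if t = m+1 then a else 0) * (\<Sum>j<d. c j * v $ j))"
proof -
  let ?n = "2*m+2"
  define w where "w = (if 2*m+1-i < d then c (2*m+1-i) else 0)"
  define Q where "Q = (if t = m then 1 else if t = m+1 then a else 0)"
  define e where "e = (if i = t then 1 else 0 :: 'a)"
  have s: "(\<Sum>j<?n. if j < d then c j * v $ j else 0) = (\<Sum>j<d. c j * v $ j)"
    by (rule sum.mono_neutral_cong_right) (use d in auto)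
  have E: "eichler m a t d c $$ (i,j) = (if i = j then 1 else 0) + e * (if j < d then c j else 0) +
      w * ((if j = 2*m+1-t then 1 else 0) + Q * (if j < d then c j else 0))" if "j < ?n" for j
    unfolding eichler_def w_def Q_def e_def using i that by simp
  have "(eichler m a t d c *\<^sub>v v) $ i = (\<Sum>j<?n. eichler m a t d c $$ (i,j) * v $ j)"
    using v i eichler_carrier by (auto simp: scalar_prod_def atLeast0LessThan intro!: sum.cong)
  also have "\<dots> = (\<Sum>j<?n. (if j = i then v $ j else 0) + e * (if j < d then c j * v $ j else 0)
      + w * ((if j = 2*m+1-t then v $ j else 0) + Q * (if j < d then c j * v $ j else 0)))"
  proof (rule sum.cong[OF refl])
    fix j assume "j \<in> {..<?n}"
    then have j: "j < ?n" by simp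
    have "(if i = j then 1 else 0) * v $ j = (if j = i then v $ j else 0)"
      "(if j = 2*m+1-t then 1 else 0) * v $ j = (if j = 2*m+1-t then v $ j else 0)"
      "(if j < d then c j else 0) * v $ j = (if j < d then c j * v $ j else 0)" by auto
    then show "eichler m a t d c $$ (i,j) * v $ j = (if j = i then v $ j else 0) + e * (if j < d then c j * v $ j else 0)
      + w * ((if j = 2*m+1-t then v $ j else 0) + Q * (if j < d then c j * v $ j else 0))"
      by (simp only: E[OF j] distrib_right mult.assoc)
  qed
  also have "\<dots> = v $ i + e * (\<Sum>j<d. c j * v $ j) + w * (v $ (2*m+1-t) + Q * (\<Sum>j<d. c j * v $ j))"
  proof -
    have "(\<Sum>j<?n. if j = i then v $ j else 0) = v $ i"
      "(\<Sum>j<?n. if j = 2*m+1-t then v $ j else 0) = v $ (2*m+1-t)"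
      by (subst sum.delta; use i t in simp)+
    then show ?thesis by (simp only: sum.distrib sum_distrib_left[symmetric] s)
  qed
  finally show ?thesis by (simp add: w_def Q_def e_def)
qed

text \<open>Only coordinate \<open>t\<close> and the last \<open>d\<close> coordinates change. The
  sum over the pairs gains \<open>\<beta> * \<alpha>\<close>, and also
  \<open>\<alpha> * v $ (2*m+1-t)\<close> if \<open>t\<close> is not a middle index; in the middle
  case the terms in coordinates \<open>m\<close> and \<open>m+1\<close> gain the same amount
  \<open>\<beta> * \<alpha>\<close>. In characteristic two everything cancels.\<close>

lemma qform_eichler:
  assumes two: "(2::'a) = 0" and v: "v \<in> carrier_vec (2*m+2)"
  shows "qform m a (eichler m a t d c *\<^sub>v v) = qform m a v"
proof -
  define Q where "Q = (if t = m then 1 else if t = m+1 then a else 0)"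
  define \<alpha> where "\<alpha> = (\<Sum>j<d. c j * v $ j)"
  define \<beta> where "\<beta> = v $ (2*m+1-t) + Q * \<alpha>"
  define z where "z = eichler m a t d c *\<^sub>v v"
  have z: "z $ i = v $ i + (if i = t then \<alpha> else 0) + (if 2*m+1-i < d then c (2*m+1-i) else 0) * \<beta>"
    if "i < 2*m+2" for i
    unfolding z_def \<beta>_def \<alpha>_def Q_def by (rule eichler_vec_index[OF v that])
  have prod: "z $ (2*m+1-i) * z $ i = v $ (2*m+1-i) * v $ i + (if i = t then \<alpha> * v $ (2*m+1-t) else 0)
      + (if i = 2*m+1-t then \<alpha> * v $ (2*m+1-t) else 0) + \<beta> * (if i < d then c i * v $ i else 0)"
    if i: "i < m" for i
  proof -
    have "z $ i = v $ i + (if i = t then \<alpha> else 0)" using z[of i] i d by auto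
    moreover have "z $ (2*m+1-i) = v $ (2*m+1-i) + (if i = 2*m+1-t then \<alpha> else 0) + (if i < d then c i else 0) * \<beta>"
      using z[of "2*m+1-i"] i t by auto
    ultimately show ?thesis using i d t by (auto simp: algebra_simps)
  qed
  have s: "(\<Sum>i<m. if i < d then c i * v $ i else 0) = \<alpha>"
    unfolding \<alpha>_def by (rule sum.mono_neutral_cong_right) (use d in auto)
  have "(\<Sum>i<m. z $ (2*m+1-i) * z $ i) = (\<Sum>i<m. v $ (2*m+1-i) * v $ i + (if i = t then \<alpha> * v $ (2*m+1-t) else 0)
      + (if i = 2*m+1-t then \<alpha> * v $ (2*m+1-t) else 0) + \<beta> * (if i < d then c i * v $ i else 0))"
    by (rule sum.cong) (simp_all only: prod lessThan_iff)
  also have "\<dots> = (\<Sum>i<m. v $ (2*m+1-i) * v $ i) + (if t < m then \<alpha> * v $ (2*m+1-t) else 0)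
      + (if 2*m+1-t < m then \<alpha> * v $ (2*m+1-t) else 0) + \<beta> * \<alpha>"
    unfolding sum.distrib sum_distrib_left[symmetric] s by simp
  finally have sum: "(\<Sum>i<m. z $ (2*m+1-i) * z $ i) = (\<Sum>i<m. v $ (2*m+1-i) * v $ i)
      + ((if t < m \<or> t > m+1 then \<alpha> * v $ (2*m+1-t) else 0) + \<beta> * \<alpha>)"
    using t by auto
  have zm: "z $ m = v $ m + (if t = m then \<alpha> else 0)" "z $ (m+1) = v $ (m+1) + (if t = m+1 then \<alpha> else 0)"
    using z[of m] z[of "m+1"] d by auto
  have xx: "x + x = 0" "x + (x + y) = y" for x y :: 'a
    using minus_eq_self(3)[OF two, of x] by (simp_all flip: add.assoc)
  consider "t < m \<or> t > m+1" | "t = m" | "t = m+1" by linarith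
  then have "qform m a z = qform m a v"
  proof cases
    case 1
    then show ?thesis unfolding qform_def sum zm by (auto simp: \<beta>_def Q_def mult.commute xx)
  next
    case 2
    then show ?thesis unfolding qform_def sum zm
      by (simp add: \<beta>_def Q_def power2_eq_square algebra_simps xx)
  next
    case 3
    then show ?thesis unfolding qform_def sum zm
      by (simp add: \<beta>_def Q_def power2_eq_square algebra_simps xx)
  qed
  then show ?thesis by (simp only: z_def)
qed

lemma eichler_unitri: "eichler m a t d c \<in> unitri (2*m+2)" "eichler m a t d c $$ (m+1,m) = 0"
  using t d by (auto simp: unitri_def eichler_def)

text \<open>Reflection in the antidiagonal inverts an isometry, by \<open>mat_inverse_index\<close>.
  In characteristic two the transformation is therefore an involution, and its action on variables
  can be read off its own rows.\<close>

lemma eichler_symmetric: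
  assumes "i < 2*m+2" "j < 2*m+2"
  shows "eichler m a t d c $$ (2*m+1-j, 2*m+1-i) = eichler m a t d c $$ (i,j)"
proof -
  define Q where "Q = (if t = m then 1 else if t = m+1 then a else 0)"
  have E: "eichler m a t d c $$ (i,j) = (if i = j then 1 else 0) + (if i = t then if j < d then c j else 0 else 0) +
      (if 2*m+1-i < d then c (2*m+1-i) else 0) * ((if j = 2*m+1-t then 1 else 0) + Q * (if j < d then c j else 0))"
    if "i < 2*m+2" "j < 2*m+2" for i j
    unfolding eichler_def Q_def using that by simp
  have eqs: "(2*m+1-j = 2*m+1-i) = (i = j)" "(2*m+1-j = t) = (j = 2*m+1-t)" "(2*m+1-i = 2*m+1-t) = (i = t)"
    "2*m+1-(2*m+1-j) = j" using assms t by auto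
  have less: "2*m+1-j < 2*m+2" "2*m+1-i < 2*m+2" by auto
  have swap: "\<delta> + (if B then x else 0) + y * ((if A then 1 else 0) + Q * x) =
      \<delta> + (if A then y else 0) + x * ((if B then 1 else 0) + Q * y)" for A B and \<delta> x y :: 'a
    by (simp add: algebra_simps)
  show ?thesis unfolding E[OF assms] E[OF less] eqs by (rule swap)
qed

lemma eichler_row:
  assumes "i \<le> t" "j < 2*m+2"
  shows "eichler m a t d c $$ (i,j) = (if i = j then 1 else 0) + (if i = t \<and> j < d then c j else 0)"
  using assms t d by (auto simp: eichler_def)

end

section \<open>The action on variables and their orbits\<close>

lemma eichler_G1:
  fixes a :: "'a::{finite,field}"
  assumes card: "CARD('a) = 2 ^ r" and t: "t < 2*m+2" and d: "d \<le> t" "d \<le> m" "d \<le> 2*m+1-t"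
  shows "eichler m a t d c \<in> G1 m a"
  by (rule G1I[OF two_eq_0[OF card]])
    (use eichler_unitri[OF t d] qform_eichler[OF t d two_eq_0[OF card]] in auto)

lemma mat_inverse_G1:
  fixes a :: "'a::{finite,field}"
  assumes card: "CARD('a) = 2 ^ r" and N: "N \<in> G1 m a" and ij: "i < 2*m+2" "j < 2*m+2"
  shows "the (mat_inverse N) $$ (i,j) = N $$ (2*m+1-j, 2*m+1-i)"
  using mat_inverse_index[OF G1D(2,6)[OF card N] ij] by simp

text \<open>Provides the conjugates of \<open>x_t\<close> under the stabilizer of the earlier
  variables. Variables count from 1 and matrix rows from 0, so the Siegel transformation is taken at
  \<open>t - 1\<close>.\<close>

lemma mpoly_act_eichler:
  fixes a :: "'a::{finite,field}"
  assumes card: "CARD('a) = 2 ^ r" and t: "1 \<le> t" "t \<le> 2*m+2"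
    and d: "d \<le> t - 1" "d \<le> m" "d \<le> 2*m+2-t"
  shows "\<exists>g\<in>G1 m a. (\<forall>i\<in>{1..<t}. mpoly_act (2*m+2) g (Var i) = Var i) \<and>
    mpoly_act (2*m+2) g (Var t) = Var t + (\<Sum>l=1..d. Const (c l) * Var l)"
proof -
  interpret K: comm_ring_hom "Const :: 'a \<Rightarrow> 'a mpoly" by (rule comm_ring_hom_Const)
  define g where "g = eichler m a (t-1) d (\<lambda>j. c (Suc j))"
  have t': "t - 1 < 2*m+2" and d': "d \<le> t - 1" "d \<le> m" "d \<le> 2*m+1-(t-1)" using t d by auto
  have g: "g \<in> G1 m a" unfolding g_def by (rule eichler_G1[OF card t' d'])
  have act: "mpoly_act (2*m+2) g (Var i) = Var i + (if i = t then \<Sum>l=1..d. Const (c l) * Var l else 0)"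
    if i: "1 \<le> i" "i \<le> t" for i
  proof -
    have "mpoly_act (2*m+2) g (Var i) = (\<Sum>j=1..2*m+2. Const (g $$ (i-1, j-1)) * Var j)"
      unfolding mpoly_act_Var
    proof (rule sum.cong[OF refl])
      fix j assume j: "j \<in> {1..2*m+2}"
      have "the (mat_inverse g) $$ (i-1, j-1) = g $$ (2*m+1-(j-1), 2*m+1-(i-1))"
        by (rule mat_inverse_G1[OF card g]) (use i j t in auto)
      also have "\<dots> = g $$ (i-1, j-1)"
        unfolding g_def by (rule eichler_symmetric[OF t' d']) (use i j t in auto)
      finally show "Const (the (mat_inverse g) $$ (i-1, j-1)) * Var j = Const (g $$ (i-1, j-1)) * Var j"
        by simp
    qed
    also have "\<dots> = (\<Sum>j=1..2*m+2. (if j = i then Var j else 0) +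
        (if i = t then (if j \<le> d then Const (c j) * Var j else 0) else 0))"
    proof (rule sum.cong[OF refl])
      fix j assume j: "j \<in> {1..2*m+2}"
      have "g $$ (i-1, j-1) = (if i-1 = j-1 then 1 else 0) + (if i-1 = t-1 \<and> j-1 < d then c (Suc (j-1)) else 0)"
        unfolding g_def by (rule eichler_row[OF t' d']) (use i j in auto)
      also have "\<dots> = (if j = i then 1 else 0) + (if i = t \<and> j \<le> d then c j else 0)"
        using i j t by auto
      finally show "Const (g $$ (i-1, j-1)) * Var j = (if j = i then Var j else 0) +
          (if i = t then (if j \<le> d then Const (c j) * Var j else 0) else 0)"
        by (auto simp: K.hom_add algebra_simps)
    qed
    also have "\<dots> = Var i + (if i = t then (\<Sum>j=1..2*m+2. if j \<le> d then Const (c j) * Var j else 0) else 0)"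
      using i t by (simp add: sum.distrib)
    also have "(\<Sum>j=1..2*m+2. if j \<le> d then Const (c j) * Var j else 0) = (\<Sum>l=1..d. Const (c l) * Var l)"
      by (rule sum.mono_neutral_cong_right) (use d in auto)
    finally show ?thesis .
  qed
  show ?thesis
    using act t by (intro bexI[OF _ g]) auto
qed

text \<open>The inverse of \<open>g\<close> is unitriangular, so only variables up to
  \<open>x_t\<close> occur in the image. The bound \<open>m\<close> reflects the middle block: for
  \<open>t = m+2\<close> the coefficient of \<open>x_{m+1}\<close> vanishes. All remaining
  combinations are realized by Siegel transformations.\<close>

lemma orbit_Var:
  fixes a :: "'a::{finite,field}"
  assumes card: "CARD('a) = 2 ^ r" and t: "1 \<le> t" "t \<le> m+2"
  shows "(\<lambda>g. mpoly_act (2*m+2) g (Var t)) ` G1 m a =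
    range (\<lambda>c. Var t + (\<Sum>l=1..min (t-1) m. Const (c l) * Var l))"
proof
  interpret K: comm_ring_hom "Const :: 'a \<Rightarrow> 'a mpoly" by (rule comm_ring_hom_Const)
  let ?d = "min (t-1) m"
  show "(\<lambda>g. mpoly_act (2*m+2) g (Var t)) ` G1 m a \<subseteq> range (\<lambda>c. Var t + (\<Sum>l=1..?d. Const (c l) * Var l))"
  proof (rule image_subsetI)
    fix g assume g: "g \<in> G1 m a"
    define c where "c l = the (mat_inverse g) $$ (t-1, l-1)" for l
    have c: "c l = g $$ (2*m+1-(l-1), 2*m+1-(t-1))" if "l \<in> {1..2*m+2}" for l
      unfolding c_def by (rule mat_inverse_G1[OF card g]) (use that t in auto)
    have u: "g \<in> unitri (2*m+2)" using G1D(1)[OF card g] .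
    have "c t = 1" using c[of t] u t unfolding unitri_def by auto
    moreover have "c l = 0" if l: "l \<in> {1..2*m+2}" "l \<noteq> t" "l \<notin> {1..?d}" for l
    proof (cases "l > t")
      case True
      then have "g $$ (2*m+1-(l-1), 2*m+1-(t-1)) = 0"
        using u l t unfolding unitri_def by auto
      then show ?thesis using c l by simp
    next
      case False
      then have "t = m+2" "l = m+1" using l t by auto
      then show ?thesis using c[of l] G1D(4)[OF card g] by simp
    qed
    ultimately have "(\<Sum>l=1..2*m+2. Const (c l) * Var l) = (\<Sum>l\<in>insert t {1..?d}. Const (c l) * Var l)"
      by (intro sum.mono_neutral_right) (use t in \<open>auto simp: K.hom_zero\<close>)
    also have "\<dots> = Var t + (\<Sum>l=1..?d. Const (c l) * Var l)"
      using \<open>c t = 1\<close> t by (subst sum.insert) auto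
    finally have "mpoly_act (2*m+2) g (Var t) = Var t + (\<Sum>l=1..?d. Const (c l) * Var l)"
      unfolding mpoly_act_Var c_def .
    then show "mpoly_act (2*m+2) g (Var t) \<in> range (\<lambda>c. Var t + (\<Sum>l=1..?d. Const (c l) * Var l))"
      by (intro range_eqI[where x = c])
  qed
  show "range (\<lambda>c. Var t + (\<Sum>l=1..?d. Const (c l) * Var l)) \<subseteq> (\<lambda>g. mpoly_act (2*m+2) g (Var t)) ` G1 m a"
  proof (rule image_subsetI)
    fix c :: "nat \<Rightarrow> 'a"
    have "1 \<le> t" "t \<le> 2*m+2" "?d \<le> t - 1" "?d \<le> m" "?d \<le> 2*m+2-t" using t by auto
    from mpoly_act_eichler[OF card this, of a c] obtain g where g: "g \<in> G1 m a"
      "mpoly_act (2*m+2) g (Var t) = Var t + (\<Sum>l=1..?d. Const (c l) * Var l)" by blast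
    show "Var t + (\<Sum>l=1..?d. Const (c l) * Var l) \<in> (\<lambda>g. mpoly_act (2*m+2) g (Var t)) ` G1 m a"
      unfolding g(2)[symmetric] by (rule imageI[OF g(1)])
  qed
qed

section \<open>Invariance of the forms \<open>h_k\<close>\<close>

lemma qform_map_vec:
  assumes "comm_ring_hom h" "v \<in> carrier_vec (2*m+2)"
  shows "qform m (h a) (map_vec h v) = h (qform m a v)"
proof -
  interpret comm_ring_hom h by fact
  have "(\<Sum>i<m. map_vec h v $ (2*m+1-i) * map_vec h v $ i) = h (\<Sum>i<m. v $ (2*m+1-i) * v $ i)"
    unfolding hom_sum by (rule sum.cong) (use assms(2) in \<open>auto simp: hom_mult\<close>)
  then show ?thesis using assms(2)
    by (simp add: qform_def hom_add hom_mult hom_power)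
qed

text \<open>Equality of values over a finite field does not give a polynomial identity, so the
  isometry is transferred to vectors over a larger ring. Preservation of the polar form is a matrix
  identity and survives \<open>h\<close>; the difference of the two quadratic forms is then
  additive, and on unit vectors it comes from the original ring.\<close>

lemma qform_preserved_extend:
  fixes P :: "'a::comm_ring_1 mat" and h :: "'a \<Rightarrow> 'b::comm_ring_1"
  assumes h: "comm_ring_hom h" and two: "(2::'a) = 0"
    and P: "P \<in> carrier_mat (2*m+2) (2*m+2)"
    and Q: "\<And>v. v \<in> carrier_vec (2*m+2) \<Longrightarrow> qform m a (P *\<^sub>v v) = qform m a v"
    and v: "v \<in> carrier_vec (2*m+2)"
  shows "qform m (h a) (map_mat h P *\<^sub>v v) = qform m (h a) v"
proof -
  interpret comm_ring_hom h by fact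
  let ?n = "2*m+2" and ?P = "map_mat h P"
  have two': "(2::'b) = 0" by (metis hom_add hom_one hom_zero one_add_one two)
  have P': "?P \<in> carrier_mat ?n ?n" using P by simp
  have J: "antidiag ?n \<in> carrier_mat ?n ?n" for n by (rule antidiag_carrier)
  have mJ: "map_mat h (antidiag ?n) = antidiag ?n" by (rule eq_matI) (auto simp: antidiag_def)
  have "transpose_mat P * antidiag ?n * P = antidiag ?n"
    unfolding bform_preserved_iff[OF P] using bform_preserved[OF two P Q] by blast
  then have m1: "map_mat h (transpose_mat P * antidiag ?n * P) = antidiag ?n" using mJ by (simp only:)
  have m2: "map_mat h (transpose_mat P * antidiag ?n * P) = map_mat h (transpose_mat P) * map_mat h (antidiag ?n) * ?P"
    using P antidiag_carrier[where 'a='a, of ?n] by (simp add: mat_hom_mult[of _ ?n ?n _ ?n] del: add_2_eq_Suc')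
  have "transpose_mat ?P * antidiag ?n * ?P = antidiag ?n"
    using trans[OF m2[symmetric] m1] unfolding mJ map_mat_transpose .
  then have b: "bform m (?P *\<^sub>v u) (?P *\<^sub>v v) = bform m u v" if "u \<in> carrier_vec ?n" "v \<in> carrier_vec ?n" for u v
    using that unfolding bform_preserved_iff[OF P'] by blast
  have "qform m (h a) (?P *\<^sub>v v) - qform m (h a) v = 0"
  proof (rule quadratic_zero[OF _ _ _ v])
    fix u v :: "'b vec" assume uv: "u \<in> carrier_vec ?n" "v \<in> carrier_vec ?n"
    then have Puv: "?P *\<^sub>v u \<in> carrier_vec ?n" "?P *\<^sub>v v \<in> carrier_vec ?n" using P' by auto
    show "qform m (h a) (?P *\<^sub>v (u + v)) - qform m (h a) (u + v) =
        qform m (h a) (?P *\<^sub>v u) - qform m (h a) u + (qform m (h a) (?P *\<^sub>v v) - qform m (h a) v)"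
      unfolding mult_add_distrib_mat_vec[OF P' uv] qform_add[OF two' uv] qform_add[OF two' Puv] b[OF uv]
      by simp
  next
    fix c and v :: "'b vec" assume v: "v \<in> carrier_vec ?n"
    then have Pv: "?P *\<^sub>v v \<in> carrier_vec ?n" using P' by auto
    have cv: "?P *\<^sub>v (c \<cdot>\<^sub>v v) = c \<cdot>\<^sub>v (?P *\<^sub>v v)"
      using P' v by (intro eq_vecI) auto
    show "qform m (h a) (?P *\<^sub>v (c \<cdot>\<^sub>v v)) - qform m (h a) (c \<cdot>\<^sub>v v) =
        c\<^sup>2 * (qform m (h a) (?P *\<^sub>v v) - qform m (h a) v)"
      unfolding cv qform_smult[OF v] qform_smult[OF Pv] by (simp only: right_diff_distrib)
  next
    fix j assume j: "j < ?n"
    have u: "map_vec h (unit_vec ?n j) = unit_vec ?n j"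
      by (rule eq_vecI) (auto simp: unit_vec_def)
    have "?P *\<^sub>v unit_vec ?n j = map_vec h (P *\<^sub>v unit_vec ?n j)"
      using P j by (intro eq_vecI) auto
    then have "qform m (h a) (?P *\<^sub>v unit_vec ?n j) = h (qform m a (P *\<^sub>v unit_vec ?n j))"
      using P qform_map_vec[OF h, of "P *\<^sub>v unit_vec ?n j" m a] by simp
    moreover have "qform m (h a) (unit_vec ?n j) = h (qform m a (unit_vec ?n j))"
      using qform_map_vec[OF h, of "unit_vec ?n j" m a] u by simp
    ultimately show "qform m (h a) (?P *\<^sub>v unit_vec ?n j) - qform m (h a) (unit_vec ?n j) = 0"
      using Q[of "unit_vec ?n j"] by simp
  qed
  then show ?thesis by simp
qed

text \<open>Taking for \<open>A\<close> the action or the identity reduces invariance of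
  \<open>h_1\<close> to that of \<open>qform\<close>, and invariance of the other \<open>h_k\<close>
  to that of \<open>bform\<close> between the coordinate vector and its Frobenius power.\<close>

lemma h_poly_hom:
  fixes a :: "'a::{finite,field}" and A :: "'a mpoly \<Rightarrow> 'a mpoly"
  assumes A: "comm_ring_hom A" "A (Const a) = Const a"
  shows "A (h_poly m a 1) = qform m (Const a) (vec (2*m+2) (\<lambda>i. A (Var (Suc i))))"
    and "k \<noteq> 1 \<Longrightarrow> A (h_poly m a k) = bform m (vec (2*m+2) (\<lambda>i. A (Var (Suc i))))
      (vec (2*m+2) (\<lambda>i. A (Var (Suc i)) ^ (CARD('a) ^ (k-1))))"
proof -
  interpret comm_ring_hom A by (rule A)
  have idx: "2*m+3 - Suc i = Suc (2*m+1-i)" if "i < m+1" for i using that by simp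
  have 1: "(\<Sum>i=1..m. A (Var (2*m+3-i)) * A (Var i)) = (\<Sum>i<m. A (Var (Suc (2*m+1-i))) * A (Var (Suc i)))"
    unfolding One_nat_def sum.atLeast1_atMost_eq by (intro sum.cong refl) (simp add: idx)
  show "A (h_poly m a 1) = qform m (Const a) (vec (2*m+2) (\<lambda>i. A (Var (Suc i))))"
    unfolding h_poly_def qform_def
    by (simp add: hom_add hom_mult hom_sum hom_power A(2) 1 Suc_eq_plus1[symmetric] del: One_nat_def)
  assume k: "k \<noteq> 1"
  define q where "q = CARD('a) ^ (k-1)"
  have "A (h_poly m a k) = (\<Sum>i=1..m+1. A (Var (2*m+3-i)) ^ q * A (Var i) + A (Var (2*m+3-i)) * A (Var i) ^ q)"
    using k unfolding h_poly_def q_def by (simp add: hom_add hom_mult hom_sum hom_power del: One_nat_def sum.cl_ivl_Suc)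
  also have "\<dots> = (\<Sum>i<m+1. A (Var (Suc (2*m+1-i))) ^ q * A (Var (Suc i)) + A (Var (Suc (2*m+1-i))) * A (Var (Suc i)) ^ q)"
    unfolding One_nat_def sum.atLeast1_atMost_eq by (intro sum.cong refl) (simp add: idx)
  also have "\<dots> = bform m (vec (2*m+2) (\<lambda>i. A (Var (Suc i)))) (vec (2*m+2) (\<lambda>i. A (Var (Suc i)) ^ q))"
    unfolding bform_split by (simp add: algebra_simps sum.distrib)
  finally show "A (h_poly m a k) = bform m (vec (2*m+2) (\<lambda>i. A (Var (Suc i)))) (vec (2*m+2) (\<lambda>i. A (Var (Suc i)) ^ (CARD('a) ^ (k-1))))"
    unfolding q_def .
qed

lemma mpoly_act_h_poly:
  fixes a :: "'a::{finite,field}"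
  assumes card: "CARD('a) = 2 ^ r" and g: "g \<in> G1 m a"
  shows "mpoly_act (2*m+2) g (h_poly m a k) = h_poly m a k"
proof -
  let ?n = "2*m+2"
  interpret K: comm_ring_hom "Const :: 'a \<Rightarrow> 'a mpoly" by (rule comm_ring_hom_Const)
  note two = two_eq_0[OF card] and two' = two_eq_0_fract(1)[OF card]
  define P where "P = the (mat_inverse g)"
  note G = G1D(2,3)[OF card g]
  note inv = mat_inverse_invertible[OF G, folded P_def]
  have P: "P \<in> carrier_mat ?n ?n" by (rule inv)
  have Q: "qform m a (P *\<^sub>v v) = qform m a v" if v: "v \<in> carrier_vec ?n" for v
  proof -
    have "qform m a (P *\<^sub>v v) = qform m a (g *\<^sub>v (P *\<^sub>v v))"
      by (rule G1D(5)[OF card g, symmetric]) (use P v in auto)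
    also have "g *\<^sub>v (P *\<^sub>v v) = v"
      using assoc_mult_mat_vec[OF G(1) P v] inv(2) v by simp
    finally show ?thesis .
  qed
  let ?P = "map_mat Const P"
  have P': "?P \<in> carrier_mat ?n ?n" using P by simp
  have Q': "qform m (Const a) (?P *\<^sub>v v) = qform m (Const a) v" if "v \<in> carrier_vec ?n" for v
    by (rule qform_preserved_extend[OF comm_ring_hom_Const two P _ that]) (rule Q)
  define Y :: "nat \<Rightarrow> 'a mpoly vec" where "Y e = vec ?n (\<lambda>i. Var (Suc i) ^ e)" for e
  have Y: "Y e \<in> carrier_vec ?n" for e by (simp add: Y_def)
  \<comment> \<open>Frobenius powers are additive and fix the entries of \<open>P\<close>, so the
    vector of powers is transformed by the same matrix as the vector of variables.\<close>
  have act: "vec ?n (\<lambda>i. mpoly_act ?n g (Var (Suc i)) ^ (CARD('a) ^ k)) = ?P *\<^sub>v Y (CARD('a) ^ k)" for k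
  proof (rule eq_vecI)
    fix i assume "i < dim_vec (?P *\<^sub>v Y (CARD('a) ^ k))"
    then have i: "i < ?n" using P by simp
    have "c ^ (CARD('a) ^ k) = c" for c :: 'a
      by (induction k) (simp_all add: power_mult finite_field_power_card)
    then have cf: "Const c ^ (CARD('a) ^ k) = Const c" for c :: 'a by (metis K.hom_power)
    have "mpoly_act ?n g (Var (Suc i)) ^ (CARD('a) ^ k) =
        (\<Sum>j=1..?n. Const (P $$ (i, j-1)) * Var j ^ (CARD('a) ^ k))"
      unfolding mpoly_act_Var P_def[symmetric]
      by (simp only: frob_sum[OF two' card] power_mult_distrib cf diff_Suc_1)
    also have "\<dots> = (\<Sum>j<?n. Const (P $$ (i,j)) * Var (Suc j) ^ (CARD('a) ^ k))"
      by (rule sum.reindex_bij_witness[of _ Suc "\<lambda>j. j - 1"]) auto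
    also have "\<dots> = (?P *\<^sub>v Y (CARD('a) ^ k)) $ i"
      using i P by (auto simp: Y_def scalar_prod_def atLeast0LessThan intro!: sum.cong)
    finally show "vec ?n (\<lambda>i. mpoly_act ?n g (Var (Suc i)) ^ (CARD('a) ^ k)) $ i = (?P *\<^sub>v Y (CARD('a) ^ k)) $ i"
      using i by simp
  qed (use P in simp)
  have hom: "comm_ring_hom (mpoly_act ?n g)" "mpoly_act ?n g (Const a) = Const a"
    by (rule comm_ring_hom_mpoly_act mpoly_act_Const)+
  have id: "comm_ring_hom (\<lambda>p::'a mpoly. p)" "(\<lambda>p::'a mpoly. p) (Const a) = Const a"
    by (rule comm_ring_hom_ident refl)+
  have act1: "vec ?n (\<lambda>i. mpoly_act ?n g (Var (Suc i))) = ?P *\<^sub>v Y 1" using act[of 0] by simp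
  have Y1: "vec ?n (\<lambda>i. Var (Suc i)) = Y 1" by (simp add: Y_def)
  show ?thesis
  proof (cases "k = 1")
    case True
    show ?thesis
      using h_poly_hom(1)[OF hom, of m] h_poly_hom(1)[OF id, of m] Q'[OF Y]
      unfolding True act1 Y1 by (simp only:)
  next
    case False
    have Yk: "vec ?n (\<lambda>i. Var (Suc i) ^ (CARD('a) ^ (k-1))) = Y (CARD('a) ^ (k-1))" by (simp add: Y_def)
    have "bform m (?P *\<^sub>v Y 1) (?P *\<^sub>v Y (CARD('a) ^ (k-1))) = bform m (Y 1) (Y (CARD('a) ^ (k-1)))"
      by (rule bform_preserved[OF two' P' _ Y Y]) (rule Q')
    then show ?thesis
      using h_poly_hom(2)[OF hom False, of m] h_poly_hom(2)[OF id False, of m]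
      unfolding act1 act Y1 Yk by (simp only:)
  qed
qed

section \<open>The invariant field\<close>

abbreviation (input) invariant_gens :: "nat \<Rightarrow> 'a::{finite,field} \<Rightarrow> 'a mpoly fract set" where
  "invariant_gens m a \<equiv> (\<lambda>i. to_fract (orbit_product (2*m+2) (G1 m a) (Var i))) ` {1..m+2}
     \<union> (\<lambda>k. to_fract (h_poly m a k)) ` {1..m}"

text \<open>The field \<open>K\<^sub>t\<close> of the tower: stage \<open>0\<close> is the proposed
  invariant field, and stage \<open>2*m+2\<close> contains all of
  \<open>ratfuns (2*m+2)\<close>.\<close>

definition stage :: "nat \<Rightarrow> 'a::{finite,field} \<Rightarrow> nat \<Rightarrow> 'a mpoly fract set" where
  "stage m a t = field_gen ((\<lambda>i. to_fract (Var i)) ` {1..t} \<union> invariant_gens m a)"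

lemma h_poly_polys: "h_poly m a k \<in> polys (2*m+2)"
proof -
  have v: "(Var i :: 'a mpoly) \<in> polys (2*m+2)" if "i \<in> {1..2*m+2}" for i
    using that polys_simps(4) by auto
  show ?thesis
  proof (cases "k = 1")
    case True
    then show ?thesis unfolding h_poly_def
      by (simp only: if_True simp_thms) (intro polys_simps(3,5,6) polys_sum polys_power v; auto)
  next
    case False
    then show ?thesis unfolding h_poly_def
      by (simp only: if_False) (intro polys_simps(5,6) polys_sum polys_power v; auto)
  qed
qed

lemma finite_G1: "finite (G1 m (a :: 'a::{finite,field}))"
proof (rule finite_subset)
  let ?n = "2*m+2"
  let ?P = "({..<?n} \<times> {..<?n}) \<rightarrow>\<^sub>E (UNIV :: 'a set)"
  show "G1 m a \<subseteq> (\<lambda>f. mat ?n ?n f) ` ?P"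
  proof
    fix N assume "N \<in> G1 m a"
    then have N: "N \<in> carrier_mat ?n ?n" unfolding G1_def unitri_def by blast
    have "N = mat ?n ?n (restrict (\<lambda>ij. N $$ ij) ({..<?n} \<times> {..<?n}))"
      by (rule eq_matI) (use N in auto)
    then show "N \<in> (\<lambda>f. mat ?n ?n f) ` ?P"
      by (rule image_eqI[where x = "restrict (\<lambda>ij. N $$ ij) ({..<?n} \<times> {..<?n})"]) simp
  qed
  show "finite ((\<lambda>f. mat ?n ?n f) ` ?P)" by (intro finite_imageI finite_PiE) auto
qed

section \<open>The tower of stages and its fixed elements\<close>

context
  fixes a :: "'a::{finite,field}" and m r :: nat
  assumes card: "CARD('a) = 2 ^ r"
begin

interpretation S: scalars "\<lambda>c::'a. to_fract (Const c)" "CARD('a)" r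
  by (rule scalars_Const[OF card])

text \<open>The orbit is the coset \<open>x_t + W\<close>, with \<open>W\<close> the span of the
  first \<open>min (t-1) m\<close> variables. As \<open>g\<close> maps \<open>W\<close> into
  \<open>W\<close> and \<open>x_t\<close> into \<open>x_t + W\<close>, it maps this finite set
  injectively into itself and so permutes the factors.\<close>

lemma mpoly_act_orbit_product:
  assumes g: "g \<in> G1 m a" and t: "1 \<le> t" "t \<le> m+2"
  shows "mpoly_act (2*m+2) g (orbit_product (2*m+2) (G1 m a) (Var t)) = orbit_product (2*m+2) (G1 m a) (Var t)"
proof -
  let ?n = "2*m+2" and ?d = "min (t-1) m"
  interpret A: comm_ring_hom "mpoly_act ?n g" by (rule comm_ring_hom_mpoly_act)
  interpret K: comm_ring_hom "Const :: 'a \<Rightarrow> 'a mpoly" by (rule comm_ring_hom_Const)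
  define W where "W = range (\<lambda>c::nat \<Rightarrow> 'a. \<Sum>l=1..?d. Const (c l) * Var l)"
  have WI: "(\<Sum>l=1..?d. Const (c l) * Var l) \<in> W" for c unfolding W_def by (rule rangeI)
  have W_add: "u + v \<in> W" if "u \<in> W" "v \<in> W" for u v
  proof -
    from that obtain c e where "u = (\<Sum>l=1..?d. Const (c l) * Var l)" "v = (\<Sum>l=1..?d. Const (e l) * Var l)"
      unfolding W_def by blast
    then have "u + v = (\<Sum>l=1..?d. Const (c l + e l) * Var l)"
      by (simp add: K.hom_add distrib_right sum.distrib)
    then show ?thesis using WI by (simp only:)
  qed
  have W_smult: "Const b * v \<in> W" if "v \<in> W" for b v
  proof -
    from that obtain e where "v = (\<Sum>l=1..?d. Const (e l) * Var l)"
      unfolding W_def by blast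
    then have "Const b * v = (\<Sum>l=1..?d. Const (b * e l) * Var l)"
      by (simp add: K.hom_mult sum_distrib_left mult.assoc)
    then show ?thesis using WI by (simp only:)
  qed
  have W_sum: "sum f I \<in> W" if "finite I" "\<And>i. i \<in> I \<Longrightarrow> f i \<in> W" for f and I :: "nat set"
    using that
  proof (induction I)
    case empty
    then show ?case using W_smult[OF WI, of 0] by simp
  qed (auto intro: W_add)
  have W_Var: "Var l \<in> W" if "l \<in> {1..?d}" for l
  proof -
    have "(\<Sum>i=1..?d. Const (if i = l then 1 else 0) * Var i) = (\<Sum>i=1..?d. if i = l then Var l else (0 :: 'a mpoly))"
      by (rule sum.cong) auto
    then have "(\<Sum>i=1..?d. Const (if i = l then 1 else 0) * Var i) = (Var l :: 'a mpoly)"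
      using that by simp
    then show ?thesis using WI by metis
  qed
  have orbit: "(\<lambda>g. mpoly_act ?n g (Var s)) ` G1 m a = range (\<lambda>c. Var s + (\<Sum>l=1..min (s-1) m. Const (c l) * Var l))"
    if "1 \<le> s" "s \<le> m+2" for s
    using that by (rule orbit_Var[OF card])
  have act_Var: "\<exists>w\<in>W. mpoly_act ?n g (Var s) = Var s + w" if s: "1 \<le> s" "s \<le> t" for s
  proof -
    have "mpoly_act ?n g (Var s) \<in> range (\<lambda>c. Var s + (\<Sum>l=1..min (s-1) m. Const (c l) * Var l))"
      using orbit[of s] s t g by (metis (no_types, lifting) image_eqI order_trans)
    then obtain c where c: "mpoly_act ?n g (Var s) = Var s + (\<Sum>l=1..min (s-1) m. Const (c l) * Var l)" by blast
    have "(\<Sum>l=1..min (s-1) m. Const (c l) * Var l) \<in> W"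
      by (rule W_sum) (use s in \<open>auto intro!: W_smult W_Var\<close>)
    then show ?thesis using c by blast
  qed
  have act_W: "mpoly_act ?n g w \<in> W" if "w \<in> W" for w
  proof -
    from that obtain c where w: "w = (\<Sum>l=1..?d. Const (c l) * Var l)" unfolding W_def by blast
    have "mpoly_act ?n g (Var l) \<in> W" if "l \<in> {1..?d}" for l
    proof -
      have "1 \<le> l" "l \<le> t" using that by auto
      from act_Var[OF this] W_Var[OF that] W_add show ?thesis by metis
    qed
    then show ?thesis unfolding w A.hom_sum A.hom_mult mpoly_act_Const
      by (intro W_sum W_smult) auto
  qed
  let ?O = "(\<lambda>g. mpoly_act ?n g (Var t)) ` G1 m a"
  have O: "?O = (\<lambda>w. Var t + w) ` W" unfolding orbit[OF t] W_def by (simp add: image_image)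
  have sub: "mpoly_act ?n g ` ?O \<subseteq> ?O"
  proof (rule image_subsetI)
    fix y assume "y \<in> ?O"
    then obtain w where w: "w \<in> W" "y = Var t + w" unfolding O by blast
    obtain w' where w': "w' \<in> W" "mpoly_act ?n g (Var t) = Var t + w'" using act_Var[of t] t by blast
    have "mpoly_act ?n g y = Var t + (w' + mpoly_act ?n g w)"
      unfolding w(2) A.hom_add w'(2) by (rule add.assoc)
    then show "mpoly_act ?n g y \<in> ?O" unfolding O using w w' act_W W_add by blast
  qed
  have "?O \<subseteq> polys ?n"
    using t by (auto intro!: mpoly_act_polys polys_simps)
  then have inj: "inj_on (mpoly_act ?n g) ?O"
  proof (intro inj_onI)
    fix y z assume *: "?O \<subseteq> polys ?n" "y \<in> ?O" "z \<in> ?O" "mpoly_act ?n g y = mpoly_act ?n g z"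
    then have "mpoly_act ?n g (y - z) = 0" unfolding A.hom_minus by (simp only: diff_self)
    moreover have "y - z \<in> polys ?n"
      using * polys_simps(5)[of y ?n "- z"] polys_simps(7)[of z ?n] by (simp add: subset_iff)
    ultimately show "y = z" using mpoly_act_eq_0_iff[OF G1D(2,3)[OF card g]] by simp
  qed
  have fin: "finite ?O" using finite_G1 by blast
  have "mpoly_act ?n g ` ?O = ?O" by (rule endo_inj_surj[OF fin sub inj])
  then have "(\<Prod>y\<in>?O. mpoly_act ?n g y) = (\<Prod>y\<in>?O. y)"
    using prod.reindex[OF inj, of "\<lambda>y. y"] by (simp add: comp_def)
  then show ?thesis unfolding orbit_product_def A.hom_prod .
qed

lemma orbit_product_polys: "1 \<le> t \<Longrightarrow> t \<le> 2*m+2 \<Longrightarrow> orbit_product (2*m+2) (G1 m a) (Var t) \<in> polys (2*m+2)"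
  unfolding orbit_product_def by (intro polys_prod) (auto intro!: mpoly_act_polys polys_simps)

text \<open>Orbit products and the \<open>h_k\<close> are invariant, so a group element that fixes
  the first \<open>t\<close> variables fixes every generator of the stage.\<close>

lemma stage_fixed:
  assumes g: "g \<in> G1 m a" and t: "t \<le> 2*m+2"
    and x: "\<And>i. i \<in> {1..t} \<Longrightarrow> mpoly_act (2*m+2) g (Var i) = Var i"
  shows "stage m a t \<subseteq> {f \<in> ratfuns (2*m+2). ratfun_act (2*m+2) g f = f}"
proof -
  note G = G1D(2,3)[OF card g]
  have I: "to_fract p \<in> {f \<in> ratfuns (2*m+2). ratfun_act (2*m+2) g f = f}"
    if "p \<in> polys (2*m+2)" "mpoly_act (2*m+2) g p = p" for p
    using that ratfun_act_to_fract[OF G that(1)] to_fract_ratfuns by simp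
  show ?thesis
    unfolding stage_def
  proof (rule field_gen_least[OF subfield_ratfun_act_fixed[OF G]])
    show "to_fract (Const c) \<in> {f \<in> ratfuns (2*m+2). ratfun_act (2*m+2) g f = f}" for c
      by (rule I) (rule polys_simps mpoly_act_Const)+
    have "to_fract (Var i) \<in> {f \<in> ratfuns (2*m+2). ratfun_act (2*m+2) g f = f}" if "i \<in> {1..t}" for i
      by (rule I) (use that t x in \<open>auto intro: polys_simps\<close>)
    moreover have "to_fract (orbit_product (2*m+2) (G1 m a) (Var i)) \<in> {f \<in> ratfuns (2*m+2). ratfun_act (2*m+2) g f = f}"
      if "i \<in> {1..m+2}" for i
    proof (rule I)
      have i: "1 \<le> i" "i \<le> m+2" using that by auto
      then show "orbit_product (2*m+2) (G1 m a) (Var i) \<in> polys (2*m+2)"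
        by (intro orbit_product_polys) auto
      show "mpoly_act (2*m+2) g (orbit_product (2*m+2) (G1 m a) (Var i)) = orbit_product (2*m+2) (G1 m a) (Var i)"
        by (rule mpoly_act_orbit_product[OF g i])
    qed
    moreover have "to_fract (h_poly m a k) \<in> {f \<in> ratfuns (2*m+2). ratfun_act (2*m+2) g f = f}" for k
      by (rule I) (rule h_poly_polys mpoly_act_h_poly[OF card g])+
    ultimately show "(\<lambda>i. to_fract (Var i)) ` {1..t} \<union> invariant_gens m a
        \<subseteq> {f \<in> ratfuns (2*m+2). ratfun_act (2*m+2) g f = f}" by blast
  qed
qed

lemma stage_full: "ratfuns (2*m+2) \<subseteq> stage m a (2*m+2)"
  unfolding ratfuns_eq_field_gen stage_def
  by (rule field_gen_least[OF subfield_field_gen]) (auto intro: field_gen_gens)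

lemma stage_gens:
  "to_fract (Const c) \<in> stage m a t"
  "i \<in> {1..t} \<Longrightarrow> to_fract (Var i) \<in> stage m a t"
  "i \<in> {1..m+2} \<Longrightarrow> to_fract (orbit_product (2*m+2) (G1 m a) (Var i)) \<in> stage m a t"
  "k \<in> {1..m} \<Longrightarrow> to_fract (h_poly m a k) \<in> stage m a t"
  unfolding stage_def by (auto intro: field_gen_gens)

lemma subfield_stage: "subfield_set (stage m a t)"
  unfolding stage_def by (rule subfield_field_gen)

section \<open>Equations for single variables over the preceding stage\<close>

abbreviation (input) xspan :: "nat \<Rightarrow> 'a mpoly fract set" where
  "xspan d \<equiv> lspan (\<lambda>c. to_fract (Const c)) (\<lambda>i. to_fract (Var i)) d"

lemma card_xspan: "finite (xspan d)" "card (xspan d) = CARD('a) ^ d"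
proof -
  have "\<forall>i\<in>{1..d}. c i = 0" if "(\<Sum>i=1..d. to_fract (Const (c i)) * to_fract (Var i)) = (0 :: 'a mpoly fract)" for c
    using Var_independent[OF that] by blast
  from S.card_lspan[where x = "\<lambda>i. to_fract (Var i)" and j = d, OF this]
  show "finite (xspan d)" "card (xspan d) = CARD('a) ^ d" by blast+
qed

text \<open>By \<open>orbit_Var\<close> the product of \<open>x_t + w\<close> over the span is the
  orbit product of \<open>x_t\<close>, so subtracting that constant from the product of the
  \<open>T + w\<close> gives a polynomial with root \<open>x_t\<close>.\<close>

lemma eqn_low:
  assumes t: "1 \<le> t" "t \<le> m+2"
  shows "\<exists>Q \<in> subfield_set.polys_over (stage m a (t-1)). Q \<noteq> 0 \<and> poly Q (to_fract (Var t)) = 0 \<and>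
    degree Q \<le> card (xspan (min (t-1) m))"
proof -
  interpret K: subfield_set "stage m a (t-1)" by (rule subfield_stage)
  let ?W = "xspan (min (t-1) m)" and ?N = "to_fract (orbit_product (2*m+2) (G1 m a) (Var t))"
  define L where "L = (\<Prod>w\<in>?W. [:w, 1:])"
  define Q where "Q = L - [:?N:]"
  have W: "w \<in> stage m a (t-1)" if "w \<in> ?W" for w
  proof -
    from that obtain c where "w = (\<Sum>i=1..min (t-1) m. to_fract (Const (c i)) * to_fract (Var i))"
      unfolding lspan_def by blast
    moreover have "to_fract (Var i) \<in> stage m a (t-1)" if "i \<in> {1..min (t-1) m}" for i
      using that by (intro stage_gens(2)) auto
    ultimately show ?thesis by (simp only:) (intro K.mems stage_gens(1))
  qed
  have "L \<in> K.polys_over"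
    unfolding L_def
  proof (intro K.polys_over_prod)
    fix w assume "w \<in> ?W"
    then show "[:w, 1:] \<in> K.polys_over"
      unfolding K.polys_over_def using W[of w] K.zero_mem K.one_mem
      by (auto simp: coeff_pCons split: nat.splits)
  qed
  then have Q: "Q \<in> K.polys_over"
    unfolding Q_def using t by (intro K.polys_over_simps stage_gens) auto
  have dL: "degree L = card ?W"
    unfolding L_def by (subst degree_prod_eq_sum_degree) auto
  \<comment> \<open>The product has positive degree, so it differs from the constant subtracted from
    it.\<close>
  have "card ?W > 0" using card_xspan[of "min (t-1) m"] by simp
  then have "L \<noteq> [:?N:]" using dL by (metis degree_pCons_0 less_irrefl)
  then have "Q \<noteq> 0" by (simp add: Q_def)
  moreover have "degree Q \<le> card ?W"
    unfolding Q_def using dL by (intro degree_diff_le) auto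
  moreover have "poly Q (to_fract (Var t)) = 0"
  proof -
    let ?O = "(\<lambda>g. mpoly_act (2*m+2) g (Var t)) ` G1 m a"
    have "to_fract ` ?O = (\<lambda>w. to_fract (Var t) + w) ` ?W"
      unfolding orbit_Var[OF card t] lspan_def by (simp add: image_image to_fract_sum)
    then have "(\<Prod>y\<in>to_fract ` ?O. y) = (\<Prod>y\<in>(\<lambda>w. to_fract (Var t) + w) ` ?W. y)" by simp
    moreover have "(\<Prod>y\<in>to_fract ` ?O. y) = ?N"
      unfolding orbit_product_def to_fract_prod by (subst prod.reindex) (auto intro: inj_onI)
    moreover have "(\<Prod>y\<in>(\<lambda>w. to_fract (Var t) + w) ` ?W. y) = (\<Prod>w\<in>?W. to_fract (Var t) + w)"
      by (subst prod.reindex) (auto intro: inj_onI)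
    ultimately show ?thesis by (simp add: Q_def L_def poly_prod add.commute)
  qed
  ultimately show ?thesis using Q by blast
qed

text \<open>\<open>qpoly_of_forms\<close> expresses a q-polynomial in \<open>y j\<close> through
  sums over \<open>{1..j}\<close>. These sums differ from \<open>h_1, ..., h_j\<close> only by terms
  in variables before \<open>y j\<close>, hence lie in the preceding stage.\<close>

lemma eqn_high:
  assumes j: "1 \<le> j" "j \<le> m"
  shows "\<exists>Q \<in> subfield_set.polys_over (stage m a (2*m+2-j)). Q \<noteq> 0 \<and>
    poly Q (to_fract (Var (2*m+3-j))) = 0 \<and> degree Q \<le> card (xspan (j-1))"
proof -
  define K where "K = stage m a (2*m+2-j)"
  interpret K: subfield_set K unfolding K_def by (rule subfield_stage)
  define q where "q = CARD('a)"
  have q0: "q > 0" by (simp add: q_def)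
  define x where "x i = (to_fract (Var i) :: 'a mpoly fract)" for i
  define y where "y i = x (2*m+3-i)" for i
  have x: "x i \<in> K" if "1 \<le> i" "i \<le> 2*m+2-j" for i
    using that unfolding x_def K_def by (intro stage_gens) auto
  \<comment> \<open>For \<open>i > j\<close> the index \<open>2*m+3-i\<close> is at most
    \<open>2*m+2-j\<close>, so these variables are already in \<open>K\<close>.\<close>
  have y: "y i \<in> K" if "j < i" "i \<le> m+1" for i
    unfolding y_def by (rule x) (use that j in auto)
  have xj: "x i \<in> K" if "1 \<le> i" "i \<le> m+2" for i by (rule x) (use that j in auto)
  have split: "sum f {1..j} = sum f {1..M} - sum f {j<..M}" if "j \<le> M" for f :: "nat \<Rightarrow> 'a mpoly fract" and M
  proof -
    have "{1..M} = {1..j} \<union> {j<..M}" using that j by auto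
    moreover have "sum f ({1..j} \<union> {j<..M}) = sum f {1..j} + sum f {j<..M}"
      by (rule sum.union_disjoint) auto
    ultimately show ?thesis by (simp only: add_diff_cancel_right')
  qed
  have c1: "(\<Sum>i=1..j. y i * x i) \<in> K"
  proof -
    have "to_fract (h_poly m a 1) = (\<Sum>i=1..m. y i * x i) + x (m+1) ^ 2 + x (m+1) * x (m+2) + to_fract (Const a) * x (m+2) ^ 2"
      unfolding h_poly_def by (simp add: to_fract_sum to_fract_power x_def y_def del: One_nat_def)
    then have "(\<Sum>i=1..m. y i * x i) = to_fract (h_poly m a 1) - (x (m+1) ^ 2 + x (m+1) * x (m+2) + to_fract (Const a) * x (m+2) ^ 2)"
      by (simp add: algebra_simps)
    also have "\<dots> \<in> K"
      using j by (intro K.mems xj) (auto simp: K_def intro: stage_gens)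
    finally show ?thesis
      unfolding split[OF j(2)] using j by (elim K.diff_mem) (intro K.mems xj y; auto)
  qed
  \<comment> \<open>Here \<open>h_{e+1}\<close> is used, and \<open>e < j \<le> m\<close> keeps it
    among the generators. Its sum runs up to \<open>m+1\<close> because it includes the middle
    pair.\<close>
  have ce: "(\<Sum>i=1..j. y i ^ (q ^ e) * x i + y i * x i ^ (q ^ e)) \<in> K" if e: "1 \<le> e" "e < j" for e
  proof -
    have "to_fract (h_poly m a (Suc e)) = (\<Sum>i=1..m+1. y i ^ (q ^ e) * x i + y i * x i ^ (q ^ e))"
      unfolding h_poly_def using e by (simp add: to_fract_sum to_fract_power x_def y_def q_def del: One_nat_def sum.cl_ivl_Suc)
    moreover have "to_fract (h_poly m a (Suc e)) \<in> K"
      unfolding K_def using e j by (intro stage_gens) auto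
    ultimately have "(\<Sum>i=1..m+1. y i ^ (q ^ e) * x i + y i * x i ^ (q ^ e)) \<in> K" by simp
    moreover have "j \<le> m + 1" using j by simp
    ultimately show ?thesis
      unfolding split[OF \<open>j \<le> m + 1\<close>] using j by (elim K.diff_mem) (intro K.mems xj y; auto)
  qed
  have "x (Suc (j-1)) \<notin> lspan (\<lambda>c. to_fract (Const c)) x (j-1)"
  proof
    assume "x (Suc (j-1)) \<in> lspan (\<lambda>c. to_fract (Const c)) x (j-1)"
    then obtain c where c: "x j = (\<Sum>i=1..j-1. to_fract (Const (c i)) * x i)"
      unfolding lspan_def using j by auto
    \<comment> \<open>A representation of \<open>x j\<close> by the earlier variables would be a
      linear relation with coefficient \<open>1\<close> at \<open>x j\<close>.\<close>
    define c' where "c' i = (if i = j then 1 else - c i)" for i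
    have "(\<Sum>i=1..j. to_fract (Const (c' i)) * to_fract (Var i)) = x j + (\<Sum>i=1..j-1. to_fract (Const (c' i)) * x i)"
      using j by (cases j) (simp_all add: c'_def x_def)
    also have "(\<Sum>i=1..j-1. to_fract (Const (c' i)) * x i) = (\<Sum>i=1..j-1. - (to_fract (Const (c i)) * x i))"
    proof (rule sum.cong[OF refl])
      fix i assume "i \<in> {1..j-1}"
      then have "c' i = - c i" by (auto simp: c'_def)
      then show "to_fract (Const (c' i)) * x i = - (to_fract (Const (c i)) * x i)"
        using S.hom_uminus[of "c i"] by simp
    qed
    also have "x j + \<dots> = 0" unfolding c by (simp add: sum_negf)
    finally have "c' j = 0" by (rule Var_independent) (use j in auto)
    then show False by (simp add: c'_def)
  qed
  moreover have "x i \<in> K" if "1 \<le> i" "i \<le> Suc (j-1)" for i by (rule xj) (use that j in auto)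
  ultimately have "\<exists>u. (\<forall>k. u k \<in> K) \<and>
      (\<forall>i\<in>{1..Suc (j-1)}. (\<Sum>k<Suc (j-1). u k * x i ^ (q ^ k)) = (if i = Suc (j-1) then 1 else 0))"
    unfolding q_def by (intro S.dual_qpoly[OF K.subfield_set_axioms])
  moreover have "Suc (j-1) = j" using j by simp
  ultimately obtain u where u: "\<And>k. u k \<in> K"
    and dual: "\<And>i. i \<in> {1..j} \<Longrightarrow> (\<Sum>k<j. u k * x i ^ (q ^ k)) = (if i = j then 1 else 0)"
    by (simp only:) blast
  define \<kappa> where "\<kappa> = (\<Sum>k<j. (u k)\<^sup>2 * (\<Sum>i=1..j. y i * x i) ^ (q ^ k)) +
    (\<Sum>l<j. \<Sum>k<l. u k * u l * (\<Sum>i=1..j. y i ^ (q ^ (l - k)) * x i + y i * x i ^ (q ^ (l - k))) ^ (q ^ k))"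
  have \<kappa>: "\<kappa> \<in> K"
    unfolding \<kappa>_def by (intro K.mems u c1 ce) auto
  define Q where "Q = (\<Sum>k<j. monom (u k) (q ^ k)) - [:\<kappa>:]"
  have pQ: "poly Q z = (\<Sum>k<j. u k * z ^ (q ^ k)) - \<kappa>" for z
    by (simp add: Q_def poly_sum poly_monom)
  have "Q \<in> K.polys_over"
    unfolding Q_def by (intro K.polys_over_simps K.polys_over_sum u \<kappa>)
  moreover have "poly Q (y j) = 0"
    unfolding pQ \<kappa>_def using S.qpoly_of_forms[of j u x y] dual j by (simp add: q_def)
  \<comment> \<open>By \<open>dual\<close> the values of \<open>Q\<close> at \<open>x j\<close> and
    at \<open>0\<close> differ by \<open>1\<close>.\<close>
  moreover have "Q \<noteq> 0"
  proof
    assume "Q = 0"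
    then have "poly Q (x j) = 0" "poly Q 0 = 0" by simp_all
    then show False unfolding pQ using dual[of j] j q0 by (simp add: power_0_left)
  qed
  moreover have "degree Q \<le> q ^ (j-1)"
  proof -
    have "degree (\<Sum>k<j. monom (u k) (q ^ k)) \<le> q ^ (j-1)"
    proof (rule degree_sum_le)
      fix k assume "k \<in> {..<j}"
      then have "q ^ k \<le> q ^ (j-1)" using q0 by (intro power_increasing) auto
      then show "degree (monom (u k) (q ^ k)) \<le> q ^ (j-1)" using degree_monom_le order.trans by blast
    qed simp
    then show ?thesis unfolding Q_def by (intro degree_diff_le) auto
  qed
  ultimately show ?thesis
    using card_xspan(2)[of "j-1"] unfolding K_def[symmetric] y_def x_def q_def by auto
qed

section \<open>Descent through the tower\<close>

lemma stage_descent: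
  assumes t: "1 \<le> t" "t \<le> 2*m+2" and f: "f \<in> stage m a t"
    and inv: "\<And>g. g \<in> G1 m a \<Longrightarrow> ratfun_act (2*m+2) g f = f"
  shows "f \<in> stage m a (t-1)"
proof -
  let ?n = "2*m+2"
  interpret K: subfield_set "stage m a (t-1)" by (rule subfield_stage)
  \<comment> \<open>The largest \<open>d\<close> allowed in \<open>mpoly_act_eichler\<close>. It
    equals \<open>min (t-1) m\<close> for \<open>t \<le> m+2\<close> and \<open>j-1\<close> for
    \<open>t = 2*m+3-j\<close> with \<open>j \<le> m\<close>, matching the degree bounds of
    \<open>eqn_low\<close> and \<open>eqn_high\<close>.\<close>
  define d where "d = min (t-1) (min m (2*m+2-t))"
  have d: "d \<le> t - 1" "d \<le> m" "d \<le> 2*m+2-t" by (auto simp: d_def)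
  obtain Q where Q: "Q \<in> K.polys_over" "Q \<noteq> 0" "poly Q (to_fract (Var t)) = 0" "degree Q \<le> card (xspan d)"
  proof (cases "t \<le> m+2")
    case True
    then have "d = min (t-1) m" by (auto simp: d_def)
    then show ?thesis using eqn_low[OF t(1) True] that by blast
  next
    case False
    define j where "j = 2*m+3-t"
    have j: "1 \<le> j" "j \<le> m" "t = 2*m+3-j" "t - 1 = 2*m+2-j" "d = j-1"
      using False t by (auto simp: j_def d_def)
    from eqn_high[OF j(1,2)] that show ?thesis unfolding j(3)[symmetric] j(4)[symmetric] j(5)[symmetric] by blast
  qed
  let ?S = "(\<lambda>w. to_fract (Var t) + w) ` xspan d"
  show ?thesis
  proof (rule K.descent[OF Q(1-3)])
    show "finite ?S" using card_xspan by blast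
    have "card ?S = card (xspan d)" by (rule card_image) (auto intro: inj_onI)
    then show "degree Q \<le> card ?S" using Q(4) by simp
    have "subfield_set (K.adjoin (to_fract (Var t)))" by (rule K.subfield_adjoin[OF Q(1-3)])
    \<comment> \<open>Among the generators of stage \<open>t\<close> only \<open>x_t\<close> is new
      compared with stage \<open>t-1\<close>.\<close>
    then have "stage m a t \<subseteq> K.adjoin (to_fract (Var t))"
      unfolding stage_def[of m a t]
    proof (rule field_gen_least)
      show "to_fract (Const c) \<in> K.adjoin (to_fract (Var t))" for c
        using K.subset_adjoin(1) stage_gens(1) by blast
      have "to_fract (Var i) \<in> K.adjoin (to_fract (Var t))" if "i \<in> {1..t}" for i
      proof (cases "i = t")
        case True
        then show ?thesis using K.subset_adjoin(2) by simp
      next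
        case False
        then have "i \<in> {1..t-1}" using that by auto
        then show ?thesis using K.subset_adjoin(1) stage_gens(2) by blast
      qed
      moreover have "invariant_gens m a \<subseteq> K.adjoin (to_fract (Var t))"
        using K.subset_adjoin(1) stage_gens(3,4) by blast
      ultimately show "(\<lambda>i. to_fract (Var i)) ` {1..t} \<union> invariant_gens m a \<subseteq> K.adjoin (to_fract (Var t))"
        by blast
    qed
    then show "f \<in> K.adjoin (to_fract (Var t))" using f by blast
  next
    fix s p assume s: "s \<in> ?S" and p: "p \<in> K.polys_over" and fp: "f = poly p (to_fract (Var t))"
    from s obtain c where c: "s = to_fract (Var t) + (\<Sum>l=1..d. to_fract (Const (c l)) * to_fract (Var l))"
      unfolding lspan_def by blast
    \<comment> \<open>This \<open>g\<close> fixes the coefficients of \<open>p\<close> and moves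
      \<open>x_t\<close> to \<open>s\<close>; as \<open>f\<close> is invariant, \<open>p\<close>
      takes the value \<open>f\<close> at \<open>s\<close> too.\<close>
    from mpoly_act_eichler[OF card t d, of a c] obtain g where g: "g \<in> G1 m a"
      and low: "\<And>i. i \<in> {1..<t} \<Longrightarrow> mpoly_act ?n g (Var i) = Var i"
      and gt: "mpoly_act ?n g (Var t) = Var t + (\<Sum>l=1..d. Const (c l) * Var l)" by blast
    have sub: "stage m a (t-1) \<subseteq> {f \<in> ratfuns ?n. ratfun_act ?n g f = f}"
      by (rule stage_fixed[OF g]) (use t low in auto)
    have vt: "(Var t :: 'a mpoly) \<in> polys ?n" using t by (intro polys_simps)
    have "f = ratfun_act ?n g (poly p (to_fract (Var t)))" using inv[OF g] fp by simp
    also have "\<dots> = poly p (ratfun_act ?n g (to_fract (Var t)))"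
      by (rule ratfun_act_poly[OF G1D(2,3)[OF card g] K.subfield_set_axioms _ _ p to_fract_ratfuns[OF vt]])
        (use sub in blast)+
    also have "ratfun_act ?n g (to_fract (Var t)) = s"
      unfolding ratfun_act_to_fract[OF G1D(2,3)[OF card g] vt] gt c by (simp add: to_fract_sum)
    finally show "f = poly p s" .
  qed
qed

text \<open>An invariant lies in the top stage and descends one variable at a time to stage
  \<open>0\<close>. The converse is checked on the generators.\<close>

lemma invariant_field_eq: "invariant_field (2*m+2) (G1 m a) = field_gen (invariant_gens m a)"
proof
  have stage0: "stage m a 0 = field_gen (invariant_gens m a)" by (simp add: stage_def)
  show "invariant_field (2*m+2) (G1 m a) \<subseteq> field_gen (invariant_gens m a)"
  proof
    fix f assume "f \<in> invariant_field (2*m+2) (G1 m a)"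
    then have f: "f \<in> ratfuns (2*m+2)" "\<And>g. g \<in> G1 m a \<Longrightarrow> ratfun_act (2*m+2) g f = f"
      unfolding invariant_field_def by auto
    have "f \<in> stage m a (2*m+2-k)" if "k \<le> 2*m+2" for k
      using that
    proof (induction k)
      case 0
      then show ?case using f stage_full by auto
    next
      case (Suc k)
      then have "f \<in> stage m a (2*m+2-k-1)" by (intro stage_descent f) auto
      then show ?case by simp
    qed
    from this[of "2*m+2"] show "f \<in> field_gen (invariant_gens m a)" by (simp only: stage0 diff_self_eq_0 order_refl)
  qed
  have "field_gen (invariant_gens m a) \<subseteq> {f \<in> ratfuns (2*m+2). ratfun_act (2*m+2) g f = f}" if "g \<in> G1 m a" for g
    using stage_fixed[OF that, of 0] by (simp add: stage0)
  moreover have "field_gen (invariant_gens m a) \<subseteq> ratfuns (2*m+2)"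
  proof (rule field_gen_least[OF subfield_ratfuns])
    have "orbit_product (2*m+2) (G1 m a) (Var i) \<in> polys (2*m+2)" if "i \<in> {1..m+2}" for i
      using that by (intro orbit_product_polys) auto
    then show "invariant_gens m a \<subseteq> ratfuns (2*m+2)"
      using to_fract_ratfuns h_poly_polys by blast
  qed (intro to_fract_ratfuns polys_simps)
  ultimately show "field_gen (invariant_gens m a) \<subseteq> invariant_field (2*m+2) (G1 m a)"
    unfolding invariant_field_def by blast
qed

end

theorem lemma4p21:
  fixes a :: "'a::{finite,field}" and m r :: nat
  assumes "m \<ge> 1"
    and "CARD('a) = 2 ^ r"
    and "irreducible [:a, 1, 1:]"
  shows "invariant_field (2*m+2) (G1 m a) =
    field_gen ((\<lambda>i. to_fract (orbit_product (2*m+2) (G1 m a) (Var i))) ` {1..m+2}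
               \<union> (\<lambda>k. to_fract (h_poly m a k)) ` {1..m})"
  by (rule invariant_field_eq[OF assms(2)])

end
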